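(* Let $a>0$, $0<r<1$, and $$T(a,r)=\{\varphi_{\alpha,p}\;:\;|\alpha|=a,\ |p|=r\},\qquad \varphi_{\alpha,p}(z)=\frac{\alpha}{1-pz}.$$ For every $\varepsilon>0$, there exists $\delta>0$ such that, if $u_0\in H^{1/2}_+$ satisfies $$\inf_{\varphi\in T(a,r)}\|u_0-\varphi\|_{H^{1/2}}\le\delta,$$ then the solution $u$ of $i\partial_tu=\Pi(|u|^2u)$ with $u(0)=u_0$ satisfies $$\sup_{t\in\mathbb R}\ \inf_{\varphi\in T(a,r)}\|u(t)-\varphi\|_{H^{1/2}}\le\varepsilon.$$
   Context: $\mathbb S^1$ is the unit circle in $\mathbb C$; $E_+$ denotes the subspace of elements $u$ of a space $E$ of distributions on $\mathbb S^1$ with $\hat u(k)=0$ for all $k<0$; $H^{1/2}_+=(H^{1/2}(\mathbb S^1))_+$ with $\|u\|_{H^{1/2}}^2=\sum_{k\ge0}(k+1)|\hat u(k)|^2$; $\Pi:L^2(\mathbb S^1)\to L^2_+$ is the orthogonal projector. For each $u_0\in H^{1/2}_+$ the equation has a unique solution $u\in C(\mathbb R,H^{1/2}_+)$ with $u(0)=u_0$. *)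

theory Defs
  imports "HOL-Analysis.Analysis"
begin

text \<open>
  Elements of the function spaces below are represented by functions
  \<open>complex \<Rightarrow> complex\<close>; only their values on the unit circle matter, and two functions
  represent the same element iff they agree almost everywhere with respect to \<open>circle\<close>.
\<close>

definition circle :: "complex measure" where
  "circle = distr (uniform_measure lborel {0..2 * pi}) (restrict_space borel (sphere 0 1)) cis"

definition L2 :: "(complex \<Rightarrow> complex) set" where
  "L2 = {u \<in> borel_measurable circle. integrable circle (\<lambda>z. (cmod (u z))\<^sup>2)}"

definition L2_inner :: "(complex \<Rightarrow> complex) \<Rightarrow> (complex \<Rightarrow> complex) \<Rightarrow> complex" where
  "L2_inner u v = (LINT z|circle. u z * cnj (v z))"

definition L2_norm :: "(complex \<Rightarrow> complex) \<Rightarrow> real" where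
  "L2_norm u = sqrt (LINT z|circle. (cmod (u z))\<^sup>2)"

definition fourier :: "(complex \<Rightarrow> complex) \<Rightarrow> int \<Rightarrow> complex" where
  "fourier u k = (LINT z|circle. u z * z powi (- k))"

definition plus_part :: "(complex \<Rightarrow> complex) set \<Rightarrow> (complex \<Rightarrow> complex) set" where
  "plus_part E = {u \<in> E. \<forall>k<0. fourier u k = 0}"

definition H_half :: "(complex \<Rightarrow> complex) set" where
  "H_half = {u \<in> L2. (\<lambda>k::int. (\<bar>real_of_int k\<bar> + 1) * (cmod (fourier u k))\<^sup>2) summable_on UNIV}"

text \<open>
  The following is the \<open>H\<^sup>1\<^sup>/\<^sup>2\<close> norm on \<open>plus_part H_half\<close> only: the Fourier modes
  \<open>k < 0\<close> do not enter.
\<close>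

definition H_half_norm :: "(complex \<Rightarrow> complex) \<Rightarrow> real" where
  "H_half_norm u = sqrt (\<Sum>k::nat. (real k + 1) * (cmod (fourier u (int k)))\<^sup>2)"

text \<open>
  The orthogonal projector of \<open>L2\<close> onto \<open>plus_part L2\<close>. The choice only selects a
  representative: the projection is unique up to equality almost everywhere.
\<close>

definition szego_proj :: "(complex \<Rightarrow> complex) \<Rightarrow> (complex \<Rightarrow> complex)" where
  "szego_proj f = (SOME g. g \<in> plus_part L2 \<and>
     (\<forall>h \<in> plus_part L2. L2_inner (\<lambda>z. f z - g z) h = 0))"

text \<open>
  Solutions in \<open>C(\<real>, plus_part H_half)\<close>. Since \<open>H\<^sup>1\<^sup>/\<^sup>2\<close> embeds into \<open>L\<^sup>6\<close>, the
  nonlinearity lies in \<open>L2\<close>, so that the projector is applied within its domain. The time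
  derivative is the derivative in \<open>L2\<close>.
\<close>

definition szego_solution :: "(real \<Rightarrow> complex \<Rightarrow> complex) \<Rightarrow> bool" where
  "szego_solution u \<longleftrightarrow>
     (\<forall>t. u t \<in> plus_part H_half) \<and>
     (\<forall>t. ((\<lambda>s. H_half_norm (\<lambda>z. u s z - u t z)) \<longlongrightarrow> 0) (at t)) \<and>
     (\<forall>t. ((\<lambda>h. L2_norm (\<lambda>z. \<i> * ((u (t + h) z - u t z) / complex_of_real h)
              - szego_proj (\<lambda>w. complex_of_real ((cmod (u t w))\<^sup>2) * u t w) z)) \<longlongrightarrow> 0) (at 0))"

definition soliton :: "complex \<Rightarrow> complex \<Rightarrow> complex \<Rightarrow> complex" where
  "soliton \<alpha> p z = \<alpha> / (1 - p * z)"

definition soliton_torus :: "real \<Rightarrow> real \<Rightarrow> (complex \<Rightarrow> complex) set" where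
  "soliton_torus a r = {soliton \<alpha> p | \<alpha> p. cmod \<alpha> = a \<and> cmod p = r}"

end

theory Submission
  imports Defs
begin

text \<open>
  The mass \<open>Q = \<parallel>u\<parallel>\<^sup>2\<close> (in \<open>L\<^sup>2\<close>), the momentum \<open>M = (Du, u)\<close> and the energy \<open>E\<close>, the fourth power
  of the \<open>L\<^sup>4\<close> norm, are conserved. By the Cauchy--Schwarz inequality for the coefficients of \<open>u\<^sup>2\<close>,
  the deficit \<open>Q\<^sup>2 + 2 M Q - E\<close> is nonnegative; it vanishes on the solitons, and it bounds
  \<open>\<Sum>\<^sub>l\<^sub>,\<^sub>m \<bar>c\<^sub>l c\<^sub>m - c\<^sub>0 c\<^sub>l\<^sub>+\<^sub>m\<bar>\<^sup>2\<close>, where \<open>c\<close> are the Fourier coefficients of \<open>u\<close>. The Hankel array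
  \<open>c\<^sub>l\<^sub>+\<^sub>m\<close> has Hilbert--Schmidt norm \<open>\<parallel>u\<parallel>\<close> in \<open>H\<^sup>1\<^sup>/\<^sup>2\<close>, so a small deficit forces \<open>c\<close> to be close in
  \<open>H\<^sup>1\<^sup>/\<^sup>2\<close> to the geometric sequence with ratio \<open>c\<^sub>1 / c\<^sub>0\<close>, and the values of \<open>Q\<close> and \<open>M\<close> fix the
  moduli of \<open>c\<^sub>0\<close> and of the ratio. No compactness is needed.

  The conservation of \<open>M\<close> is the delicate point, since \<open>u\<close> is only in \<open>H\<^sup>1\<^sup>/\<^sup>2\<close>. The Galerkin
  truncations conserve \<open>M\<close> and converge to \<open>u\<close> in \<open>L\<^sup>2\<close> for a short time, by a Gronwall argument
  with a logarithmic loss in the manner of Yudovich. Lower semicontinuity gives that \<open>M\<close> does not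
  increase, in both time directions, so \<open>M\<close> is locally constant.
\<close>

section \<open>Square integrable functions on the circle\<close>

text \<open>The k-th coefficient of u^2 is a sum of k + 1 products \<open>c l * c (k - l)\<close>,
  and k + 1 = l + (k - l) + 1; this is the origin of 2 M Q + Q^2 in the deficit. Equality in
  Cauchy--Schwarz on every antidiagonal means that these products do not depend on l, which
  characterises geometric sequences, the coefficients of the solitons. The obstacle with M is that u
  is differentiable in time in L^2 only, while M is as strong as the H^(1/2) norm, so M cannot be
  differentiated along u. Comparing u with a truncation leads to a quadratic form with potential
  |u|^2, for which H^(1/2) just fails to give a bounded u. After a frequency cut at 2^j, the
  Gronwall factor exp (12 (j + 1) R T), with R a bound for the squared H^(1/2) norm, competes with a
  remainder of order 2^(-j/2), so the argument closes when R T is small. Continuity of u in H^(1/2)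
  supplies such an R near each time, and local constancy of M then suffices.\<close>

lemma quadratic_nonneg_imp_discrim:
  fixes A B C :: real
  assumes "\<And>s. 0 \<le> s\<^sup>2 * A - 2 * s * C + B" "0 \<le> A"
  shows "C\<^sup>2 \<le> A * B"
proof (cases "A = 0")
  case True
  have "C = 0"
  proof (rule ccontr)
    assume "C \<noteq> 0"
    \<comment> \<open>At this \<open>s\<close> the expression \<open>B - 2 * s * C\<close> equals
      -1.\<close>
    then show False using assms(1)[of "(B + 1) / (2 * C)"] True by simp
  qed
  with True show ?thesis by simp
next
  case False
  then have A: "A > 0" using assms(2) by simp
  have "0 \<le> A * ((C / A)\<^sup>2 * A - 2 * (C / A) * C + B)"
    using assms(1)[of "C / A"] A by simp
  also have "\<dots> = A * B - C\<^sup>2" using A by (simp add: field_simps power2_eq_square)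
  finally show ?thesis by simp
qed

lemma integrable_mult_of_squares:
  fixes f g :: "'a \<Rightarrow> real"
  assumes [measurable]: "f \<in> borel_measurable M" "g \<in> borel_measurable M"
    and "integrable M (\<lambda>x. (f x)\<^sup>2)" "integrable M (\<lambda>x. (g x)\<^sup>2)"
  shows "integrable M (\<lambda>x. f x * g x)"
proof (rule Bochner_Integration.integrable_bound)
  show "integrable M (\<lambda>x. (f x)\<^sup>2 + (g x)\<^sup>2)" using assms by simp
  have "\<bar>a * b\<bar> \<le> a\<^sup>2 + b\<^sup>2" for a b :: real
  proof -
    have "2 * \<bar>a * b\<bar> \<le> a\<^sup>2 + b\<^sup>2"
      using sum_squares_bound[of "\<bar>a\<bar>" "\<bar>b\<bar>"] by (simp add: abs_mult)
    then show ?thesis by (smt (verit) zero_le_power2)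
  qed
  then show "AE x in M. norm (f x * g x) \<le> norm ((f x)\<^sup>2 + (g x)\<^sup>2)" by simp
qed measurable

lemma integral_Cauchy_Schwarz:
  fixes f g :: "'a \<Rightarrow> real"
  assumes m: "f \<in> borel_measurable M" "g \<in> borel_measurable M"
    and i: "integrable M (\<lambda>x. (f x)\<^sup>2)" "integrable M (\<lambda>x. (g x)\<^sup>2)"
  shows "\<bar>LINT x|M. f x * g x\<bar> \<le> sqrt (LINT x|M. (f x)\<^sup>2) * sqrt (LINT x|M. (g x)\<^sup>2)"
proof -
  note fg = integrable_mult_of_squares[OF m i]
  have "(LINT x|M. f x * g x)\<^sup>2 \<le> (LINT x|M. (f x)\<^sup>2) * (LINT x|M. (g x)\<^sup>2)"
  proof (rule quadratic_nonneg_imp_discrim)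
    fix s :: real
    have "0 \<le> (LINT x|M. (s * f x - g x)\<^sup>2)" by simp
    also have "\<dots> = (LINT x|M. s\<^sup>2 * (f x)\<^sup>2 - 2 * s * (f x * g x) + (g x)\<^sup>2)"
      by (simp add: power2_diff power_mult_distrib algebra_simps)
    also have "\<dots> = s\<^sup>2 * (LINT x|M. (f x)\<^sup>2) - 2 * s * (LINT x|M. f x * g x) + (LINT x|M. (g x)\<^sup>2)"
      using fg i by simp
    finally show "0 \<le> s\<^sup>2 * (LINT x|M. (f x)\<^sup>2) - 2 * s * (LINT x|M. f x * g x) + (LINT x|M. (g x)\<^sup>2)" .
  qed simp
  then have "sqrt ((LINT x|M. f x * g x)\<^sup>2) \<le> sqrt ((LINT x|M. (f x)\<^sup>2) * (LINT x|M. (g x)\<^sup>2))"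
    using real_sqrt_le_mono by blast
  then show ?thesis by (simp add: real_sqrt_mult)
qed

section \<open>The normalised arc length measure\<close>

lemma space_circle [simp]: "space circle = sphere 0 1"
  by (simp add: circle_def space_restrict_space)

lemma sets_circle [measurable_cong, simp]: "sets circle = sets (restrict_space borel (sphere 0 1))"
  by (simp add: circle_def)

lemma cis_measurable_circle [measurable]:
  "cis \<in> measurable (uniform_measure lborel {0..2 * pi}) (restrict_space borel (sphere 0 1))"
  by (intro measurable_restrict_space2)
    (auto intro!: borel_measurable_continuous_onI continuous_intros simp: continuous_on_cis
      measurable_cong_sets[OF sets_uniform_measure refl])

lemma emeasure_circle: "emeasure circle (space circle) = 1"
proof -
  let ?U = "uniform_measure lborel {0..2 * pi}"
  have "emeasure circle (space circle) = emeasure ?U (cis -` (sphere 0 1) \<inter> space ?U)"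
    unfolding space_circle unfolding circle_def by (rule emeasure_distr) (auto simp: sets_restrict_space)
  also have "cis -` (sphere 0 1) \<inter> space ?U = space ?U" by auto
  also have "emeasure ?U (space ?U) = 1"
    by (simp add: emeasure_uniform_measure ennreal_divide_self)
  finally show ?thesis .
qed

interpretation circle: finite_measure circle
  by (rule finite_measureI) (simp add: emeasure_circle del: space_circle)

lemma measure_circle [simp]: "measure circle (sphere 0 1) = 1"
  using emeasure_circle by (simp add: measure_def)

lemma continuous_circle_measurable:
  fixes f :: "complex \<Rightarrow> 'b::topological_space"
  assumes "continuous_on (sphere 0 1) f"
  shows "f \<in> borel_measurable circle"
  using borel_measurable_continuous_on_restrict[OF assms]
  by (simp cong: measurable_cong_sets)

lemma continuous_circle_integrable:
  fixes f :: "complex \<Rightarrow> 'b::{banach, second_countable_topology}"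
  assumes "continuous_on (sphere 0 1) f"
  shows "integrable circle f"
proof -
  have "compact (f ` sphere 0 1)" by (intro compact_continuous_image assms) simp
  then obtain B where "\<And>z. z \<in> sphere 0 1 \<Longrightarrow> norm (f z) \<le> B"
    by (meson bounded_iff compact_imp_bounded imageI)
  then show ?thesis
    by (intro circle.integrable_const_bound[where B = B] continuous_circle_measurable assms AE_I2) auto
qed

lemma continuous_on_powi_sphere [continuous_intros]:
  "continuous_on (sphere 0 1) (\<lambda>z::complex. z powi k)"
  by (rule continuous_on_power_int) (auto intro: continuous_intros)

text \<open>Orthonormality of the characters. After pulling back along \<open>cis\<close>, the
  antiderivative of \<open>cis (k * t)\<close> takes the same value at both ends of the
  period.\<close>

lemma integral_circle_powi:
  "(LINT z|circle. z powi k) = (if k = 0 then 1 else 0)"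
proof (cases "k = 0")
  case False
  let ?U = "uniform_measure lborel {0..2 * pi}"
  have "(LINT z|circle. z powi k) = (LINT t|?U. cis t powi k)"
    unfolding circle_def
    by (rule integral_distr[OF cis_measurable_circle], 
        rule borel_measurable_continuous_on_restrict, intro continuous_intros)
  also have "\<dots> = (LINT t|?U. cis (of_int k * t))"
    by (simp add: cis_power_int)
  also have "\<dots> = (LINT t|density lborel (\<lambda>x. ennreal (indicator {0..2 * pi} x / (2 * pi))). cis (of_int k * t))"
  proof -
    have "?U = density lborel (\<lambda>x. ennreal (indicator {0..2 * pi} x / (2 * pi)))"
      unfolding uniform_measure_def
      by (intro density_cong) (auto split: split_indicator simp: divide_ennreal ennreal_1[symmetric] simp del: ennreal_1)
    then show ?thesis by simp
  qed
  also have "\<dots> = (LINT t|lborel. (indicator {0..2 * pi} t / (2 * pi)) *\<^sub>R cis (of_int k * t))"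
    by (rule integral_density)
      (auto intro!: borel_measurable_continuous_onI continuous_intros simp: continuous_on_cis)
  also have "\<dots> = (1 / (2 * pi)) *\<^sub>R (LINT t|lborel. indicator {0..2 * pi} t *\<^sub>R cis (of_int k * t))"
    by (simp flip: integral_scaleR_right)
  also have "(LINT t|lborel. indicator {0..2 * pi} t *\<^sub>R cis (of_int k * t))
      = (\<lambda>t. cis (of_int k * t) / (\<i> * of_int k)) (2 * pi) - (\<lambda>t. cis (of_int k * t) / (\<i> * of_int k)) 0"
  proof (rule integral_FTC_atLeastAtMost)
    fix x :: real
    show "((\<lambda>t. cis (of_int k * t) / (\<i> * of_int k)) has_vector_derivative cis (of_int k * x))
        (at x within {0..2 * pi})"
      using False
      by (auto intro!: derivative_eq_intros simp: has_vector_derivative_def scaleR_conv_of_real field_simps)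
  qed (auto intro!: continuous_intros simp: continuous_on_cis)
  also have "\<dots> = 0"
    using cis_multiple_2pi[of "real_of_int k"] by (simp add: mult_ac)
  finally show ?thesis using False by simp
qed simp


section \<open>Closure, norm and inner product of L2\<close>

lemma L2_measurable [measurable_dest]: "u \<in> L2 \<Longrightarrow> u \<in> borel_measurable circle"
  by (simp add: L2_def)

lemma L2_integrable_square: "u \<in> L2 \<Longrightarrow> integrable circle (\<lambda>z. (cmod (u z))\<^sup>2)"
  by (simp add: L2_def)

lemma L2_dominated:
  assumes "v \<in> L2" "u \<in> borel_measurable circle"
    and "\<And>z. z \<in> sphere 0 1 \<Longrightarrow> cmod (u z) \<le> cmod (v z)"
  shows "u \<in> L2"
proof -
  have [measurable]: "u \<in> borel_measurable circle" by fact
  have "integrable circle (\<lambda>z. (cmod (u z))\<^sup>2)"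
    by (rule Bochner_Integration.integrable_bound[OF L2_integrable_square[OF assms(1)]])
      (use assms(3) in \<open>auto intro!: AE_I2 power_mono\<close>)
  then show ?thesis using assms(2) by (simp add: L2_def)
qed

lemma L2_cmult: "u \<in> L2 \<Longrightarrow> (\<lambda>z. c * u z) \<in> L2"
  by (auto simp: L2_def norm_mult power_mult_distrib)

lemma L2_cnj: "u \<in> L2 \<Longrightarrow> (\<lambda>z. cnj (u z)) \<in> L2"
  by (auto simp: L2_def intro: measurable_compose[OF _ borel_measurable_continuous_onI[of cnj]]
      intro!: continuous_intros)

lemma L2_norm_integrable_mult:
  assumes "u \<in> L2" "v \<in> L2"
  shows "integrable circle (\<lambda>z. cmod (u z) * cmod (v z))"
proof -
  have [measurable]: "u \<in> borel_measurable circle" "v \<in> borel_measurable circle"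
    using assms by (auto simp: L2_def)
  show ?thesis
    by (rule integrable_mult_of_squares) (use assms in \<open>auto simp: L2_integrable_square\<close>)
qed

lemma L2_integrable_mult:
  assumes "u \<in> L2" "v \<in> L2"
  shows "integrable circle (\<lambda>z. u z * v z)"
  using assms
  by (intro Bochner_Integration.integrable_bound[OF L2_norm_integrable_mult[OF assms]])
    (auto simp: L2_def norm_mult)

lemma L2_integrable_inner:
  "u \<in> L2 \<Longrightarrow> v \<in> L2 \<Longrightarrow> integrable circle (\<lambda>z. u z * cnj (v z))"
  by (intro L2_integrable_mult L2_cnj)

lemma L2_add:
  assumes "u \<in> L2" "v \<in> L2"
  shows "(\<lambda>z. u z + v z) \<in> L2"
proof -
  have [measurable]: "u \<in> borel_measurable circle" "v \<in> borel_measurable circle"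
    using assms by (auto simp: L2_def)
  have "integrable circle (\<lambda>z. (cmod (u z + v z))\<^sup>2)"
  proof (rule Bochner_Integration.integrable_bound)
    show "integrable circle (\<lambda>z. (cmod (u z))\<^sup>2 + 2 * (cmod (u z) * cmod (v z)) + (cmod (v z))\<^sup>2)"
      using assms by (intro Bochner_Integration.integrable_add integrable_mult_right
        L2_integrable_square L2_norm_integrable_mult)
    have "(cmod (a + b))\<^sup>2 \<le> (cmod a)\<^sup>2 + 2 * (cmod a * cmod b) + (cmod b)\<^sup>2" for a b
      using power_mono[OF norm_triangle_ineq[of a b], of 2] by (simp add: power2_sum algebra_simps)
    then show "AE z in circle. norm ((cmod (u z + v z))\<^sup>2)
        \<le> norm ((cmod (u z))\<^sup>2 + 2 * (cmod (u z) * cmod (v z)) + (cmod (v z))\<^sup>2)"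
      by (intro AE_I2) simp
  qed measurable
  then show ?thesis by (simp add: L2_def)
qed

lemma L2_diff:
  assumes "u \<in> L2" "v \<in> L2"
  shows "(\<lambda>z. u z - v z) \<in> L2"
  using L2_add[OF assms(1) L2_cmult[OF assms(2), of "-1"]] by simp

lemma continuous_L2: "continuous_on (sphere 0 1) u \<Longrightarrow> u \<in> L2"
  unfolding L2_def
  by (auto intro!: continuous_circle_measurable continuous_circle_integrable continuous_intros)

lemma L2_const: "(\<lambda>z. c) \<in> L2"
  by (intro continuous_L2 continuous_intros)

lemma L2_powi: "(\<lambda>z. z powi k) \<in> L2"
  by (intro continuous_L2 continuous_intros)

lemma L2_sum: "(\<And>i. i \<in> I \<Longrightarrow> f i \<in> L2) \<Longrightarrow> (\<lambda>z. \<Sum>i\<in>I. f i z) \<in> L2"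
  by (induction I rule: infinite_finite_induct) (auto intro: L2_add simp: L2_const)

lemma L2_integrable: "u \<in> L2 \<Longrightarrow> integrable circle u"
  using L2_integrable_mult[OF _ L2_const[of 1]] by simp

lemma L2_norm_nonneg [simp]: "0 \<le> L2_norm u"
  by (simp add: L2_norm_def)

lemma L2_norm_square: "(L2_norm u)\<^sup>2 = (LINT z|circle. (cmod (u z))\<^sup>2)"
  by (simp add: L2_norm_def)

lemma L2_norm_cmult: "L2_norm (\<lambda>z. c * u z) = cmod c * L2_norm u"
  by (simp add: L2_norm_def norm_mult power_mult_distrib real_sqrt_mult)

lemma L2_norm_minus_commute: "L2_norm (\<lambda>z. u z - v z) = L2_norm (\<lambda>z. v z - u z)"
  by (simp add: L2_norm_def norm_minus_commute)

lemma L2_Cauchy_Schwarz_norm: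
  assumes "u \<in> L2" "v \<in> L2"
  shows "(LINT z|circle. cmod (u z) * cmod (v z)) \<le> L2_norm u * L2_norm v"
proof -
  have [measurable]: "u \<in> borel_measurable circle" "v \<in> borel_measurable circle"
    using assms by (auto simp: L2_def)
  have "\<bar>LINT z|circle. cmod (u z) * cmod (v z)\<bar> \<le> L2_norm u * L2_norm v"
    unfolding L2_norm_def by (rule integral_Cauchy_Schwarz) (auto simp: L2_integrable_square assms)
  then show ?thesis by linarith
qed

lemma L2_Cauchy_Schwarz:
  assumes "u \<in> L2" "v \<in> L2"
  shows "cmod (L2_inner u v) \<le> L2_norm u * L2_norm v"
proof -
  have "cmod (L2_inner u v) \<le> (LINT z|circle. cmod (u z * cnj (v z)))"
    unfolding L2_inner_def by (rule integral_norm_bound)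
  also have "\<dots> = (LINT z|circle. cmod (u z) * cmod (v z))" by (simp add: norm_mult)
  finally show ?thesis using L2_Cauchy_Schwarz_norm[OF assms] by simp
qed

lemma L2_triangle:
  assumes "u \<in> L2" "v \<in> L2"
  shows "L2_norm (\<lambda>z. u z + v z) \<le> L2_norm u + L2_norm v"
proof (rule power2_le_imp_le)
  have "(L2_norm (\<lambda>z. u z + v z))\<^sup>2
      \<le> (LINT z|circle. (cmod (u z))\<^sup>2 + 2 * (cmod (u z) * cmod (v z)) + (cmod (v z))\<^sup>2)"
    unfolding L2_norm_square
  proof (rule integral_mono)
    show "(cmod (u z + v z))\<^sup>2 \<le> (cmod (u z))\<^sup>2 + 2 * (cmod (u z) * cmod (v z)) + (cmod (v z))\<^sup>2" for z
      using power_mono[OF norm_triangle_ineq[of "u z" "v z"], of 2]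
      by (simp add: power2_sum algebra_simps)
  qed (use assms L2_add in \<open>intro Bochner_Integration.integrable_add integrable_mult_right
        L2_integrable_square L2_norm_integrable_mult; blast\<close>)+
  also have "\<dots> = (L2_norm u)\<^sup>2 + 2 * (LINT z|circle. cmod (u z) * cmod (v z)) + (L2_norm v)\<^sup>2"
    using assms by (simp add: L2_norm_square L2_integrable_square L2_norm_integrable_mult)
  also have "\<dots> \<le> (L2_norm u)\<^sup>2 + 2 * (L2_norm u * L2_norm v) + (L2_norm v)\<^sup>2"
    using L2_Cauchy_Schwarz_norm[OF assms] by simp
  finally show "(L2_norm (\<lambda>z. u z + v z))\<^sup>2 \<le> (L2_norm u + L2_norm v)\<^sup>2"
    by (simp add: power2_sum algebra_simps)
qed simp

lemma L2_triangle_diff: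
  assumes "u \<in> L2" "v \<in> L2" "w \<in> L2"
  shows "L2_norm (\<lambda>z. u z - w z) \<le> L2_norm (\<lambda>z. u z - v z) + L2_norm (\<lambda>z. v z - w z)"
  using L2_triangle[OF L2_diff[OF assms(1,2)] L2_diff[OF assms(2,3)]] by simp

lemma L2_inner_diff_left:
  "u \<in> L2 \<Longrightarrow> v \<in> L2 \<Longrightarrow> w \<in> L2 \<Longrightarrow> L2_inner (\<lambda>z. u z - v z) w = L2_inner u w - L2_inner v w"
  by (simp add: L2_inner_def left_diff_distrib L2_integrable_inner)

lemma L2_inner_diff_right:
  "u \<in> L2 \<Longrightarrow> v \<in> L2 \<Longrightarrow> w \<in> L2 \<Longrightarrow> L2_inner w (\<lambda>z. u z - v z) = L2_inner w u - L2_inner w v"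
  by (simp add: L2_inner_def right_diff_distrib L2_integrable_inner)

lemma L2_inner_cmult_left: "L2_inner (\<lambda>z. c * u z) v = c * L2_inner u v"
  by (simp add: L2_inner_def mult.assoc)

lemma L2_inner_commute: "L2_inner v u = cnj (L2_inner u v)"
proof -
  have "cnj (L2_inner u v) = (LINT z|circle. cnj (u z * cnj (v z)))"
    unfolding L2_inner_def by (rule Bochner_Integration.integral_cnj[symmetric])
  then show ?thesis by (simp add: L2_inner_def mult.commute)
qed

lemma L2_inner_sum_left:
  assumes "\<And>i. i \<in> I \<Longrightarrow> f i \<in> L2" "w \<in> L2"
  shows "L2_inner (\<lambda>z. \<Sum>i\<in>I. f i z) w = (\<Sum>i\<in>I. L2_inner (f i) w)"
  using assms by (simp add: L2_inner_def sum_distrib_right L2_integrable_inner)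

lemma L2_inner_self: "L2_inner u u = of_real ((L2_norm u)\<^sup>2)"
proof -
  have "L2_inner u u = (LINT z|circle. complex_of_real ((cmod (u z))\<^sup>2))"
    unfolding L2_inner_def by (simp only: complex_norm_square)
  then show ?thesis by (simp only: integral_complex_of_real L2_norm_square)
qed

lemma L2_norm_square_add:
  assumes "u \<in> L2" "v \<in> L2"
  shows "(L2_norm (\<lambda>z. u z + v z))\<^sup>2 = (L2_norm u)\<^sup>2 + 2 * Re (L2_inner u v) + (L2_norm v)\<^sup>2"
proof -
  have eq: "(cmod (a + b))\<^sup>2 = (cmod a)\<^sup>2 + 2 * Re (a * cnj b) + (cmod b)\<^sup>2" for a b
    by (simp only: cmod_power2) (simp add: power2_eq_square algebra_simps)
  have "(L2_norm (\<lambda>z. u z + v z))\<^sup>2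
      = (LINT z|circle. (cmod (u z))\<^sup>2 + 2 * Re (u z * cnj (v z)) + (cmod (v z))\<^sup>2)"
    unfolding L2_norm_square eq ..
  also have "\<dots> = (L2_norm u)\<^sup>2 + 2 * (LINT z|circle. Re (u z * cnj (v z))) + (L2_norm v)\<^sup>2"
    using assms L2_integrable_inner[OF assms]
    by (simp add: L2_norm_square L2_integrable_square del: times_complex.sel)
  also have "(LINT z|circle. Re (u z * cnj (v z))) = Re (L2_inner u v)"
    unfolding L2_inner_def using L2_integrable_inner[OF assms] by (rule integral_Re)
  finally show ?thesis .
qed

section \<open>Fourier coefficients and finite Fourier sums\<close>

lemma cnj_powi_sphere: "z \<in> sphere 0 1 \<Longrightarrow> cnj (z powi k) = z powi (- k)" for z :: complex
proof -
  assume "z \<in> sphere 0 1"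
  then have "cmod z = 1" by simp
  then have "cnj z = inverse z"
    by (metis complex_div_cnj div_by_1 divide_complex_def mult_1 of_real_1 power_one)
  then show ?thesis by (simp add: power_int_minus flip: power_int_inverse)
qed

lemma fourier_eq_L2_inner: "fourier u k = L2_inner u (\<lambda>z. z powi k)"
  unfolding fourier_def L2_inner_def
  by (rule Bochner_Integration.integral_cong) (simp_all flip: cnj_powi_sphere)

lemma fourier_diff: "u \<in> L2 \<Longrightarrow> v \<in> L2 \<Longrightarrow> fourier (\<lambda>z. u z - v z) k = fourier u k - fourier v k"
  by (simp add: fourier_eq_L2_inner L2_inner_diff_left L2_powi)

lemma fourier_powi: "fourier (\<lambda>z. z powi l) k = (if k = l then 1 else 0)"
proof -
  have "z powi l * z powi (- k) = z powi (l - k)" if "cmod z = 1" for z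
    using that power_int_add[of z l "- k"] by force
  then have "fourier (\<lambda>z. z powi l) k = (LINT z|circle. z powi (l - k))"
    unfolding fourier_def by (intro Bochner_Integration.integral_cong) auto
  then show ?thesis by (auto simp: integral_circle_powi)
qed

text \<open>Elements of L2 are classes modulo null sets. The initial condition of the theorem holds
  almost everywhere only, and through this lemma it fixes the coefficients of
  \<open>u 0\<close>.\<close>

lemma fourier_cong_AE:
  assumes "AE z in circle. u z = v z" "u \<in> L2" "v \<in> L2"
  shows "fourier u k = fourier v k"
  unfolding fourier_def using assms L2_powi[of "-k"]
  by (intro integral_cong_AE) (auto simp: L2_def)

lemma norm_fourier_le: "u \<in> L2 \<Longrightarrow> cmod (fourier u k) \<le> L2_norm u"
proof -
  assume "u \<in> L2"
  then have "cmod (fourier u k) \<le> L2_norm u * L2_norm (\<lambda>z. z powi k)"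
    unfolding fourier_eq_L2_inner by (intro L2_Cauchy_Schwarz L2_powi)
  also have "(L2_norm (\<lambda>z. z powi k))\<^sup>2 = 1"
    using fourier_powi[of k k] unfolding fourier_eq_L2_inner L2_inner_self
    by (metis of_real_eq_1_iff)
  then have "L2_norm (\<lambda>z. z powi k) = 1"
    using L2_norm_nonneg by (metis abs_1 abs_of_nonneg power2_eq_1_iff power_one real_sqrt_abs)
  finally show ?thesis by simp
qed

definition trig_sum :: "int set \<Rightarrow> (int \<Rightarrow> complex) \<Rightarrow> complex \<Rightarrow> complex" where
  "trig_sum K p z = (\<Sum>k\<in>K. p k * z powi k)"

lemma L2_trig_sum: "trig_sum K p \<in> L2"
  unfolding trig_sum_def[abs_def] by (intro L2_sum L2_cmult L2_powi)

lemma L2_inner_trig_sum_left: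
  assumes "v \<in> L2"
  shows "L2_inner (trig_sum K p) v = (\<Sum>k\<in>K. p k * cnj (fourier v k))"
proof -
  have "L2_inner (trig_sum K p) v = (\<Sum>k\<in>K. p k * L2_inner (\<lambda>z. z powi k) v)"
    unfolding trig_sum_def[abs_def]
    by (simp add: L2_inner_sum_left L2_cmult L2_powi assms L2_inner_cmult_left)
  also have "\<dots> = (\<Sum>k\<in>K. p k * cnj (fourier v k))"
    unfolding fourier_eq_L2_inner by (simp flip: L2_inner_commute)
  finally show ?thesis .
qed

lemma fourier_trig_sum:
  assumes "finite K"
  shows "fourier (trig_sum K p) k = (if k \<in> K then p k else 0)"
  using assms by (simp add: fourier_eq_L2_inner L2_inner_trig_sum_left L2_powi
      fourier_powi[unfolded fourier_eq_L2_inner] if_distrib sum.delta' cong: if_cong)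

lemma L2_norm_trig_sum:
  assumes "finite K"
  shows "(L2_norm (trig_sum K p))\<^sup>2 = (\<Sum>k\<in>K. (cmod (p k))\<^sup>2)"
proof -
  have "complex_of_real ((L2_norm (trig_sum K p))\<^sup>2) = (\<Sum>k\<in>K. p k * cnj (p k))"
    using assms unfolding L2_inner_self[symmetric]
    by (simp add: L2_inner_trig_sum_left L2_trig_sum fourier_trig_sum)
  also have "\<dots> = complex_of_real (\<Sum>k\<in>K. (cmod (p k))\<^sup>2)"
    by (simp only: of_real_sum complex_norm_square)
  finally show ?thesis using of_real_eq_iff by blast
qed

text \<open>Completing the square frequency by frequency. The last sum vanishes for
  \<open>p = fourier u\<close>, which gives best approximation, and nonnegativity of what then
  remains is Bessel's inequality.\<close>

lemma L2_norm_diff_trig_sum: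
  assumes "u \<in> L2" "finite K"
  shows "(L2_norm (\<lambda>z. u z - trig_sum K p z))\<^sup>2
    = (L2_norm u)\<^sup>2 - (\<Sum>k\<in>K. (cmod (fourier u k))\<^sup>2) + (\<Sum>k\<in>K. (cmod (fourier u k - p k))\<^sup>2)"
proof -
  have "(L2_norm (\<lambda>z. u z - trig_sum K p z))\<^sup>2 = (L2_norm (\<lambda>z. u z + (-1) * trig_sum K p z))\<^sup>2"
    by simp
  also have "\<dots> = (L2_norm u)\<^sup>2 + 2 * Re (L2_inner u (\<lambda>z. (-1) * trig_sum K p z))
      + (L2_norm (\<lambda>z. (-1) * trig_sum K p z))\<^sup>2"
    using assms(1) by (intro L2_norm_square_add L2_cmult L2_trig_sum)
  also have "L2_norm (\<lambda>z. (-1) * trig_sum K p z) = L2_norm (trig_sum K p)"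
    by (subst L2_norm_cmult) simp
  also have "L2_inner u (\<lambda>z. (-1) * trig_sum K p z) = cnj (- (\<Sum>k\<in>K. p k * cnj (fourier u k)))"
    by (subst L2_inner_commute, subst L2_inner_cmult_left) (simp add: L2_inner_trig_sum_left assms)
  also have "(L2_norm u)\<^sup>2 + 2 * Re (cnj (- (\<Sum>k\<in>K. p k * cnj (fourier u k)))) + (L2_norm (trig_sum K p))\<^sup>2
      = (L2_norm u)\<^sup>2 + (\<Sum>k\<in>K. - 2 * Re (p k * cnj (fourier u k)) + (cmod (p k))\<^sup>2)"
    unfolding cnj.sel
    by (simp add: L2_norm_trig_sum assms sum.distrib sum_distrib_left sum_negf sum_subtractf del: times_complex.sel)
  also have "(\<Sum>k\<in>K. - 2 * Re (p k * cnj (fourier u k)) + (cmod (p k))\<^sup>2)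
      = (\<Sum>k\<in>K. (cmod (fourier u k - p k))\<^sup>2 - (cmod (fourier u k))\<^sup>2)"
    by (rule sum.cong[OF refl], simp only: cmod_power2) (simp add: power2_eq_square algebra_simps)
  finally show ?thesis by (simp add: sum_subtractf)
qed

lemma L2_best_approximation:
  assumes "u \<in> L2" "finite K"
  shows "L2_norm (\<lambda>z. u z - trig_sum K (fourier u) z) \<le> L2_norm (\<lambda>z. u z - trig_sum K p z)"
  by (rule power2_le_imp_le) (auto simp: L2_norm_diff_trig_sum assms sum_nonneg)

lemma Bessel:
  assumes "u \<in> L2" "finite K"
  shows "(\<Sum>k\<in>K. (cmod (fourier u k))\<^sup>2) \<le> (L2_norm u)\<^sup>2"
  using L2_norm_diff_trig_sum[OF assms, of "fourier u"]
    zero_le_power2[of "L2_norm (\<lambda>z. u z - trig_sum K (fourier u) z)"] by simp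

section \<open>Density of trigonometric polynomials\<close>

text \<open>For limits of nonnegative functions without a common dominating function: a uniform
  bound on the integrals takes its place. Serves the completeness of L2 and the L6 bound.\<close>

lemma integral_Fatou:
  fixes f :: "'a \<Rightarrow> real" and F :: "nat \<Rightarrow> 'a \<Rightarrow> real"
  assumes [measurable]: "f \<in> borel_measurable M"
    and F: "\<And>n. integrable M (F n)" and nonneg: "\<And>n x. 0 \<le> F n x"
    and lim: "AE x in M. (\<lambda>n. F n x) \<longlonglongrightarrow> f x"
    and B: "\<And>n. (LINT x|M. F n x) \<le> B"
  shows "integrable M f" "(LINT x|M. f x) \<le> B"
proof -
  have [measurable]: "F n \<in> borel_measurable M" for n using F by auto
  have f0: "AE x in M. 0 \<le> f x"
    using lim by eventually_elim (rule LIMSEQ_le_const, auto intro: nonneg)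
  have "0 \<le> (LINT x|M. F 0 x)" by (intro integral_nonneg_AE AE_I2) (rule nonneg)
  then have B0: "0 \<le> B" using B[of 0] by linarith
  have "(\<integral>\<^sup>+x. ennreal (f x) \<partial>M) = (\<integral>\<^sup>+x. liminf (\<lambda>n. ennreal (F n x)) \<partial>M)"
  proof (rule nn_integral_cong_AE, use lim in eventually_elim)
    case (elim x)
    then have "(\<lambda>n. ennreal (F n x)) \<longlonglongrightarrow> ennreal (f x)" by (rule tendsto_ennrealI)
    then show ?case by (intro lim_imp_Liminf[symmetric]) simp_all
  qed
  also have "\<dots> \<le> liminf (\<lambda>n. \<integral>\<^sup>+x. ennreal (F n x) \<partial>M)"
    by (rule nn_integral_liminf) measurable
  also have "\<dots> \<le> ennreal B"
  proof -
    have "(\<integral>\<^sup>+x. ennreal (F n x) \<partial>M) \<le> ennreal B" for n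
      using F[of n] B[of n] nonneg by (subst nn_integral_eq_integral) (auto intro: ennreal_leI)
    then show ?thesis by (intro Liminf_le) (simp_all add: always_eventually)
  qed
  finally have le: "(\<integral>\<^sup>+x. ennreal (f x) \<partial>M) \<le> ennreal B" .
  then have "(\<integral>\<^sup>+x. ennreal (f x) \<partial>M) < \<infinity>" by (rule order.strict_trans1) simp
  then show "integrable M f" using f0 by (intro integrableI_nonneg) auto
  show "(LINT x|M. f x) \<le> B"
    using le B0 f0 by (subst integral_eq_nn_integral) (auto simp: enn2real_leI)
qed

lemma L2_norm_le_const:
  assumes "u \<in> L2" "0 \<le> e" and "\<And>z. z \<in> sphere 0 1 \<Longrightarrow> cmod (u z) \<le> e"
  shows "L2_norm u \<le> e"
proof (rule power2_le_imp_le)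
  have "(L2_norm u)\<^sup>2 \<le> (LINT z|circle. e\<^sup>2)"
    unfolding L2_norm_square
    by (rule integral_mono) (use assms in \<open>auto simp: L2_integrable_square intro!: power_mono\<close>)
  then show "(L2_norm u)\<^sup>2 \<le> e\<^sup>2" by simp
qed fact

lemma L2_dominated_convergence:
  assumes f: "\<And>n. f n \<in> L2" and h: "h \<in> L2" and g: "g \<in> L2"
    and dom: "\<And>n z. z \<in> sphere 0 1 \<Longrightarrow> cmod (f n z) \<le> cmod (g z)"
    and lim: "\<And>z. z \<in> sphere 0 1 \<Longrightarrow> (\<lambda>n. f n z) \<longlonglongrightarrow> h z"
  shows "(\<lambda>n. L2_norm (\<lambda>z. f n z - h z)) \<longlonglongrightarrow> 0"
proof -
  have [measurable]: "f n \<in> borel_measurable circle" "h \<in> borel_measurable circle" for n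
    using f h by (auto simp: L2_def)
  have "(\<lambda>n. LINT z|circle. (cmod (f n z - h z))\<^sup>2) \<longlonglongrightarrow> (LINT z|circle. (0::real))"
  proof (rule integral_dominated_convergence[where w = "\<lambda>z. 4 * (cmod (g z))\<^sup>2"])
    show "integrable circle (\<lambda>z. 4 * (cmod (g z))\<^sup>2)" using g by (simp add: L2_integrable_square)
    show "AE z in circle. (\<lambda>n. (cmod (f n z - h z))\<^sup>2) \<longlonglongrightarrow> 0"
    proof (rule AE_I2)
      fix z assume "z \<in> space circle"
      then have "(\<lambda>n. (cmod (f n z - h z))\<^sup>2) \<longlonglongrightarrow> (cmod (h z - h z))\<^sup>2"
        by (intro tendsto_intros lim) simp
      then show "(\<lambda>n. (cmod (f n z - h z))\<^sup>2) \<longlonglongrightarrow> 0" by simp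
    qed
    show "AE z in circle. norm ((cmod (f n z - h z))\<^sup>2) \<le> 4 * (cmod (g z))\<^sup>2" for n
    proof (rule AE_I2)
      fix z assume "z \<in> space circle"
      then have z: "z \<in> sphere 0 1" by simp
      have "cmod (h z) \<le> cmod (g z)"
        using lim[OF z] by (intro LIMSEQ_le_const2[OF tendsto_norm]) (auto intro: dom z)
      then have "cmod (f n z - h z) \<le> 2 * cmod (g z)"
        using dom[OF z, of n] norm_triangle_ineq4[of "f n z" "h z"] by linarith
      then have "(cmod (f n z - h z))\<^sup>2 \<le> (2 * cmod (g z))\<^sup>2" by (intro power_mono) auto
      then show "norm ((cmod (f n z - h z))\<^sup>2) \<le> 4 * (cmod (g z))\<^sup>2" by (simp add: power_mult_distrib)
    qed
  qed measurable
  then show ?thesis unfolding L2_norm_def using tendsto_real_sqrt by fastforce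
qed

text \<open>Equality is asked on the circle only, since it is there that \<open>cnj z\<close> is the
  monomial \<open>z powi (- 1)\<close>.\<close>

definition is_trig :: "(complex \<Rightarrow> complex) \<Rightarrow> bool" where
  "is_trig f \<longleftrightarrow> (\<exists>K p. finite K \<and> (\<forall>z\<in>sphere 0 1. f z = trig_sum K p z))"

lemma is_trig_cong: "is_trig f \<Longrightarrow> (\<And>z. z \<in> sphere 0 1 \<Longrightarrow> f z = g z) \<Longrightarrow> is_trig g"
  unfolding is_trig_def by metis

lemma is_trig_monomial: "is_trig (\<lambda>z. c * z powi k)"
  unfolding is_trig_def trig_sum_def by (rule exI[of _ "{k}"], rule exI[of _ "\<lambda>_. c"]) simp

lemma is_trig_const: "is_trig (\<lambda>z. c)"
  using is_trig_monomial[of c 0] by simp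

lemma is_trig_add:
  assumes "is_trig f" "is_trig g"
  shows "is_trig (\<lambda>z. f z + g z)"
proof -
  obtain K p where K: "finite K" "\<And>z. z \<in> sphere 0 1 \<Longrightarrow> f z = trig_sum K p z"
    using assms(1) unfolding is_trig_def by blast
  obtain L q where L: "finite L" "\<And>z. z \<in> sphere 0 1 \<Longrightarrow> g z = trig_sum L q z"
    using assms(2) unfolding is_trig_def by blast
  let ?r = "\<lambda>k. (if k \<in> K then p k else 0) + (if k \<in> L then q k else 0)"
  have "trig_sum (K \<union> L) ?r z = trig_sum K p z + trig_sum L q z" for z
  proof -
    have "trig_sum K p z = (\<Sum>k\<in>K \<union> L. (if k \<in> K then p k else 0) * z powi k)"
      unfolding trig_sum_def using K(1) L(1) by (intro sum.mono_neutral_cong_left) auto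
    moreover have "trig_sum L q z = (\<Sum>k\<in>K \<union> L. (if k \<in> L then q k else 0) * z powi k)"
      unfolding trig_sum_def using K(1) L(1) by (intro sum.mono_neutral_cong_left) auto
    ultimately show ?thesis
      unfolding trig_sum_def by (simp add: distrib_right sum.distrib)
  qed
  then show ?thesis unfolding is_trig_def using K L
    by (intro exI[of _ "K \<union> L"] exI[of _ ?r]) auto
qed

lemma is_trig_sum: "(\<And>i. i \<in> I \<Longrightarrow> is_trig (f i)) \<Longrightarrow> is_trig (\<lambda>z. \<Sum>i\<in>I. f i z)"
  by (induction I rule: infinite_finite_induct) (auto intro: is_trig_add simp: is_trig_const)

lemma is_trig_mult:
  assumes "is_trig f" "is_trig g"
  shows "is_trig (\<lambda>z. f z * g z)"
proof -
  obtain K p where K: "finite K" "\<And>z. z \<in> sphere 0 1 \<Longrightarrow> f z = trig_sum K p z"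
    using assms(1) unfolding is_trig_def by blast
  obtain L q where L: "finite L" "\<And>z. z \<in> sphere 0 1 \<Longrightarrow> g z = trig_sum L q z"
    using assms(2) unfolding is_trig_def by blast
  have "is_trig (\<lambda>z. \<Sum>k\<in>K. \<Sum>l\<in>L. (p k * q l) * z powi (k + l))"
    by (intro is_trig_sum is_trig_monomial)
  then show ?thesis
  proof (rule is_trig_cong)
    fix z :: complex assume z: "z \<in> sphere 0 1"
    then have "z \<noteq> 0" by auto
    then show "(\<Sum>k\<in>K. \<Sum>l\<in>L. (p k * q l) * z powi (k + l)) = f z * g z"
      unfolding K(2)[OF z] L(2)[OF z] trig_sum_def
      by (simp add: sum_product power_int_add mult_ac)
  qed
qed

lemma is_trig_real_polynomial:
  fixes q :: "complex \<Rightarrow> real"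
  assumes "real_polynomial_function q"
  shows "is_trig (\<lambda>z. of_real (q z))"
  using assms
proof induction
  case (linear f)
  interpret bounded_linear f by fact
  \<comment> \<open>On the circle \<open>Re z = (z + 1 / z) / 2\<close> and
    \<open>Im z = (z - 1 / z) / (2 * \<i>)\<close>, and a real linear \<open>f\<close> is determined
    by its values at 1 and \<open>\<i>\<close>.\<close>
  have "is_trig (\<lambda>z. (of_real (f 1) / 2 + of_real (f \<i>) / (2 * \<i>)) * z powi 1
      + (of_real (f 1) / 2 - of_real (f \<i>) / (2 * \<i>)) * z powi (-1))"
    by (intro is_trig_add is_trig_monomial)
  then show ?case
  proof (rule is_trig_cong)
    fix z :: complex assume z: "z \<in> sphere 0 1"
    have "z = Re z *\<^sub>R 1 + Im z *\<^sub>R \<i>" by (simp add: complex_eq_iff)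
    then have "f z = f (Re z *\<^sub>R 1 + Im z *\<^sub>R \<i>)" by (rule arg_cong)
    then have f: "f z = Re z * f 1 + Im z * f \<i>" by (simp only: add scaleR real_scaleR_def)
    have "z powi (-1) = cnj z" using cnj_powi_sphere[OF z, of 1] by simp
    then show "(of_real (f 1) / 2 + of_real (f \<i>) / (2 * \<i>)) * z powi 1
      + (of_real (f 1) / 2 - of_real (f \<i>) / (2 * \<i>)) * z powi (-1) = of_real (f z)"
      unfolding f by (simp add: complex_eq_iff)
  qed
qed (use is_trig_const is_trig_add is_trig_mult in simp_all)

lemma is_trig_polynomial:
  fixes g :: "complex \<Rightarrow> complex"
  assumes "polynomial_function g"
  shows "is_trig g"
proof -
  have "real_polynomial_function (Re \<circ> g)" "real_polynomial_function (Im \<circ> g)"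
    using assms bounded_linear_Re bounded_linear_Im unfolding polynomial_function_def by blast+
  then have "is_trig (\<lambda>z. of_real ((Re \<circ> g) z) + \<i> * of_real ((Im \<circ> g) z))"
    by (intro is_trig_add is_trig_mult is_trig_const is_trig_real_polynomial)
  then show ?thesis by (simp flip: complex_eq)
qed

text \<open>This predicate is stable under limits in L2, sums and scalar multiples. It is carried
  from continuous functions to indicators of closed sets, then of Borel sets, to simple functions
  and finally to all of L2.\<close>

definition trig_dense :: "(complex \<Rightarrow> complex) \<Rightarrow> bool" where
  "trig_dense u \<longleftrightarrow> u \<in> L2 \<and> (\<forall>e>0. \<exists>v. v \<in> L2 \<and> is_trig v \<and> L2_norm (\<lambda>z. u z - v z) < e)"

lemma trig_dense_limit:
  assumes u: "u \<in> L2" and v: "\<And>n. trig_dense (v n)" and lim: "(\<lambda>n. L2_norm (\<lambda>z. v n z - u z)) \<longlonglongrightarrow> 0"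
  shows "trig_dense u"
  unfolding trig_dense_def
proof (intro conjI allI impI u)
  fix e :: real assume e: "0 < e"
  have "\<forall>\<^sub>F n in sequentially. L2_norm (\<lambda>z. v n z - u z) < e / 2"
    by (rule order_tendstoD(2)[OF lim]) (use e in simp)
  then obtain n where n: "L2_norm (\<lambda>z. v n z - u z) < e / 2"
    by (meson eventually_happens trivial_limit_sequentially)
  obtain w where w: "w \<in> L2" "is_trig w" "L2_norm (\<lambda>z. v n z - w z) < e / 2"
    using v[of n] e unfolding trig_dense_def by (meson half_gt_zero)
  have "L2_norm (\<lambda>z. u z - w z) < e"
    using L2_triangle_diff[OF u _ w(1), of "v n"] v[of n] n w(3)
    by (simp add: trig_dense_def L2_norm_minus_commute[of u])
  with w show "\<exists>v. v \<in> L2 \<and> is_trig v \<and> L2_norm (\<lambda>z. u z - v z) < e" by blast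
qed

lemma trig_dense_add:
  assumes "trig_dense u" "trig_dense v"
  shows "trig_dense (\<lambda>z. u z + v z)"
  unfolding trig_dense_def
proof (intro conjI allI impI)
  show "(\<lambda>z. u z + v z) \<in> L2" using assms by (auto simp: trig_dense_def intro: L2_add)
  fix e :: real assume e: "0 < e"
  obtain u' where u': "u' \<in> L2" "is_trig u'" "L2_norm (\<lambda>z. u z - u' z) < e / 2"
    using assms(1) e unfolding trig_dense_def by (meson half_gt_zero)
  obtain v' where v': "v' \<in> L2" "is_trig v'" "L2_norm (\<lambda>z. v z - v' z) < e / 2"
    using assms(2) e unfolding trig_dense_def by (meson half_gt_zero)
  have "L2_norm (\<lambda>z. (u z - u' z) + (v z - v' z)) \<le> L2_norm (\<lambda>z. u z - u' z) + L2_norm (\<lambda>z. v z - v' z)"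
    using assms u' v' by (intro L2_triangle L2_diff) (auto simp: trig_dense_def)
  then have "L2_norm (\<lambda>z. (u z + v z) - (u' z + v' z)) < e"
    using u'(3) v'(3) by (simp add: algebra_simps)
  with u' v' show "\<exists>w. w \<in> L2 \<and> is_trig w \<and> L2_norm (\<lambda>z. (u z + v z) - w z) < e"
    by (intro exI[of _ "\<lambda>z. u' z + v' z"]) (auto intro: L2_add is_trig_add)
qed

lemma trig_dense_continuous:
  assumes "continuous_on (sphere 0 1) u"
  shows "trig_dense u"
  unfolding trig_dense_def
proof (intro conjI allI impI continuous_L2 assms)
  fix e :: real assume e: "0 < e"
  obtain g where g: "polynomial_function g" "\<And>z. z \<in> sphere 0 1 \<Longrightarrow> cmod (u z - g z) < e / 2"
    using Stone_Weierstrass_polynomial_function[OF compact_sphere assms, of "e / 2"] e by auto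
  have gL: "g \<in> L2" by (intro continuous_L2 continuous_on_polymonial_function g)
  have "L2_norm (\<lambda>z. u z - g z) \<le> e / 2"
    by (intro L2_norm_le_const L2_diff gL continuous_L2 assms less_imp_le[OF g(2)]) (use e in auto)
  then show "\<exists>w. w \<in> L2 \<and> is_trig w \<and> L2_norm (\<lambda>z. u z - w z) < e"
    using gL is_trig_polynomial[OF g(1)] e by (intro exI[of _ g]) auto
qed

lemma trig_dense_cmult:
  assumes "trig_dense u"
  shows "trig_dense (\<lambda>z. c * u z)"
proof (cases "c = 0")
  case True
  then show ?thesis using trig_dense_continuous[of "\<lambda>_. 0"] by simp
next
  case False
  show ?thesis unfolding trig_dense_def
  proof (intro conjI allI impI)
    show "(\<lambda>z. c * u z) \<in> L2" using assms by (auto simp: trig_dense_def intro: L2_cmult)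
    fix e :: real assume e: "0 < e"
    obtain v where v: "v \<in> L2" "is_trig v" "L2_norm (\<lambda>z. u z - v z) < e / cmod c"
      using assms e False unfolding trig_dense_def by (meson divide_pos_pos zero_less_norm_iff)
    have "L2_norm (\<lambda>z. c * (u z - v z)) < e"
      using v(3) False by (simp only: L2_norm_cmult) (simp add: field_simps)
    with v show "\<exists>w. w \<in> L2 \<and> is_trig w \<and> L2_norm (\<lambda>z. c * u z - w z) < e"
      by (intro exI[of _ "\<lambda>z. c * v z"]) (auto intro: L2_cmult is_trig_mult is_trig_const simp: algebra_simps)
  qed
qed

lemma trig_dense_sum: "(\<And>i. i \<in> I \<Longrightarrow> trig_dense (f i)) \<Longrightarrow> trig_dense (\<lambda>z. \<Sum>i\<in>I. f i z)"
  by (induction I rule: infinite_finite_induct) (auto intro: trig_dense_add trig_dense_continuous)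

lemma indicator_L2:
  assumes "A \<in> sets borel"
  shows "(indicator A :: complex \<Rightarrow> complex) \<in> L2"
proof (rule L2_dominated[OF L2_const[of 1]])
  show "(indicator A :: complex \<Rightarrow> complex) \<in> borel_measurable circle"
    using measurable_restrict_space1[OF borel_measurable_indicator[OF assms]]
    by (simp cong: measurable_cong_sets)
qed (simp add: indicator_def)

text \<open>Closed sets are stable under intersection and generate the Borel sets, so the induction
  meets only complements and disjoint unions. The latter are handled by dominated
  convergence.\<close>

lemma trig_dense_indicator:
  assumes "A \<in> sets (borel :: complex measure)"
  shows "trig_dense (indicator A)"
proof -
  have stable: "Int_stable (Collect closed :: complex set set)" by (auto simp: Int_stable_def)
  have sub: "Collect closed \<subseteq> Pow (UNIV :: complex set)" by simp
  have A: "A \<in> sigma_sets UNIV (Collect closed)"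
    using assms by (simp add: borel_eq_closed)
  from stable sub A show ?thesis
  proof (induction rule: sigma_sets_induct_disjoint)
    case (basic C)
    then have C: "closed C" by simp
    \<comment> \<open>\<open>infdist z {}\<close> is 0 by convention, so for the empty set the
      approximants below would be constantly 1.\<close>
    show ?case
    proof (cases "C = {}")
      case True
      then show ?thesis by (simp add: trig_dense_continuous indicator_def)
    next
      case False
      \<comment> \<open>Equal to 1 on \<open>C\<close>, and 0 at \<open>z\<close> once
        \<open>n\<close> exceeds the reciprocal of the distance from \<open>z\<close> to
        \<open>C\<close>.\<close>
      let ?v = "\<lambda>n z. complex_of_real (max 0 (1 - real n * infdist z C))"
      show ?thesis
      proof (rule trig_dense_limit[where v = ?v])
        show "indicator C \<in> L2" using C by (intro indicator_L2) simp
        have cont: "continuous_on (sphere 0 1) (?v n)" for n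
          by (intro continuous_intros)
        then show "trig_dense (?v n)" for n by (intro trig_dense_continuous)
        show "(\<lambda>n. L2_norm (\<lambda>z. ?v n z - indicator C z)) \<longlonglongrightarrow> 0"
        proof (rule L2_dominated_convergence[OF _ _ L2_const[of 1]])
          show "?v n \<in> L2" for n by (intro continuous_L2 cont)
          show "indicator C \<in> L2" using C by (intro indicator_L2) simp
          show "cmod (?v n z) \<le> cmod 1" for n z by (simp add: infdist_nonneg)
          fix z
          show "(\<lambda>n. ?v n z) \<longlonglongrightarrow> indicator C z"
          proof (cases "z \<in> C")
            case True
            then show ?thesis by simp
          next
            case z: False
            then have pos: "infdist z C > 0" by (intro infdist_pos_not_in_closed C False)
            obtain m :: nat where m: "1 / infdist z C < real m" using reals_Archimedean2 by blast
            have "?v n z = 0" if "m \<le> n" for n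
            proof -
              have "1 / infdist z C \<le> real n" using m that by (smt (verit) of_nat_mono)
              then have "1 \<le> real n * infdist z C" using pos by (simp add: field_simps)
              then show ?thesis by simp
            qed
            then have "\<forall>\<^sub>F n in sequentially. ?v n z = 0"
              unfolding eventually_sequentially by blast
            then show ?thesis using z by (simp add: tendsto_eventually)
          qed
        qed
      qed
    qed
  next
    case empty
    then show ?case by (simp add: trig_dense_continuous indicator_def)
  next
    case (compl A)
    have "trig_dense (\<lambda>z. 1 + (-1) * indicator A z)"
      by (intro trig_dense_add trig_dense_cmult compl trig_dense_continuous) simp
    then show ?case by (rule back_subst[of trig_dense]) (auto simp: indicator_def)
  next
    case (union A)
    have A: "A i \<in> sets borel" for i using union by (auto simp: borel_eq_closed)
    show ?case
    proof (rule trig_dense_limit[where v = "\<lambda>n. indicator (\<Union>i<n. A i)"])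
      show "indicator (\<Union> (range A)) \<in> L2" using A by (intro indicator_L2) blast
      show "trig_dense (indicator (\<Union>i<n. A i))" for n
      proof -
        have "trig_dense (\<lambda>z. \<Sum>i<n. indicator (A i) z)" by (intro trig_dense_sum union)
        moreover have "(\<lambda>z. \<Sum>i<n. indicator (A i) z) = (indicator (\<Union>i<n. A i) :: complex \<Rightarrow> complex)"
          by (rule ext, rule indicator_UN_disjoint[symmetric])
            (use union(1) disjoint_family_on_mono[of "{..<n}" UNIV A] in auto)
        ultimately show ?thesis by simp
      qed
      show "(\<lambda>n. L2_norm (\<lambda>z. indicator (\<Union>i<n. A i) z - indicator (\<Union> (range A)) z)) \<longlonglongrightarrow> 0"
      proof (rule L2_dominated_convergence[OF _ _ L2_const[of 1]])
        show "indicator (\<Union>i<n. A i) \<in> L2" for n using A by (intro indicator_L2) blast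
        show "indicator (\<Union> (range A)) \<in> L2" using A by (intro indicator_L2) blast
        show "(\<lambda>n. indicator (\<Union>i<n. A i) z) \<longlonglongrightarrow> (indicator (\<Union> (range A)) z :: complex)" for z
          by (rule LIMSEQ_indicator_UN)
      qed (simp add: indicator_def)
    qed
  qed
qed

lemma trig_dense_L2:
  assumes u: "u \<in> L2"
  shows "trig_dense u"
proof -
  obtain F where "(\<forall>i. simple_function circle (F i)) \<and> (\<forall>z\<in>space circle. (\<lambda>i. F i z) \<longlonglongrightarrow> u z)
      \<and> (\<forall>i. \<forall>z\<in>space circle. dist (F i z) 0 \<le> 2 * dist (u z) 0)"
    using borel_measurable_implies_sequence_metric[OF L2_measurable[OF u], of 0] by (elim exE)
  then have F: "\<And>i. simple_function circle (F i)"
      "\<And>z. z \<in> space circle \<Longrightarrow> (\<lambda>i. F i z) \<longlonglongrightarrow> u z"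
      "\<And>i z. z \<in> space circle \<Longrightarrow> dist (F i z) 0 \<le> 2 * dist (u z) 0"
    by blast+
  have FL: "F i \<in> L2" for i
    by (rule L2_dominated[OF L2_cmult[OF u, of 2] borel_measurable_simple_function[OF F(1)]])
      (use F(3) in \<open>auto simp: norm_mult\<close>)
  have "trig_dense (F i)" for i
  proof -
    define G where "G z = (\<Sum>y\<in>F i ` space circle. y * indicator (F i -` {y} \<inter> space circle) z)" for z
    have "F i -` {y} \<inter> space circle \<in> sets borel" for y
      using simple_functionD(2)[OF F(1), of i "{y}"] by (auto simp: sets_restrict_space)
    then have dense: "trig_dense G"
      unfolding G_def[abs_def] by (intro trig_dense_sum trig_dense_cmult trig_dense_indicator)
    then have GL: "G \<in> L2" by (simp add: trig_dense_def)
    have eq: "G z = F i z" if "z \<in> sphere 0 1" for z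
    proof -
      have "F i z = (\<Sum>y\<in>F i ` space circle. indicator (F i -` {y} \<inter> space circle) z *\<^sub>R y)"
        by (rule simple_function_indicator_representation_banach[OF F(1)]) (use that in simp)
      also have "\<dots> = G z"
        unfolding G_def by (rule sum.cong[OF refl]) (simp add: indicator_def)
      finally show ?thesis by (rule sym)
    qed
    have "L2_norm (\<lambda>z. G z - F i z) \<le> 0"
      by (rule L2_norm_le_const[OF L2_diff[OF GL FL]]) (simp_all add: eq)
    then have "L2_norm (\<lambda>z. G z - F i z) = 0"
      using L2_norm_nonneg by (rule order_antisym)
    \<comment> \<open>\<open>G\<close> and \<open>F i\<close> may differ off the circle. The
      constant sequence \<open>G\<close>, at distance 0 from \<open>F i\<close>, transfers density
      from one to the other.\<close>
    then have "(\<lambda>n::nat. L2_norm (\<lambda>z. G z - F i z)) \<longlonglongrightarrow> 0" by simp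
    then show ?thesis by (rule trig_dense_limit[OF FL dense])
  qed
  moreover have "(\<lambda>n. L2_norm (\<lambda>z. F n z - u z)) \<longlonglongrightarrow> 0"
    by (rule L2_dominated_convergence[OF FL u L2_cmult[OF u, of 2]])
      (use F in \<open>auto simp: norm_mult\<close>)
  ultimately show ?thesis by (intro trig_dense_limit[OF u])
qed

section \<open>Parseval, Riesz--Fischer and the Szego projector\<close>

lemma L2_norm_cong: "(\<And>z. z \<in> sphere 0 1 \<Longrightarrow> u z = v z) \<Longrightarrow> L2_norm u = L2_norm v"
  unfolding L2_norm_def by (intro arg_cong[where f = sqrt] Bochner_Integration.integral_cong) auto

lemma L2_norm_const: "L2_norm (\<lambda>z. c) = cmod c"
  by (simp add: L2_norm_def)

lemma integral_norm_le_L2_norm: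
  assumes "u \<in> L2"
  shows "(LINT z|circle. cmod (u z)) \<le> L2_norm u"
  using L2_Cauchy_Schwarz_norm[OF assms L2_const[of 1]] by (simp add: L2_norm_const)

definition psum :: "(nat \<Rightarrow> complex) \<Rightarrow> nat \<Rightarrow> complex \<Rightarrow> complex" where
  "psum c n z = (\<Sum>k<n. c k * z ^ k)"

lemma psum_eq_trig_sum: "psum c n = trig_sum (int ` {..<n}) (\<lambda>k. c (nat k))"
  unfolding psum_def trig_sum_def by (rule ext) (simp add: sum.reindex)

lemma continuous_on_psum [continuous_intros]: "continuous_on S (psum c n)"
  unfolding psum_def[abs_def] by (intro continuous_intros)

lemma L2_psum: "psum c n \<in> L2"
  by (simp add: psum_eq_trig_sum L2_trig_sum)

lemma fourier_psum: "fourier (psum c n) k = (if 0 \<le> k \<and> k < int n then c (nat k) else 0)"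
  by (auto simp: psum_eq_trig_sum fourier_trig_sum image_iff zero_le_imp_eq_int)
    (metis lessThan_iff nat_0_le nat_less_iff)

lemma psum_plus_part: "psum c n \<in> plus_part L2"
  by (simp add: plus_part_def L2_psum fourier_psum)

lemma L2_norm_diff_psum:
  assumes "u \<in> L2"
  shows "(L2_norm (\<lambda>z. u z - psum c n z))\<^sup>2
    = (L2_norm u)\<^sup>2 - (\<Sum>k<n. (cmod (fourier u (int k)))\<^sup>2) + (\<Sum>k<n. (cmod (fourier u (int k) - c k))\<^sup>2)"
  unfolding psum_eq_trig_sum by (subst L2_norm_diff_trig_sum[OF assms]) (simp_all add: sum.reindex)

lemma L2_norm_psum: "(L2_norm (psum c n))\<^sup>2 = (\<Sum>k<n. (cmod (c k))\<^sup>2)"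
  unfolding psum_eq_trig_sum by (subst L2_norm_trig_sum) (simp_all add: sum.reindex)

lemma L2_norm_psum_diff_psum:
  assumes "m \<le> n"
  shows "(L2_norm (\<lambda>z. psum c n z - psum c m z))\<^sup>2 = (\<Sum>k=m..<n. (cmod (c k))\<^sup>2)"
proof -
  have "(L2_norm (\<lambda>z. psum c n z - psum c m z))\<^sup>2 = (\<Sum>k<n. (cmod (c k))\<^sup>2) - (\<Sum>k<m. (cmod (c k))\<^sup>2)"
    using assms by (simp add: L2_norm_diff_psum L2_psum L2_norm_psum fourier_psum)
  also have "\<dots> = (\<Sum>k=m..<n. (cmod (c k))\<^sup>2)"
    using assms sum_diff_nat_ivl[of 0 m n "\<lambda>k. (cmod (c k))\<^sup>2"] by (simp add: atLeast0LessThan)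
  finally show ?thesis .
qed

lemma plus_part_L2D: "u \<in> plus_part L2 \<Longrightarrow> u \<in> L2" "u \<in> plus_part L2 \<Longrightarrow> k < 0 \<Longrightarrow> fourier u k = 0"
  by (auto simp: plus_part_def)

text \<open>Past the largest frequency of a nearby trigonometric polynomial, the partial sum is the
  Fourier sum over a set containing all frequencies of that polynomial, because the coefficients of
  \<open>u\<close> of negative index vanish. By best approximation it is at least as close to
  \<open>u\<close>.\<close>

lemma plus_part_approx:
  assumes u: "u \<in> plus_part L2"
  shows "(\<lambda>n. L2_norm (\<lambda>z. u z - psum (\<lambda>k. fourier u (int k)) n z)) \<longlonglongrightarrow> 0"
proof (rule LIMSEQ_I)
  fix e :: real assume "0 < e"
  then obtain v where v: "is_trig v" "L2_norm (\<lambda>z. u z - v z) < e"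
    using trig_dense_L2[OF plus_part_L2D(1)[OF u]] unfolding trig_dense_def by blast
  then obtain K p where K: "finite K" and p: "\<And>z. z \<in> sphere 0 1 \<Longrightarrow> v z = trig_sum K p z"
    unfolding is_trig_def by blast
  obtain N :: nat where N: "\<And>k. k \<in> K \<Longrightarrow> k < int N"
  proof -
    have "k < int (nat (Max K) + 1)" if "k \<in> K" for k
      using Max_ge[OF K that] by linarith
    then show ?thesis using that by blast
  qed
  show "\<exists>N. \<forall>n\<ge>N. norm (L2_norm (\<lambda>z. u z - psum (\<lambda>k. fourier u (int k)) n z) - 0) < e"
  proof (intro exI[of _ N] allI impI)
    fix n assume n: "N \<le> n"
    let ?K = "K \<union> int ` {..<n}" and ?p = "\<lambda>k. if k \<in> K then p k else 0"
    have "psum (\<lambda>k. fourier u (int k)) n z = trig_sum ?K (fourier u) z" for z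
      unfolding psum_eq_trig_sum trig_sum_def
    proof (rule sum.mono_neutral_cong_left)
      show "\<forall>i\<in>?K - int ` {..<n}. fourier u i * z powi i = 0"
      proof
        fix i assume i: "i \<in> ?K - int ` {..<n}"
        have "i < 0"
        proof (rule ccontr)
          assume "\<not> i < 0"
          moreover have "i < int n" using i N[of i] n by auto
          ultimately have "i \<in> int ` {..<n}" by (intro image_eqI[of _ _ "nat i"]) auto
          with i show False by blast
        qed
        then show "fourier u i * z powi i = 0" using u by (simp add: plus_part_L2D)
      qed
    qed (use K in auto)
    then have "L2_norm (\<lambda>z. u z - psum (\<lambda>k. fourier u (int k)) n z)
        \<le> L2_norm (\<lambda>z. u z - trig_sum ?K ?p z)"
      using K by (simp add: L2_best_approximation plus_part_L2D(1)[OF u])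
    also have "\<dots> = L2_norm (\<lambda>z. u z - v z)"
    proof (rule L2_norm_cong)
      fix z :: complex assume z: "z \<in> sphere 0 1"
      have "trig_sum ?K ?p z = trig_sum K p z"
        unfolding trig_sum_def by (rule sum.mono_neutral_cong_right) (use K in auto)
      then show "u z - trig_sum ?K ?p z = u z - v z" using p[OF z] by simp
    qed
    finally show "norm (L2_norm (\<lambda>z. u z - psum (\<lambda>k. fourier u (int k)) n z) - 0) < e"
      using v(2) by simp
  qed
qed

lemma Parseval:
  assumes u: "u \<in> plus_part L2"
  shows "(\<lambda>k. (cmod (fourier u (int k)))\<^sup>2) sums (L2_norm u)\<^sup>2"
proof -
  have "(\<lambda>n. (L2_norm u)\<^sup>2 - (L2_norm (\<lambda>z. u z - psum (\<lambda>k. fourier u (int k)) n z))\<^sup>2)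
      \<longlonglongrightarrow> (L2_norm u)\<^sup>2 - 0\<^sup>2"
    by (intro tendsto_intros plus_part_approx u)
  then show ?thesis
    unfolding sums_def by (simp add: L2_norm_diff_psum plus_part_L2D(1)[OF u])
qed

text \<open>A subsequence with summable increments converges almost everywhere, and Fatou's lemma
  bounds the distance from its limit to every partial sum, not only those of the subsequence, by the
  tail of the series.\<close>

lemma Riesz_Fischer:
  assumes c: "summable (\<lambda>k. (cmod (c k))\<^sup>2)"
  obtains g where "g \<in> L2" "(\<lambda>n. L2_norm (\<lambda>z. g z - psum c n z)) \<longlonglongrightarrow> 0"
proof -
  have "\<exists>N. \<forall>m\<ge>N. \<forall>n. (\<Sum>k=m..<n. (cmod (c k))\<^sup>2) < (1 / 4) ^ j" for j :: nat
    using c[unfolded summable_Cauchy, rule_format, of "(1 / 4) ^ j"] by (simp add: abs_of_nonneg sum_nonneg)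
  then obtain N where N: "\<And>j m n. N j \<le> m \<Longrightarrow> (\<Sum>k=m..<n. (cmod (c k))\<^sup>2) < (1 / 4) ^ j"
    by metis
  \<comment> \<open>Adding up all \<open>N i\<close> makes \<open>r\<close> increasing with
    \<open>N j \<le> r j\<close>; the summand \<open>j\<close> makes it unbounded.\<close>
  define r where "r j = (\<Sum>i\<le>j. N i) + j" for j
  have rN: "N j \<le> r j" for j unfolding r_def by (simp add: member_le_sum trans_le_add1)
  have r_Suc: "r j \<le> r (Suc j)" for j unfolding r_def by simp
  have r_ge: "j \<le> r j" for j unfolding r_def by simp
  let ?s = "\<lambda>n. psum c n"
  define b where "b j z = ?s (r (Suc j)) z - ?s (r j) z" for j z
  have bL: "b j \<in> L2" for j unfolding b_def[abs_def] by (intro L2_diff L2_psum)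
  have b_norm: "(LINT z|circle. cmod (b j z)) \<le> (1 / 2) ^ j" for j
  proof -
    have "(L2_norm (b j))\<^sup>2 \<le> (1 / 4) ^ j"
      unfolding b_def[abs_def] L2_norm_psum_diff_psum[OF r_Suc] using N[OF rN] less_imp_le by blast
    also have "\<dots> = ((1 / 2) ^ j)\<^sup>2"
      by (subst power_mult[symmetric], subst mult.commute, subst power_mult) (simp add: power2_eq_square)
    finally have "L2_norm (b j) \<le> (1 / 2) ^ j" by (rule power2_le_imp_le) simp
    then show ?thesis using integral_norm_le_L2_norm[OF bL, of j] by linarith
  qed
  have "AE z in circle. convergent (\<lambda>j. ?s (r j) z)"
  proof -
    have [measurable]: "b j \<in> borel_measurable circle" for j using bL by (simp add: L2_def)
    have "(\<integral>\<^sup>+z. (\<Sum>j. ennreal (cmod (b j z))) \<partial>circle) = (\<Sum>j. \<integral>\<^sup>+z. ennreal (cmod (b j z)) \<partial>circle)"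
      by (rule nn_integral_suminf) measurable
    also have "\<dots> \<le> (\<Sum>j. ennreal ((1 / 2) ^ j))"
    proof (rule suminf_le)
      fix j
      have "(\<integral>\<^sup>+z. ennreal (cmod (b j z)) \<partial>circle) = ennreal (LINT z|circle. cmod (b j z))"
        by (rule nn_integral_eq_integral) (use L2_integrable[OF bL] in auto)
      then show "(\<integral>\<^sup>+z. ennreal (cmod (b j z)) \<partial>circle) \<le> ennreal ((1 / 2) ^ j)"
        using b_norm by (simp add: ennreal_leI)
    qed auto
    also have "\<dots> = ennreal (\<Sum>j. (1 / 2) ^ j)"
      by (rule suminf_ennreal2) (auto intro: summable_geometric)
    finally have "(\<integral>\<^sup>+z. (\<Sum>j. ennreal (cmod (b j z))) \<partial>circle) < \<infinity>"
      by (rule order.strict_trans1) simp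
    then have "(\<integral>\<^sup>+z. (\<Sum>j. ennreal (cmod (b j z))) \<partial>circle) \<noteq> \<infinity>" by simp
    then have "AE z in circle. (\<Sum>j. ennreal (cmod (b j z))) \<noteq> \<infinity>"
      by (intro nn_integral_PInf_AE) measurable
    then show ?thesis
    proof eventually_elim
      case (elim z)
      then have "summable (\<lambda>j. cmod (b j z))" by (intro summable_suminf_not_top) auto
      then have "summable (\<lambda>j. b j z)" by (rule summable_norm_cancel)
      then have "convergent (\<lambda>n. ?s (r 0) z + (\<Sum>j<n. b j z))"
        unfolding summable_iff_convergent by (simp only: convergent_add_const_iff)
      moreover have "?s (r 0) z + (\<Sum>j<n. b j z) = ?s (r n) z" for n
        unfolding b_def by (subst sum_lessThan_telescope) simp
      ultimately show ?case by simp
    qed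
  qed
  then have conv: "AE z in circle. (\<lambda>j. ?s (r j) z) \<longlonglongrightarrow> lim (\<lambda>j. ?s (r j) z)"
    by (simp add: convergent_LIMSEQ_iff)
  define g where "g z = lim (\<lambda>j. ?s (r j) z)" for z
  have sm [measurable]: "?s n \<in> borel_measurable circle" for n using L2_psum by (simp add: L2_def)
  have gm [measurable]: "g \<in> borel_measurable circle"
    unfolding g_def[abs_def] by (rule borel_measurable_lim_metric) measurable
  define T where "T m = (\<Sum>k. (cmod (c (k + m)))\<^sup>2)" for m
  have T: "integrable circle (\<lambda>z. (cmod (g z - ?s m z))\<^sup>2) \<and> (LINT z|circle. (cmod (g z - ?s m z))\<^sup>2) \<le> T m" for m
  proof -
    \<comment> \<open>The shift by \<open>m\<close> keeps the index \<open>r (j + m)\<close> from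
      falling below \<open>m\<close>.\<close>
    let ?F = "\<lambda>j z. (cmod (?s (r (j + m)) z - ?s m z))\<^sup>2"
    have 1: "AE z in circle. (\<lambda>j. ?F j z) \<longlonglongrightarrow> (cmod (g z - ?s m z))\<^sup>2"
      using conv
    proof eventually_elim
      case (elim z)
      then have "(\<lambda>j. ?s (r (j + m)) z) \<longlonglongrightarrow> g z" unfolding g_def by (rule LIMSEQ_ignore_initial_segment)
      then show ?case by (intro tendsto_intros)
    qed
    have 2: "(LINT z|circle. ?F j z) \<le> T m" for j
    proof -
      have "m \<le> r (j + m)" using r_ge[of "j + m"] by linarith
      then have "(LINT z|circle. ?F j z) = (\<Sum>k=m..<r (j + m). (cmod (c k))\<^sup>2)"
        by (simp flip: L2_norm_square add: L2_norm_psum_diff_psum)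
      also have "\<dots> = (\<Sum>k<r (j + m) - m. (cmod (c (k + m)))\<^sup>2)"
        using sum.shift_bounds_nat_ivl[of "\<lambda>k. (cmod (c k))\<^sup>2" 0 m "r (j + m) - m"] \<open>m \<le> r (j + m)\<close>
        by (simp add: atLeast0LessThan)
      also have "\<dots> \<le> T m" unfolding T_def by (intro sum_le_suminf summable_ignore_initial_segment[OF c]) simp_all
      finally show ?thesis .
    qed
    have 3: "integrable circle (?F j)" for j
      by (intro L2_integrable_square L2_diff L2_psum)
    have 4: "(\<lambda>z. (cmod (g z - ?s m z))\<^sup>2) \<in> borel_measurable circle" by measurable
    show ?thesis
      by (intro conjI integral_Fatou[OF 4 3 zero_le_power2 1 2])
  qed
  have gs: "(\<lambda>z. g z - ?s m z) \<in> L2" for m using T[of m] by (simp add: L2_def)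
  have gL: "g \<in> L2" using L2_add[OF gs[of 0] L2_psum[of c 0]] by simp
  have T0: "T \<longlonglongrightarrow> 0"
  proof -
    have "(\<lambda>m. (\<Sum>k. (cmod (c k))\<^sup>2) - (\<Sum>k<m. (cmod (c k))\<^sup>2)) \<longlonglongrightarrow> (\<Sum>k. (cmod (c k))\<^sup>2) - (\<Sum>k. (cmod (c k))\<^sup>2)"
      by (intro tendsto_intros summable_LIMSEQ c)
    then show ?thesis unfolding T_def[abs_def] by (simp add: suminf_minus_initial_segment[OF c])
  qed
  have "(\<lambda>n. L2_norm (\<lambda>z. g z - ?s n z)) \<longlonglongrightarrow> 0"
  proof (rule tendsto_sandwich[OF _ _ tendsto_const])
    show "\<forall>\<^sub>F n in sequentially. L2_norm (\<lambda>z. g z - ?s n z) \<le> sqrt (T n)"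
      using T unfolding L2_norm_def by simp
    show "(\<lambda>n. sqrt (T n)) \<longlonglongrightarrow> 0" using tendsto_real_sqrt[OF T0] by simp
  qed simp
  then show ?thesis using that gL by blast
qed

lemma fourier_of_limit:
  assumes g: "g \<in> L2" and s: "\<And>n. s n \<in> L2" and lim: "(\<lambda>n. L2_norm (\<lambda>z. g z - s n z)) \<longlonglongrightarrow> 0"
  shows "(\<lambda>n. fourier (s n) k) \<longlonglongrightarrow> fourier g k"
proof -
  have "(\<lambda>n. fourier g k - fourier (s n) k) \<longlonglongrightarrow> 0"
  proof (rule Lim_null_comparison[OF _ lim])
    show "\<forall>\<^sub>F n in sequentially. norm (fourier g k - fourier (s n) k) \<le> L2_norm (\<lambda>z. g z - s n z)"
      using norm_fourier_le[OF L2_diff[OF g s]] by (simp add: fourier_diff g s)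
  qed
  from tendsto_diff[OF tendsto_const[of "fourier g k"] this] show ?thesis by simp
qed

lemma L2_inner_of_limit:
  assumes g: "g \<in> L2" and s: "\<And>n. s n \<in> L2" and lim: "(\<lambda>n. L2_norm (\<lambda>z. g z - s n z)) \<longlonglongrightarrow> 0" and v: "v \<in> L2"
  shows "(\<lambda>n. L2_inner v (s n)) \<longlonglongrightarrow> L2_inner v g"
proof -
  have lim': "(\<lambda>n. L2_norm v * L2_norm (\<lambda>z. g z - s n z)) \<longlonglongrightarrow> 0"
    using tendsto_mult[OF tendsto_const lim, of "L2_norm v"] by simp
  have "(\<lambda>n. L2_inner v g - L2_inner v (s n)) \<longlonglongrightarrow> 0"
  proof (rule Lim_null_comparison[OF _ lim'])
    show "\<forall>\<^sub>F n in sequentially. norm (L2_inner v g - L2_inner v (s n)) \<le> L2_norm v * L2_norm (\<lambda>z. g z - s n z)"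
      using L2_Cauchy_Schwarz[OF v L2_diff[OF g s]] by (simp add: L2_inner_diff_right g s v)
  qed
  from tendsto_diff[OF tendsto_const[of "L2_inner v g"] this] show ?thesis by simp
qed

text \<open>This gives the choice in \<open>szego_proj\<close> its meaning. Bessel's inequality and
  completeness supply a function with the coefficients of \<open>f\<close> at indices
  \<open>k \<ge> 0\<close>. Orthogonality holds against finite sums and passes to the limit in the
  second argument.\<close>

lemma szego_proj_exists:
  assumes f: "f \<in> L2"
  shows "\<exists>g. g \<in> plus_part L2 \<and> (\<forall>h \<in> plus_part L2. L2_inner (\<lambda>z. f z - g z) h = 0)"
proof -
  let ?c = "\<lambda>k. fourier f (int k)"
  have "(\<Sum>k<n. (cmod (?c k))\<^sup>2) \<le> (L2_norm f)\<^sup>2" for n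
    using Bessel[OF f, of "int ` {..<n}"] by (simp add: sum.reindex)
  then have "summable (\<lambda>k. (cmod (?c k))\<^sup>2)"
    by (intro summableI_nonneg_bounded) auto
  then obtain g where g: "g \<in> L2" "(\<lambda>n. L2_norm (\<lambda>z. g z - psum ?c n z)) \<longlonglongrightarrow> 0"
    by (rule Riesz_Fischer)
  have lim: "(\<lambda>n. fourier (psum ?c n) k) \<longlonglongrightarrow> fourier g k" for k
    by (rule fourier_of_limit[OF g(1) L2_psum g(2)])
  have neg: "fourier g k = 0" if "k < 0" for k
    using lim[of k] that by (simp add: fourier_psum LIMSEQ_const_iff)
  have pos: "fourier g k = fourier f k" if "0 \<le> k" for k
  proof -
    have "\<forall>\<^sub>F n in sequentially. fourier (psum ?c n) k = fourier f k"
      unfolding eventually_sequentially using that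
      by (intro exI[of _ "nat k + 1"]) (auto simp: fourier_psum)
    then have "(\<lambda>n. fourier (psum ?c n) k) \<longlonglongrightarrow> fourier f k" by (rule tendsto_eventually)
    then show ?thesis using LIMSEQ_unique lim by blast
  qed
  have "L2_inner (\<lambda>z. f z - g z) h = 0" if h: "h \<in> plus_part L2" for h
  proof -
    let ?h = "psum (\<lambda>k. fourier h (int k))"
    have fg: "(\<lambda>z. f z - g z) \<in> L2" by (intro L2_diff f g)
    have "L2_inner (\<lambda>z. f z - g z) (?h n) = 0" for n
    proof -
      have "L2_inner (?h n) (\<lambda>z. f z - g z) = 0"
        unfolding psum_eq_trig_sum
        by (subst L2_inner_trig_sum_left[OF fg]) (auto simp: fourier_diff f g pos intro!: sum.neutral)
      then show ?thesis by (subst L2_inner_commute) simp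
    qed
    moreover have "(\<lambda>n. L2_inner (\<lambda>z. f z - g z) (?h n)) \<longlonglongrightarrow> L2_inner (\<lambda>z. f z - g z) h"
      by (rule L2_inner_of_limit[OF plus_part_L2D(1)[OF h] L2_psum plus_part_approx[OF h] fg])
    ultimately show ?thesis by (simp add: LIMSEQ_const_iff)
  qed
  moreover have "g \<in> plus_part L2" using g neg by (simp add: plus_part_def)
  ultimately show ?thesis by blast
qed

lemma szego_proj_plus_part: "f \<in> L2 \<Longrightarrow> szego_proj f \<in> plus_part L2"
  unfolding szego_proj_def using someI_ex[OF szego_proj_exists] by blast

lemma szego_proj_inner:
  assumes "f \<in> L2" "h \<in> plus_part L2"
  shows "L2_inner (szego_proj f) h = L2_inner f h"
proof -
  have "L2_inner (\<lambda>z. f z - szego_proj f z) h = 0"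
    unfolding szego_proj_def using someI_ex[OF szego_proj_exists[OF assms(1)]] assms(2) by blast
  then show ?thesis
    using assms szego_proj_plus_part[OF assms(1)] by (simp add: L2_inner_diff_left plus_part_L2D)
qed

section \<open>Convolution of coefficient sequences\<close>

definition conv :: "(nat \<Rightarrow> complex) \<Rightarrow> (nat \<Rightarrow> complex) \<Rightarrow> nat \<Rightarrow> complex" where
  "conv a b k = (\<Sum>l\<le>k. a l * b (k - l))"

definition l2_summable :: "(nat \<Rightarrow> complex) \<Rightarrow> bool" where
  "l2_summable c \<longleftrightarrow> summable (\<lambda>k. (cmod (c k))\<^sup>2)"

definition mass :: "(nat \<Rightarrow> complex) \<Rightarrow> real" where
  "mass c = (\<Sum>k. (cmod (c k))\<^sup>2)"

definition h_summable :: "(nat \<Rightarrow> complex) \<Rightarrow> bool" where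
  "h_summable c \<longleftrightarrow> summable (\<lambda>k. (real k + 1) * (cmod (c k))\<^sup>2)"

definition hsum :: "(nat \<Rightarrow> complex) \<Rightarrow> real" where
  "hsum c = (\<Sum>k. (real k + 1) * (cmod (c k))\<^sup>2)"

section \<open>Norms of coefficient sequences\<close>

lemma l2_summable_triangle:
  assumes "l2_summable a" "l2_summable b"
  shows "l2_summable (\<lambda>k. a k + b k)" "sqrt (mass (\<lambda>k. a k + b k)) \<le> sqrt (mass a) + sqrt (mass b)"
proof -
  have fin: "L2_set (\<lambda>k. cmod (a k + b k)) {..<n} \<le> sqrt (mass a) + sqrt (mass b)" for n
  proof -
    have "L2_set (\<lambda>k. cmod (a k + b k)) {..<n} \<le> L2_set (\<lambda>k. cmod (a k) + cmod (b k)) {..<n}"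
      by (rule L2_set_mono) (auto intro: norm_triangle_ineq)
    also have "\<dots> \<le> L2_set (\<lambda>k. cmod (a k)) {..<n} + L2_set (\<lambda>k. cmod (b k)) {..<n}"
      by (rule L2_set_triangle_ineq)
    also have "\<dots> \<le> sqrt (mass a) + sqrt (mass b)"
      using assms unfolding L2_set_def mass_def l2_summable_def
      by (intro add_mono real_sqrt_le_mono sum_le_suminf) auto
    finally show ?thesis .
  qed
  have a0: "0 \<le> mass a" and b0: "0 \<le> mass b"
    using assms unfolding mass_def l2_summable_def by (auto intro: suminf_nonneg)
  have le: "(\<Sum>k<n. (cmod (a k + b k))\<^sup>2) \<le> (sqrt (mass a) + sqrt (mass b))\<^sup>2" for n
  proof -
    have "(\<Sum>k<n. (cmod (a k + b k))\<^sup>2) = (L2_set (\<lambda>k. cmod (a k + b k)) {..<n})\<^sup>2"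
      unfolding L2_set_def by (simp add: sum_nonneg)
    also have "\<dots> \<le> (sqrt (mass a) + sqrt (mass b))\<^sup>2"
      by (intro power_mono fin) (simp add: L2_set_nonneg)
    finally show ?thesis .
  qed
  show s: "l2_summable (\<lambda>k. a k + b k)"
    unfolding l2_summable_def by (rule summableI_nonneg_bounded[OF _ le]) simp
  have "mass (\<lambda>k. a k + b k) \<le> (sqrt (mass a) + sqrt (mass b))\<^sup>2"
    unfolding mass_def[of "\<lambda>k. a k + b k"] using s le by (intro suminf_le_const) (auto simp: l2_summable_def)
  then have "sqrt (mass (\<lambda>k. a k + b k)) \<le> sqrt ((sqrt (mass a) + sqrt (mass b))\<^sup>2)"
    by (rule real_sqrt_le_mono)
  then show "sqrt (mass (\<lambda>k. a k + b k)) \<le> sqrt (mass a) + sqrt (mass b)"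
    using a0 b0 by simp
qed

lemma l2_summable_uminus: "l2_summable a \<Longrightarrow> l2_summable (\<lambda>k. - a k)"
  by (simp add: l2_summable_def)

lemma mass_uminus: "mass (\<lambda>k. - a k) = mass a"
  by (simp add: mass_def)

lemma l2_summable_diff: "l2_summable a \<Longrightarrow> l2_summable b \<Longrightarrow> l2_summable (\<lambda>k. a k - b k)"
  using l2_summable_triangle(1)[OF _ l2_summable_uminus] by simp

lemma mass_diff_ge:
  assumes "l2_summable a" "l2_summable b"
  shows "\<bar>sqrt (mass a) - sqrt (mass b)\<bar> \<le> sqrt (mass (\<lambda>k. a k - b k))"
  using l2_summable_triangle(2)[OF l2_summable_diff[OF assms] assms(2)]
    l2_summable_triangle(2)[OF l2_summable_diff[OF assms(2,1)] assms(1)]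
    mass_uminus[of "\<lambda>k. a k - b k"] by simp

lemma mass_nonneg: "l2_summable a \<Longrightarrow> 0 \<le> mass a"
  unfolding mass_def l2_summable_def by (auto intro: suminf_nonneg)

lemma l2_summable_cmult: "l2_summable a \<Longrightarrow> l2_summable (\<lambda>k. x * a k)"
  unfolding l2_summable_def norm_mult power_mult_distrib by (rule summable_mult)

lemma mass_cmult: "l2_summable a \<Longrightarrow> mass (\<lambda>k. x * a k) = (cmod x)\<^sup>2 * mass a"
  unfolding l2_summable_def mass_def norm_mult power_mult_distrib by (rule suminf_mult)

text \<open>An isometry onto the unweighted sequence space, by which Minkowski's inequality for
  \<open>mass\<close> becomes the one for \<open>hsum\<close>.\<close>

definition hweight :: "(nat \<Rightarrow> complex) \<Rightarrow> nat \<Rightarrow> complex" where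
  "hweight c k = of_real (sqrt (real k + 1)) * c k"

lemma hweight_norm: "(cmod (hweight c k))\<^sup>2 = (real k + 1) * (cmod (c k))\<^sup>2"
  by (simp add: hweight_def norm_mult power_mult_distrib)

lemma h_summable_hweight: "h_summable c \<longleftrightarrow> l2_summable (hweight c)"
  by (simp add: h_summable_def l2_summable_def hweight_norm)

lemma hsum_hweight: "hsum c = mass (hweight c)"
  by (simp add: hsum_def mass_def hweight_norm)

lemma hweight_add: "hweight (\<lambda>k. a k + b k) = (\<lambda>k. hweight a k + hweight b k)"
  by (simp add: hweight_def fun_eq_iff distrib_left)

lemma hweight_diff: "hweight (\<lambda>k. a k - b k) = (\<lambda>k. hweight a k - hweight b k)"
  by (simp add: hweight_def fun_eq_iff right_diff_distrib)

lemma h_summable_add: "h_summable a \<Longrightarrow> h_summable b \<Longrightarrow> h_summable (\<lambda>k. a k + b k)"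
  by (simp add: h_summable_hweight hweight_add l2_summable_triangle)

lemma h_summable_diff: "h_summable a \<Longrightarrow> h_summable b \<Longrightarrow> h_summable (\<lambda>k. a k - b k)"
  by (simp add: h_summable_hweight hweight_diff l2_summable_diff)

lemma hsum_add_sqrt:
  "h_summable a \<Longrightarrow> h_summable b \<Longrightarrow> sqrt (hsum (\<lambda>k. a k + b k)) \<le> sqrt (hsum a) + sqrt (hsum b)"
  by (simp add: h_summable_hweight hweight_add hsum_hweight l2_summable_triangle)

lemma hsum_nonneg: "h_summable a \<Longrightarrow> 0 \<le> hsum a"
  by (simp add: h_summable_hweight hsum_hweight mass_nonneg)

lemma hsum_diff_ge:
  "h_summable a \<Longrightarrow> h_summable b \<Longrightarrow> \<bar>sqrt (hsum a) - sqrt (hsum b)\<bar> \<le> sqrt (hsum (\<lambda>k. a k - b k))"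
  by (simp add: h_summable_hweight hweight_diff hsum_hweight mass_diff_ge)

lemma h_summable_imp_l2_summable: "h_summable c \<Longrightarrow> l2_summable c"
  unfolding h_summable_def l2_summable_def
  by (erule summable_comparison_test[rotated]) (auto simp: algebra_simps)

lemma mass_le_hsum: "h_summable c \<Longrightarrow> mass c \<le> hsum c"
  using h_summable_imp_l2_summable[of c] unfolding mass_def hsum_def l2_summable_def h_summable_def
  by (intro suminf_le) (auto simp: algebra_simps)

lemma mass_le_tail:
  assumes "h_summable c" "\<And>k. k < n \<Longrightarrow> c k = 0" "0 < n"
  shows "mass c \<le> hsum c / real n"
proof -
  have "real n * mass c = (\<Sum>k. real n * (cmod (c k))\<^sup>2)"
    unfolding mass_def using h_summable_imp_l2_summable[OF assms(1)]
    by (intro suminf_mult[symmetric]) (simp add: l2_summable_def)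
  also have "\<dots> \<le> hsum c" unfolding hsum_def
  proof (rule suminf_le)
    show "real n * (cmod (c k))\<^sup>2 \<le> (real k + 1) * (cmod (c k))\<^sup>2" for k
      using assms(2)[of k] by (cases "k < n") (auto intro: mult_right_mono)
    show "summable (\<lambda>k. real n * (cmod (c k))\<^sup>2)"
      using h_summable_imp_l2_summable[OF assms(1)] by (intro summable_mult) (simp add: l2_summable_def)
  qed (use assms(1) in \<open>simp add: h_summable_def\<close>)
  finally show ?thesis using assms(3) by (simp add: field_simps)
qed

section \<open>Weighted product estimates\<close>

lemma conv_pointwise:
  fixes v :: "nat \<Rightarrow> nat \<Rightarrow> real"
  assumes "\<And>l m. 0 < v l m" "(\<Sum>l\<le>k. 1 / v l (k - l)) \<le> C"
  shows "(cmod (conv a b k))\<^sup>2 \<le> C * (\<Sum>l\<le>k. v l (k - l) * ((cmod (a l))\<^sup>2 * (cmod (b (k - l)))\<^sup>2))"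
proof -
  let ?x = "\<lambda>l. 1 / sqrt (v l (k - l))" and ?y = "\<lambda>l. sqrt (v l (k - l)) * (cmod (a l) * cmod (b (k - l)))"
  have "cmod (conv a b k) \<le> (\<Sum>l\<le>k. cmod (a l) * cmod (b (k - l)))"
    unfolding conv_def by (rule sum_norm_le) (simp add: norm_mult)
  also have "\<dots> = (\<Sum>l\<le>k. ?x l * ?y l)"
    by (rule sum.cong[OF refl]) (use assms(1) in \<open>simp add: less_imp_neq[symmetric]\<close>)
  finally have "(cmod (conv a b k))\<^sup>2 \<le> (\<Sum>l\<le>k. ?x l * ?y l)\<^sup>2" by (intro power_mono) auto
  also have "\<dots> \<le> (\<Sum>l\<le>k. (?x l)\<^sup>2) * (\<Sum>l\<le>k. (?y l)\<^sup>2)" by (rule Cauchy_Schwarz_ineq_sum)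
  also have "(\<Sum>l\<le>k. (?x l)\<^sup>2) = (\<Sum>l\<le>k. 1 / v l (k - l))"
    using assms(1) by (simp add: power_divide less_imp_le)
  also have "(\<Sum>l\<le>k. (?y l)\<^sup>2) = (\<Sum>l\<le>k. v l (k - l) * ((cmod (a l))\<^sup>2 * (cmod (b (k - l)))\<^sup>2))"
    using assms(1) by (simp add: power_mult_distrib less_imp_le)
  finally show ?thesis
    using assms by (meson less_imp_le mult_nonneg_nonneg mult_right_mono order_trans sum_nonneg zero_le_power2)
qed

text \<open>Cauchy--Schwarz on each antidiagonal with weights \<open>w1 l * w2 (k - l)\<close>
  leaves the Cauchy product of the two weighted series. The factor lost is the dual sum of
  reciprocal weights, and \<open>C\<close> bounds it uniformly in \<open>k\<close> after
  multiplication by \<open>w3 k\<close>.\<close>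

lemma conv_weighted:
  fixes w1 w2 w3 :: "nat \<Rightarrow> real"
  assumes w: "\<And>l. 0 < w1 l" "\<And>l. 0 < w2 l" "\<And>l. 0 < w3 l"
    and C: "\<And>k. w3 k * (\<Sum>l\<le>k. 1 / (w1 l * w2 (k - l))) \<le> C"
    and a: "summable (\<lambda>k. w1 k * (cmod (a k))\<^sup>2)" and b: "summable (\<lambda>k. w2 k * (cmod (b k))\<^sup>2)"
  shows "summable (\<lambda>k. w3 k * (cmod (conv a b k))\<^sup>2)"
    "(\<Sum>k. w3 k * (cmod (conv a b k))\<^sup>2) \<le> C * ((\<Sum>k. w1 k * (cmod (a k))\<^sup>2) * (\<Sum>k. w2 k * (cmod (b k))\<^sup>2))"
proof -
  let ?f = "\<lambda>k. w1 k * (cmod (a k))\<^sup>2" and ?g = "\<lambda>k. w2 k * (cmod (b k))\<^sup>2"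
  have f0: "0 \<le> ?f k" and g0: "0 \<le> ?g k" for k using w by (simp_all add: less_imp_le)
  have sums: "(\<lambda>k. \<Sum>i\<le>k. ?f i * ?g (k - i)) sums ((\<Sum>k. ?f k) * (\<Sum>k. ?g k))"
    by (rule Cauchy_product_sums) (simp_all only: real_norm_def abs_of_nonneg[OF f0] abs_of_nonneg[OF g0] a b)
  have pw: "w3 k * (cmod (conv a b k))\<^sup>2 \<le> C * (\<Sum>i\<le>k. ?f i * ?g (k - i))" for k
  proof -
    have "(\<Sum>l\<le>k. 1 / (w1 l * w2 (k - l))) \<le> C / w3 k"
      using C[of k] w(3)[of k] by (simp add: field_simps)
    then have "(cmod (conv a b k))\<^sup>2
        \<le> C / w3 k * (\<Sum>l\<le>k. (w1 l * w2 (k - l)) * ((cmod (a l))\<^sup>2 * (cmod (b (k - l)))\<^sup>2))"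
      by (intro conv_pointwise[where v = "\<lambda>l m. w1 l * w2 m"]) (simp_all add: w)
    also have "\<dots> = C / w3 k * (\<Sum>i\<le>k. ?f i * ?g (k - i))"
    proof -
      have "(\<Sum>l\<le>k. (w1 l * w2 (k - l)) * ((cmod (a l))\<^sup>2 * (cmod (b (k - l)))\<^sup>2)) = (\<Sum>i\<le>k. ?f i * ?g (k - i))"
        by (rule sum.cong[OF refl]) (simp add: mult_ac)
      then show ?thesis by simp
    qed
    finally show ?thesis using w(3)[of k] by (simp add: field_simps)
  qed
  have s: "summable (\<lambda>k. C * (\<Sum>i\<le>k. ?f i * ?g (k - i)))"
    using sums by (intro summable_mult) (auto simp: sums_iff)
  show s': "summable (\<lambda>k. w3 k * (cmod (conv a b k))\<^sup>2)"
    by (rule summable_comparison_test[OF _ s]) (use pw w(3) in \<open>auto simp: abs_mult less_imp_le\<close>)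
  have "(\<Sum>k. w3 k * (cmod (conv a b k))\<^sup>2) \<le> (\<Sum>k. C * (\<Sum>i\<le>k. ?f i * ?g (k - i)))"
    by (rule suminf_le[OF pw s' s])
  also have "\<dots> = C * ((\<Sum>k. ?f k) * (\<Sum>k. ?g k))"
    using sums by (simp add: suminf_mult sums_iff)
  finally show "(\<Sum>k. w3 k * (cmod (conv a b k))\<^sup>2) \<le> C * ((\<Sum>k. ?f k) * (\<Sum>k. ?g k))" .
qed

text \<open>The value of the zeta function at 3/2, the constant in the product estimates
  below.\<close>

definition zeta32 :: real where "zeta32 = (\<Sum>i. (1 / sqrt (real i + 1)) ^ 3)"

lemma zeta32_summable: "summable (\<lambda>i::nat. (1 / sqrt (real i + 1)) ^ 3)"
proof -
  have "summable (\<lambda>n. real (n + 1) powr (- 3 / 2))"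
    using summable_real_powr_iff[of "- 3 / 2"] summable_iff_shift[of "\<lambda>n. real n powr (- 3 / 2)" 1] by simp
  moreover have "real (n + 1) powr (- 3 / 2) = (1 / sqrt (real n + 1)) ^ 3" for n
  proof -
    have "(1 / sqrt (real n + 1)) = real (n + 1) powr (- 1 / 2)"
      by (simp add: powr_half_sqrt[symmetric] powr_minus_divide add.commute)
    then have "(1 / sqrt (real n + 1)) ^ 3 = (real (n + 1) powr (- 1 / 2)) powr 3"
      by (simp only: powr_numeral) simp
    then show ?thesis by (simp only: powr_powr) simp
  qed
  ultimately show ?thesis by (simp only:)
qed

lemma zeta32_nonneg: "0 \<le> zeta32"
  unfolding zeta32_def by (intro suminf_nonneg zeta32_summable) simp

lemma zeta32_partial: "(\<Sum>i\<le>k. (1 / sqrt (real i + 1)) ^ 3) \<le> zeta32"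
  unfolding zeta32_def by (intro sum_le_suminf zeta32_summable) auto

lemma young_cube:
  fixes p q :: real
  assumes "0 \<le> p" "0 \<le> q"
  shows "p * q\<^sup>2 + p\<^sup>2 * q \<le> p ^ 3 + q ^ 3"
proof -
  have "0 \<le> (p - q)\<^sup>2 * (p + q)" using assms by simp
  then show ?thesis by (simp add: power2_eq_square power3_eq_cube algebra_simps)
qed

text \<open>By \<open>young_cube\<close> the mixed products are dominated by pure cubes, and these
  sum to at most zeta(3/2) both in \<open>l\<close> and in \<open>k - l\<close>. What matters is
  that the bound does not depend on \<open>k\<close>.\<close>

lemma young_cube_sum:
  "(\<Sum>l\<le>k. (1 / sqrt (real l + 1)) * (1 / sqrt (real (k - l) + 1))\<^sup>2
      + (1 / sqrt (real l + 1))\<^sup>2 * (1 / sqrt (real (k - l) + 1))) \<le> 2 * zeta32"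
proof -
  have "(\<Sum>l\<le>k. (1 / sqrt (real l + 1)) * (1 / sqrt (real (k - l) + 1))\<^sup>2
      + (1 / sqrt (real l + 1))\<^sup>2 * (1 / sqrt (real (k - l) + 1)))
    \<le> (\<Sum>l\<le>k. (1 / sqrt (real l + 1)) ^ 3 + (1 / sqrt (real (k - l) + 1)) ^ 3)"
    by (intro sum_mono young_cube) simp_all
  also have "\<dots> = (\<Sum>l\<le>k. (1 / sqrt (real l + 1)) ^ 3) + (\<Sum>l\<le>k. (1 / sqrt (real (k - l) + 1)) ^ 3)"
    by (rule sum.distrib)
  also have "(\<Sum>l\<le>k. (1 / sqrt (real (k - l) + 1)) ^ 3) = (\<Sum>l\<le>k. (1 / sqrt (real l + 1)) ^ 3)"
    using sum.nat_diff_reindex[of "\<lambda>l. (1 / sqrt (real l + 1)) ^ 3" "Suc k"]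
    by (simp only: lessThan_Suc_atMost diff_Suc_Suc)
  finally show ?thesis using zeta32_partial[of k] by linarith
qed

text \<open>A product of two elements of H^(1/2) keeps a quarter of a derivative, expressed by the
  weight \<open>sqrt (real k + 1)\<close>. This surplus pays for a third factor in
  \<open>conv3_l2\<close>. Subadditivity of the square root distributes the weight over the two
  factors and produces the mixed terms of \<open>young_cube_sum\<close>.\<close>

lemma conv_bound_half:
  assumes "h_summable a" "h_summable b"
  shows "summable (\<lambda>k. sqrt (real k + 1) * (cmod (conv a b k))\<^sup>2)"
    "(\<Sum>k. sqrt (real k + 1) * (cmod (conv a b k))\<^sup>2) \<le> 2 * zeta32 * (hsum a * hsum b)"
proof -
  have C: "sqrt (real k + 1) * (\<Sum>l\<le>k. 1 / ((real l + 1) * (real (k - l) + 1))) \<le> 2 * zeta32" for k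
  proof -
    have "sqrt (real k + 1) * (1 / ((real l + 1) * (real (k - l) + 1)))
        \<le> (1 / sqrt (real l + 1)) * (1 / sqrt (real (k - l) + 1))\<^sup>2
          + (1 / sqrt (real l + 1))\<^sup>2 * (1 / sqrt (real (k - l) + 1))" if "l \<le> k" for l
    proof -
      have "sqrt (real k + 1) \<le> sqrt ((real l + 1) + (real (k - l) + 1))"
        using that by (intro real_sqrt_le_mono) (simp add: of_nat_diff)
      also have "\<dots> \<le> sqrt (real l + 1) + sqrt (real (k - l) + 1)"
        by (rule sqrt_add_le_add_sqrt) auto
      finally have "sqrt (real k + 1) * (1 / ((real l + 1) * (real (k - l) + 1)))
          \<le> (sqrt (real l + 1) + sqrt (real (k - l) + 1)) * (1 / ((real l + 1) * (real (k - l) + 1)))"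
        by (intro mult_right_mono) auto
      also have "\<dots> = (1 / sqrt (real l + 1)) * (1 / sqrt (real (k - l) + 1))\<^sup>2
          + (1 / sqrt (real l + 1))\<^sup>2 * (1 / sqrt (real (k - l) + 1))"
      proof -
        have id: "(x + y) * (1 / (x\<^sup>2 * y\<^sup>2)) = (1 / x) * (1 / y)\<^sup>2 + (1 / x)\<^sup>2 * (1 / y)"
          if "0 < x" "0 < y" for x y :: real
          using that by (simp add: field_simps power2_eq_square)
        show ?thesis using id[of "sqrt (real l + 1)" "sqrt (real (k - l) + 1)"] by simp
      qed
      finally show ?thesis .
    qed
    then have "sqrt (real k + 1) * (\<Sum>l\<le>k. 1 / ((real l + 1) * (real (k - l) + 1)))
      \<le> (\<Sum>l\<le>k. (1 / sqrt (real l + 1)) * (1 / sqrt (real (k - l) + 1))\<^sup>2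
          + (1 / sqrt (real l + 1))\<^sup>2 * (1 / sqrt (real (k - l) + 1)))"
      unfolding sum_distrib_left by (intro sum_mono) simp
    then show ?thesis using young_cube_sum[of k] by linarith
  qed
  note r = conv_weighted[where ?w1.0 = "\<lambda>k. real k + 1" and ?w2.0 = "\<lambda>k. real k + 1"
      and ?w3.0 = "\<lambda>k. sqrt (real k + 1)" and a = a and b = b, OF _ _ _ C]
  show "summable (\<lambda>k. sqrt (real k + 1) * (cmod (conv a b k))\<^sup>2)"
    by (rule r(1)) (use assms in \<open>auto simp: h_summable_def\<close>)
  show "(\<Sum>k. sqrt (real k + 1) * (cmod (conv a b k))\<^sup>2) \<le> 2 * zeta32 * (hsum a * hsum b)"
    unfolding hsum_def by (rule r(2)) (use assms in \<open>auto simp: h_summable_def\<close>)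
qed

lemma conv_l2:
  assumes "h_summable a" "h_summable b"
  shows "l2_summable (conv a b)" "mass (conv a b) \<le> 2 * zeta32 * (hsum a * hsum b)"
proof -
  have le: "(cmod (conv a b k))\<^sup>2 \<le> sqrt (real k + 1) * (cmod (conv a b k))\<^sup>2" for k
    using mult_right_mono[of 1 "sqrt (real k + 1)" "(cmod (conv a b k))\<^sup>2"] by simp
  show s: "l2_summable (conv a b)"
    unfolding l2_summable_def
    by (rule summable_comparison_test[OF _ conv_bound_half(1)[OF assms]]) (use le in auto)
  have "mass (conv a b) \<le> (\<Sum>k. sqrt (real k + 1) * (cmod (conv a b k))\<^sup>2)"
    unfolding mass_def
    by (rule suminf_le[OF le _ conv_bound_half(1)[OF assms]]) (use s in \<open>simp add: l2_summable_def\<close>)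
  then show "mass (conv a b) \<le> 2 * zeta32 * (hsum a * hsum b)"
    using conv_bound_half(2)[OF assms] by linarith
qed

text \<open>The embedding of H^(1/2) into L6 on the level of coefficients: cubes have square
  summable coefficients. The dual sum is the first of the two mixed terms in
  \<open>young_cube_sum\<close>.\<close>

lemma conv3_l2:
  assumes "h_summable a" "h_summable b" "h_summable c"
  shows "l2_summable (conv (conv a b) c)"
    "mass (conv (conv a b) c) \<le> (2 * zeta32)\<^sup>2 * (hsum a * hsum b * hsum c)"
proof -
  have C: "1 * (\<Sum>l\<le>k. 1 / (sqrt (real l + 1) * (real (k - l) + 1))) \<le> 2 * zeta32" for k
  proof -
    have "(\<Sum>l\<le>k. 1 / (sqrt (real l + 1) * (real (k - l) + 1)))
      \<le> (\<Sum>l\<le>k. (1 / sqrt (real l + 1)) * (1 / sqrt (real (k - l) + 1))\<^sup>2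
          + (1 / sqrt (real l + 1))\<^sup>2 * (1 / sqrt (real (k - l) + 1)))"
      by (intro sum_mono) (simp add: power_divide)
    then show ?thesis using young_cube_sum[of k] by linarith
  qed
  note r = conv_weighted[where ?w1.0 = "\<lambda>k. sqrt (real k + 1)" and ?w2.0 = "\<lambda>k. real k + 1"
      and ?w3.0 = "\<lambda>k. 1" and a = "conv a b" and b = c, OF _ _ _ C]
  have "summable (\<lambda>k. 1 * (cmod (conv (conv a b) c k))\<^sup>2)"
    by (rule r(1)) (use assms conv_bound_half(1) in \<open>auto simp: h_summable_def\<close>)
  then show "l2_summable (conv (conv a b) c)" by (simp add: l2_summable_def)
  have "(\<Sum>k. 1 * (cmod (conv (conv a b) c k))\<^sup>2)
      \<le> 2 * zeta32 * ((\<Sum>k. sqrt (real k + 1) * (cmod (conv a b k))\<^sup>2) * (\<Sum>k. (real k + 1) * (cmod (c k))\<^sup>2))"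
    by (rule r(2)) (use assms conv_bound_half(1) in \<open>auto simp: h_summable_def\<close>)
  also have "\<dots> \<le> 2 * zeta32 * ((2 * zeta32 * (hsum a * hsum b)) * hsum c)"
    unfolding hsum_def[symmetric]
    by (intro mult_left_mono mult_right_mono conv_bound_half(2) hsum_nonneg assms)
      (simp add: zeta32_nonneg)
  finally show "mass (conv (conv a b) c) \<le> (2 * zeta32)\<^sup>2 * (hsum a * hsum b * hsum c)"
    unfolding mass_def by (simp add: power2_eq_square mult_ac)
qed

text \<open>On Fourier coefficients, \<open>mass (conv c c)\<close> is the fourth power of the \<open>L\<^sup>4\<close> norm and
  \<open>momentum c\<close> is \<open>(Du, u)\<close>.\<close>

definition momentum :: "(nat \<Rightarrow> complex) \<Rightarrow> real" where
  "momentum c = (\<Sum>k. real k * (cmod (c k))\<^sup>2)"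

definition deficit :: "(nat \<Rightarrow> complex) \<Rightarrow> real" where
  "deficit c = (mass c)\<^sup>2 + 2 * momentum c * mass c - mass (conv c c)"

section \<open>The deficit as a sum of squares\<close>

lemma momentum_summable: "h_summable c \<Longrightarrow> summable (\<lambda>k. real k * (cmod (c k))\<^sup>2)"
  unfolding h_summable_def by (erule summable_comparison_test[rotated]) (auto simp: algebra_simps)

lemma hsum_eq_momentum_mass: "h_summable c \<Longrightarrow> hsum c = momentum c + mass c"
  using momentum_summable[of c] h_summable_imp_l2_summable[of c]
  unfolding hsum_def momentum_def mass_def l2_summable_def
  by (simp add: suminf_add distrib_right)

text \<open>Lagrange's identity for the Cauchy--Schwarz inequality against the constant vector of
  length \<open>k + 1\<close>.\<close>

lemma sum_pairs_square_diff:
  fixes x :: "nat \<Rightarrow> complex"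
  shows "(\<Sum>l\<le>k. \<Sum>m\<le>k. (cmod (x l - x m))\<^sup>2)
    = 2 * ((real k + 1) * (\<Sum>l\<le>k. (cmod (x l))\<^sup>2) - (cmod (\<Sum>l\<le>k. x l))\<^sup>2)"
proof -
  have eq: "(cmod (a - b))\<^sup>2 = (cmod a)\<^sup>2 + (cmod b)\<^sup>2 - 2 * Re (a * cnj b)" for a b
    by (simp only: cmod_power2) (simp add: power2_eq_square algebra_simps)
  have "(\<Sum>l\<le>k. \<Sum>m\<le>k. Re (x l * cnj (x m))) = Re ((\<Sum>l\<le>k. x l) * cnj (\<Sum>m\<le>k. x m))"
    by (simp add: sum_product del: times_complex.sel)
  also have "\<dots> = (cmod (\<Sum>l\<le>k. x l))\<^sup>2"
    by (simp only: complex_norm_square[symmetric] Re_complex_of_real)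
  finally have 1: "(\<Sum>l\<le>k. \<Sum>m\<le>k. Re (x l * cnj (x m))) = (cmod (\<Sum>l\<le>k. x l))\<^sup>2" .
  show ?thesis
    unfolding eq sum_subtractf sum.distrib sum_distrib_left[symmetric] 1
    by (simp add: sum_distrib_left[symmetric] sum.distrib algebra_simps)
qed

text \<open>From Lagrange's identity only the pairs containing the index 0 are kept. There one of
  the two products is \<open>c 0 * c k\<close>, and each difference occurs twice, which cancels the
  factor 2.\<close>

lemma conv_square_deficit:
  "(real k + 1) * (\<Sum>l\<le>k. (cmod (c l * c (k - l)))\<^sup>2) - (cmod (conv c c k))\<^sup>2
    \<ge> (\<Sum>l\<le>k. (cmod (c l * c (k - l) - c 0 * c k))\<^sup>2)"
proof -
  let ?x = "\<lambda>l. c l * c (k - l)"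
  let ?d = "\<lambda>l m. (cmod (?x l - ?x m))\<^sup>2"
  have "2 * (\<Sum>l\<le>k. ?d l 0) \<le> (\<Sum>l\<le>k. \<Sum>m\<le>k. ?d l m)"
  proof -
    \<comment> \<open>Row 0 contributes all its entries and every other row its entry in column 0.
      The entry counted twice lies on the diagonal and vanishes.\<close>
    have "(\<Sum>l\<le>k. ?d l 0) + (\<Sum>m\<le>k. ?d 0 m) = (\<Sum>l\<le>k. ?d l 0 + (if l = 0 then \<Sum>m\<le>k. ?d 0 m else 0))"
      by (simp add: sum.distrib)
    also have "\<dots> \<le> (\<Sum>l\<le>k. \<Sum>m\<le>k. ?d l m)"
    proof (rule sum_mono)
      fix l assume "l \<in> {..k}"
      have "?d l 0 \<le> (\<Sum>m\<le>k. ?d l m)" by (rule member_le_sum) auto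
      then show "?d l 0 + (if l = 0 then \<Sum>m\<le>k. ?d 0 m else 0) \<le> (\<Sum>m\<le>k. ?d l m)"
        by simp
    qed
    also have "(\<Sum>m\<le>k. ?d 0 m) = (\<Sum>l\<le>k. ?d l 0)" by (simp add: norm_minus_commute)
    finally show ?thesis by simp
  qed
  then show ?thesis unfolding sum_pairs_square_diff conv_def by simp
qed

text \<open>The weight splits as \<open>k + 1 = l + (k - l) + 1\<close>, which turns the series into
  three Cauchy products.\<close>

lemma weighted_square_sums:
  assumes "h_summable a" "h_summable b"
  shows "(\<lambda>k. (real k + 1) * (\<Sum>l\<le>k. (cmod (a l * b (k - l)))\<^sup>2))
    sums (momentum a * mass b + mass a * momentum b + mass a * mass b)"
proof -
  let ?m = "\<lambda>c k. real k * (cmod (c k))\<^sup>2" and ?q = "\<lambda>c k. (cmod (c k))\<^sup>2"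
  have s: "summable (\<lambda>k. norm (?m c k))" "summable (\<lambda>k. norm (?q c k))" if "h_summable c" for c
    using momentum_summable[OF that] h_summable_imp_l2_summable[OF that] by (simp_all add: l2_summable_def)
  have "(\<lambda>k. (\<Sum>l\<le>k. ?m a l * ?q b (k - l)) + (\<Sum>l\<le>k. ?q a l * ?m b (k - l)) + (\<Sum>l\<le>k. ?q a l * ?q b (k - l)))
    sums (momentum a * mass b + mass a * momentum b + mass a * mass b)"
    unfolding momentum_def mass_def
    by (intro sums_add Cauchy_product_sums s assms)
  moreover have "(\<Sum>l\<le>k. ?m a l * ?q b (k - l)) + (\<Sum>l\<le>k. ?q a l * ?m b (k - l)) + (\<Sum>l\<le>k. ?q a l * ?q b (k - l))
    = (real k + 1) * (\<Sum>l\<le>k. (cmod (a l * b (k - l)))\<^sup>2)" for k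
    unfolding sum.distrib[symmetric] sum_distrib_left
    by (rule sum.cong[OF refl]) (simp add: norm_mult power_mult_distrib of_nat_diff algebra_simps)
  ultimately show ?thesis by simp
qed

lemma deficit_sums:
  assumes "h_summable c"
  shows "(\<lambda>k. (real k + 1) * (\<Sum>l\<le>k. (cmod (c l * c (k - l)))\<^sup>2) - (cmod (conv c c k))\<^sup>2) sums deficit c"
proof -
  have "(\<lambda>k. (real k + 1) * (\<Sum>l\<le>k. (cmod (c l * c (k - l)))\<^sup>2) - (cmod (conv c c k))\<^sup>2)
    sums (momentum c * mass c + mass c * momentum c + mass c * mass c - mass (conv c c))"
    using conv_l2(1)[OF assms assms] unfolding l2_summable_def mass_def[of "conv c c"]
    by (intro sums_diff weighted_square_sums assms summable_sums)
  then show ?thesis by (simp add: deficit_def power2_eq_square algebra_simps)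
qed

lemma deficit_bound:
  assumes "h_summable c"
  shows "(\<Sum>k<n. \<Sum>l\<le>k. (cmod (c l * c (k - l) - c 0 * c k))\<^sup>2) \<le> deficit c"
proof -
  let ?g = "\<lambda>k. (real k + 1) * (\<Sum>l\<le>k. (cmod (c l * c (k - l)))\<^sup>2) - (cmod (conv c c k))\<^sup>2"
  have "0 \<le> ?g k" for k
    using conv_square_deficit[of c k] sum_nonneg[of "{..k}" "\<lambda>l. (cmod (c l * c (k - l) - c 0 * c k))\<^sup>2"]
    by (meson order_trans zero_le_power2)
  then have "(\<Sum>k<n. ?g k) \<le> deficit c"
    using deficit_sums[OF assms] sum_le_suminf[of ?g "{..<n}"] by (auto simp: sums_iff)
  moreover have "(\<Sum>k<n. \<Sum>l\<le>k. (cmod (c l * c (k - l) - c 0 * c k))\<^sup>2) \<le> (\<Sum>k<n. ?g k)"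
    by (intro sum_mono conv_square_deficit)
  ultimately show ?thesis by linarith
qed

text \<open>A Gagliardo--Nirenberg inequality for the L4 norm, read off from the sign of the
  deficit. The factor \<open>mass c\<close> is what makes high frequency tails small in L4.\<close>

lemma mass_conv_le:
  assumes "h_summable c"
  shows "mass (conv c c) \<le> 2 * mass c * hsum c"
proof -
  have "0 \<le> deficit c" using deficit_bound[OF assms, of 0] by simp
  then have "mass (conv c c) \<le> mass c * mass c + 2 * momentum c * mass c"
    by (simp add: deficit_def power2_eq_square)
  also have "\<dots> \<le> 2 * mass c * hsum c"
    using mass_nonneg[OF h_summable_imp_l2_summable[OF assms]]
    by (simp add: hsum_eq_momentum_mass[OF assms] algebra_simps)
  finally show ?thesis .
qed

section \<open>The space \<open>plus_part H_half\<close> and its embeddings\<close>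

definition coef :: "(complex \<Rightarrow> complex) \<Rightarrow> nat \<Rightarrow> complex" where
  "coef u k = fourier u (int k)"

lemma plus_part_H_half_iff: "u \<in> plus_part H_half \<longleftrightarrow> u \<in> plus_part L2 \<and> h_summable (coef u)"
proof -
  have "(\<lambda>k::int. (\<bar>real_of_int k\<bar> + 1) * (cmod (fourier u k))\<^sup>2) summable_on UNIV \<longleftrightarrow> h_summable (coef u)"
    if u: "u \<in> plus_part L2"
  proof -
    let ?f = "\<lambda>k::int. (\<bar>real_of_int k\<bar> + 1) * (cmod (fourier u k))\<^sup>2"
    have "?f summable_on UNIV \<longleftrightarrow> ?f summable_on range int"
    proof (rule summable_on_cong_neutral)
      fix k :: int assume "k \<in> UNIV - range int"
      then have "k < 0" by (metis DiffD2 int_nat_eq linorder_not_less nat_0_le rangeI)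
      then show "?f k = 0" using u by (simp add: plus_part_L2D)
    qed auto
    also have "\<dots> \<longleftrightarrow> (?f \<circ> int) summable_on UNIV" by (rule summable_on_reindex) simp
    also have "\<dots> \<longleftrightarrow> summable (?f \<circ> int)" by (rule summable_on_UNIV_nonneg_real_iff) simp
    also have "\<dots> \<longleftrightarrow> h_summable (coef u)" by (simp add: h_summable_def coef_def o_def)
    finally show ?thesis .
  qed
  then show ?thesis by (auto simp: plus_part_def H_half_def)
qed

lemma plus_part_H_halfD:
  assumes "u \<in> plus_part H_half"
  shows "u \<in> plus_part L2" "h_summable (coef u)" "u \<in> L2"
  using assms by (auto simp: plus_part_H_half_iff dest: plus_part_L2D(1))

lemma H_half_norm_hsum: "H_half_norm u = sqrt (hsum (coef u))"
  by (simp add: H_half_norm_def hsum_def coef_def)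

lemma coef_diff: "u \<in> L2 \<Longrightarrow> v \<in> L2 \<Longrightarrow> coef (\<lambda>z. u z - v z) = (\<lambda>k. coef u k - coef v k)"
  by (simp add: coef_def fun_eq_iff fourier_diff)

lemma plus_part_L2_diff: "u \<in> plus_part L2 \<Longrightarrow> v \<in> plus_part L2 \<Longrightarrow> (\<lambda>z. u z - v z) \<in> plus_part L2"
  by (simp add: plus_part_def L2_diff fourier_diff)

lemma plus_part_H_half_diff:
  "u \<in> plus_part H_half \<Longrightarrow> v \<in> plus_part H_half \<Longrightarrow> (\<lambda>z. u z - v z) \<in> plus_part H_half"
  unfolding plus_part_H_half_iff
  by (auto simp: coef_diff[OF plus_part_L2D(1) plus_part_L2D(1)] plus_part_L2_diff h_summable_diff)

lemma L2_norm_mass: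
  assumes "u \<in> plus_part L2"
  shows "l2_summable (coef u)" "(L2_norm u)\<^sup>2 = mass (coef u)"
  using Parseval[OF assms] by (simp_all add: l2_summable_def mass_def coef_def sums_iff)

lemma coef_psum: "coef (psum c n) = (\<lambda>k. if k < n then c k else 0)"
  by (auto simp: coef_def fourier_psum fun_eq_iff)

lemma h_summable_finite: "(\<And>k. n \<le> k \<Longrightarrow> c k = 0) \<Longrightarrow> h_summable c"
  unfolding h_summable_def by (rule summable_finite[of "{..<n}"]) auto

lemma psum_H_half: "psum c n \<in> plus_part H_half"
  by (simp add: plus_part_H_half_iff psum_plus_part coef_psum h_summable_finite[of n])

section \<open>Products of polynomials and the embedding into L6\<close>

lemma psum_cong: "(\<And>k. k < n \<Longrightarrow> c k = d k) \<Longrightarrow> psum c n = psum d n"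
  unfolding psum_def by (intro ext sum.cong) auto

lemma psum_mono_neutral: "n \<le> m \<Longrightarrow> (\<And>k. n \<le> k \<Longrightarrow> c k = 0) \<Longrightarrow> psum c m = psum c n"
  unfolding psum_def by (intro ext sum.mono_neutral_right) (auto simp: not_less)

lemma conv_eq_0:
  assumes a: "\<And>k. n \<le> k \<Longrightarrow> a k = 0" and b: "\<And>k. m \<le> k \<Longrightarrow> b k = 0" and k: "n + m \<le> k"
  shows "conv a b k = 0"
  unfolding conv_def
proof (rule sum.neutral, rule ballI)
  fix l assume "l \<in> {..k}"
  show "a l * b (k - l) = 0"
  proof (cases "n \<le> l")
    case False
    then have "m \<le> k - l" using k by linarith
    then show ?thesis by (simp add: b)
  qed (simp add: a)
qed

lemma psum_mult:
  assumes a: "\<And>k. n \<le> k \<Longrightarrow> a k = 0" and b: "\<And>k. m \<le> k \<Longrightarrow> b k = 0"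
  shows "psum a n z * psum b m z = psum (conv a b) (n + m) z"
proof -
  have "psum a n z * psum b m z = psum a (Suc n) z * psum b (Suc m) z"
    using psum_mono_neutral[of n "Suc n" a] psum_mono_neutral[of m "Suc m" b] a b by simp
  also have "\<dots> = psum (conv a b) (Suc (n + m)) z"
    unfolding psum_def lessThan_Suc_atMost conv_def
    by (rule polynomial_product) (use a b in auto)
  also have "\<dots> = psum (conv a b) (n + m) z"
    using conv_eq_0[of n a m b "n + m"] a b by (simp add: psum_def)
  finally show ?thesis .
qed

lemma mass_finite: "(\<And>k. n \<le> k \<Longrightarrow> c k = 0) \<Longrightarrow> mass c = (\<Sum>k<n. (cmod (c k))\<^sup>2)"
  unfolding mass_def by (rule suminf_finite) auto

text \<open>By Parseval the integral is the mass of the coefficients of the cubed polynomial, which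
  form a triple convolution.\<close>

lemma psum_L6:
  assumes c: "\<And>k. n \<le> k \<Longrightarrow> c k = 0"
  shows "(LINT z|circle. cmod (psum c n z) ^ 6) \<le> (2 * zeta32)\<^sup>2 * hsum c ^ 3"
proof -
  note c2 = conv_eq_0[where a = c and b = c, OF c c]
  have cube: "cmod (psum c n z) ^ 6 = (cmod (psum (conv (conv c c) c) (n + n + n) z))\<^sup>2" for z
  proof -
    have "psum (conv (conv c c) c) (n + n + n) z = psum c n z * psum c n z * psum c n z"
      using psum_mult[where a = c and b = c and z = z, OF c c]
        psum_mult[where a = "conv c c" and b = c and z = z, OF c2 c] by simp
    then show ?thesis by (simp add: norm_mult eval_nat_numeral)
  qed
  have "(LINT z|circle. cmod (psum c n z) ^ 6) = (L2_norm (psum (conv (conv c c) c) (n + n + n)))\<^sup>2"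
    unfolding cube L2_norm_square ..
  also have "\<dots> = mass (conv (conv c c) c)"
    unfolding L2_norm_psum
    by (rule mass_finite[symmetric]) (rule conv_eq_0[where a = "conv c c" and b = c, OF c2 c])
  also have "\<dots> \<le> (2 * zeta32)\<^sup>2 * (hsum c * hsum c * hsum c)"
    using h_summable_finite[OF c] by (intro conv3_l2)
  finally show ?thesis by (simp add: power3_eq_cube)
qed

lemma hsum_truncate_le: "h_summable c \<Longrightarrow> hsum (\<lambda>k. if k < n then c k else 0) \<le> hsum c"
  using h_summable_finite[of n "\<lambda>k. if k < n then c k else 0"]
  unfolding hsum_def h_summable_def by (intro suminf_le) auto

text \<open>Partial sums converge in L2, hence in L1 and almost everywhere along a subsequence;
  Fatou's lemma then transfers the bound for polynomials, which is uniform because truncation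
  decreases \<open>hsum\<close>.\<close>

lemma H_half_L6:
  assumes u: "u \<in> plus_part H_half"
  shows "integrable circle (\<lambda>z. cmod (u z) ^ 6)"
    "(LINT z|circle. cmod (u z) ^ 6) \<le> (2 * zeta32)\<^sup>2 * hsum (coef u) ^ 3"
proof -
  note uL = plus_part_H_halfD[OF u]
  let ?s = "psum (coef u)"
  have lim: "(\<lambda>n. LINT z|circle. cmod (u z - ?s n z)) \<longlonglongrightarrow> 0"
  proof (rule tendsto_sandwich[OF _ _ tendsto_const])
    show "(\<lambda>n. L2_norm (\<lambda>z. u z - ?s n z)) \<longlonglongrightarrow> 0"
      using plus_part_approx[OF uL(1)] by (simp add: coef_def[abs_def])
    show "\<forall>\<^sub>F n in sequentially. (LINT z|circle. cmod (u z - ?s n z)) \<le> L2_norm (\<lambda>z. u z - ?s n z)"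
      by (intro always_eventually allI integral_norm_le_L2_norm L2_diff uL L2_psum)
  qed simp
  have "\<exists>r. strict_mono r \<and> (AE z in circle. (\<lambda>n. u z - ?s (r n) z) \<longlonglongrightarrow> 0)"
    by (rule tendsto_L1_AE_subseq[OF _ lim]) (intro L2_integrable L2_diff uL L2_psum)
  then obtain r where r: "AE z in circle. (\<lambda>n. u z - ?s (r n) z) \<longlonglongrightarrow> 0" by blast
  have lim6: "AE z in circle. (\<lambda>n. cmod (?s (r n) z) ^ 6) \<longlonglongrightarrow> cmod (u z) ^ 6"
    using r
  proof eventually_elim
    case (elim z)
    from tendsto_diff[OF tendsto_const[of "u z"] this] have "(\<lambda>n. ?s (r n) z) \<longlonglongrightarrow> u z" by simp
    then show ?case by (intro tendsto_intros)
  qed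
  have int: "integrable circle (\<lambda>z. cmod (?s (r n) z) ^ 6)" for n
    by (intro continuous_circle_integrable continuous_intros)
  have bound: "(LINT z|circle. cmod (?s (r n) z) ^ 6) \<le> (2 * zeta32)\<^sup>2 * hsum (coef u) ^ 3" for n
  proof -
    let ?c = "\<lambda>k. if k < r n then coef u k else 0"
    have "(LINT z|circle. cmod (?s (r n) z) ^ 6) = (LINT z|circle. cmod (psum ?c (r n) z) ^ 6)"
      using psum_cong[of "r n" "coef u" ?c] by simp
    also have "\<dots> \<le> (2 * zeta32)\<^sup>2 * hsum ?c ^ 3" by (rule psum_L6) simp
    also have "\<dots> \<le> (2 * zeta32)\<^sup>2 * hsum (coef u) ^ 3"
      by (intro mult_left_mono power_mono hsum_truncate_le uL hsum_nonneg h_summable_finite[of "r n"]) auto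
    finally show ?thesis .
  qed
  have m: "(\<lambda>z. cmod (u z) ^ 6) \<in> borel_measurable circle" using uL(3) by (auto simp: L2_def)
  show "integrable circle (\<lambda>z. cmod (u z) ^ 6)"
    by (rule integral_Fatou(1)[OF m int _ lim6 bound]) simp
  show "(LINT z|circle. cmod (u z) ^ 6) \<le> (2 * zeta32)\<^sup>2 * hsum (coef u) ^ 3"
    by (rule integral_Fatou(2)[OF m int _ lim6 bound]) simp
qed

lemma L2_of_square_bound:
  fixes f :: "complex \<Rightarrow> complex"
  assumes f: "f \<in> borel_measurable circle" and G: "integrable circle G"
    and le: "\<And>z. (cmod (f z))\<^sup>2 \<le> G z"
  shows "f \<in> L2" "(L2_norm f)\<^sup>2 \<le> (LINT z|circle. G z)"
proof -
  have [measurable]: "f \<in> borel_measurable circle" by fact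
  have "integrable circle (\<lambda>z. (cmod (f z))\<^sup>2)"
  proof (rule Bochner_Integration.integrable_bound[OF G])
    show "AE z in circle. norm ((cmod (f z))\<^sup>2) \<le> norm (G z)"
      using order_trans[OF le abs_ge_self] by simp
  qed measurable
  then show "f \<in> L2" using f by (simp add: L2_def)
  then show "(L2_norm f)\<^sup>2 \<le> (LINT z|circle. G z)"
    unfolding L2_norm_square by (intro integral_mono L2_integrable_square G le)
qed

lemma H_half_cubic_L2:
  assumes u: "u \<in> plus_part H_half"
  shows "(\<lambda>z. complex_of_real ((cmod (u z))\<^sup>2) * u z) \<in> L2"
    "(L2_norm (\<lambda>z. complex_of_real ((cmod (u z))\<^sup>2) * u z))\<^sup>2 \<le> (2 * zeta32)\<^sup>2 * hsum (coef u) ^ 3"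
proof -
  have [measurable]: "u \<in> borel_measurable circle" using plus_part_H_halfD(3)[OF u] by (simp add: L2_def)
  have m: "(\<lambda>z. complex_of_real ((cmod (u z))\<^sup>2) * u z) \<in> borel_measurable circle" by measurable
  have eq: "(cmod (complex_of_real ((cmod (u z))\<^sup>2) * u z))\<^sup>2 = cmod (u z) ^ 6" for z
    by (simp add: norm_mult norm_power eval_nat_numeral)
  show "(\<lambda>z. complex_of_real ((cmod (u z))\<^sup>2) * u z) \<in> L2"
    by (rule L2_of_square_bound(1)[OF m H_half_L6(1)[OF u]]) (simp only: eq order_refl)
  show "(L2_norm (\<lambda>z. complex_of_real ((cmod (u z))\<^sup>2) * u z))\<^sup>2 \<le> (2 * zeta32)\<^sup>2 * hsum (coef u) ^ 3"
    using H_half_L6(2)[OF u] unfolding L2_norm_square eq .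
qed

lemma power4_le: "x ^ 4 \<le> x ^ 2 + x ^ 6" for x :: real
proof -
  have "0 \<le> x\<^sup>2 * ((x\<^sup>2 - 1)\<^sup>2 + x\<^sup>2)" by simp
  then show ?thesis by (simp add: power2_eq_square eval_nat_numeral algebra_simps)
qed

lemma H_half_square_L2:
  assumes u: "u \<in> plus_part H_half"
  shows "(\<lambda>z. u z * u z) \<in> L2"
proof -
  have [measurable]: "u \<in> borel_measurable circle" using plus_part_H_halfD(3)[OF u] by (simp add: L2_def)
  have m: "(\<lambda>z. u z * u z) \<in> borel_measurable circle" by measurable
  have G: "integrable circle (\<lambda>z. cmod (u z) ^ 2 + cmod (u z) ^ 6)"
    by (intro Bochner_Integration.integrable_add H_half_L6 u L2_integrable_square plus_part_H_halfD(3))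
  have "(cmod (u z * u z))\<^sup>2 = cmod (u z) ^ 4" for z
    by (simp add: norm_mult eval_nat_numeral)
  then show ?thesis
    using power4_le by (intro L2_of_square_bound(1)[OF m G]) simp
qed

text \<open>The product is only known to be integrable, so continuity of coefficients in L2 does not
  apply to it. Instead \<open>v\<close> and the character are combined into a single
  \<open>w\<close> in L2: the coefficient is the conjugate of the inner product of \<open>w\<close>
  with \<open>u\<close>, which is continuous in \<open>u\<close>.\<close>

lemma fourier_mult:
  assumes u: "u \<in> plus_part L2" and v: "v \<in> plus_part L2"
  shows "fourier (\<lambda>z. u z * v z) k = (if k < 0 then 0 else conv (coef u) (coef v) (nat k))"
proof -
  define w where "w z = cnj (v z) * z powi k" for z
  have wL: "w \<in> L2"
  proof (rule L2_dominated[OF plus_part_L2D(1)[OF v]])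
    have "(\<lambda>z. cnj (v z)) \<in> borel_measurable circle" "(\<lambda>z. z powi k) \<in> borel_measurable circle"
      using L2_cnj[OF plus_part_L2D(1)[OF v]] L2_powi[of k] by (auto simp: L2_def)
    then show "w \<in> borel_measurable circle" unfolding w_def[abs_def] by (rule borel_measurable_times)
  qed (simp add: w_def norm_mult norm_power_int)
  have w_inner: "L2_inner w f = cnj (LINT z|circle. f z * v z * z powi (- k))" for f
  proof -
    have "L2_inner w f = (LINT z|circle. cnj (f z * v z * z powi (- k)))"
      unfolding L2_inner_def
    proof (rule Bochner_Integration.integral_cong[OF refl])
      fix z assume "z \<in> space circle"
      then have "cnj (z powi (- k)) = z powi k" using cnj_powi_sphere[of z "- k"] by simp
      then show "w z * cnj (f z) = cnj (f z * v z * z powi (- k))"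
        by (simp only: w_def complex_cnj_mult mult_ac)
    qed
    also have "\<dots> = cnj (LINT z|circle. f z * v z * z powi (- k))"
      by (rule Bochner_Integration.integral_cnj)
    finally show ?thesis .
  qed
  have lim: "(\<lambda>n. L2_inner w (psum (coef u) n)) \<longlonglongrightarrow> L2_inner w u"
    by (rule L2_inner_of_limit[OF plus_part_L2D(1)[OF u] L2_psum _ wL])
      (use plus_part_approx[OF u] in \<open>simp add: coef_def[abs_def]\<close>)
  have fw: "fourier w l = cnj (fourier v (k - l))" for l
  proof -
    have "fourier w l = cnj (LINT z|circle. z powi l * v z * z powi (- k))"
      unfolding fourier_eq_L2_inner[of w] by (rule w_inner)
    also have "(LINT z|circle. z powi l * v z * z powi (- k)) = fourier v (k - l)"
      unfolding fourier_def
    proof (rule Bochner_Integration.integral_cong[OF refl])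
      fix z assume "z \<in> space circle"
      then have "z \<noteq> 0" by auto
      then have "z powi (- (k - l)) = z powi l * z powi (- k)" by (simp flip: power_int_add)
      then show "z powi l * v z * z powi (- k) = v z * z powi (- (k - l))"
        by (simp only: mult_ac)
    qed
    finally show ?thesis .
  qed
  \<comment> \<open>Beyond \<open>n = k\<close> the pairing no longer changes, because a frequency
    of \<open>u\<close> above \<open>k\<close> would have to meet a negative frequency of
    \<open>v\<close>.\<close>
  have val: "L2_inner w (psum (coef u) n) = cnj (if k < 0 then 0 else conv (coef u) (coef v) (nat k))"
    if n: "nat k < n" for n
  proof -
    have "L2_inner w (psum (coef u) n) = cnj (L2_inner (psum (coef u) n) w)" by (rule L2_inner_commute)
    also have "L2_inner (psum (coef u) n) w = (\<Sum>l<n. coef u l * fourier v (k - int l))"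
      unfolding psum_eq_trig_sum by (subst L2_inner_trig_sum_left[OF wL]) (simp add: sum.reindex fw)
    also have "\<dots> = (if k < 0 then 0 else conv (coef u) (coef v) (nat k))"
    proof (cases "k < 0")
      case True
      then show ?thesis using plus_part_L2D(2)[OF v] by (auto intro!: sum.neutral)
    next
      case False
      have "(\<Sum>l<n. coef u l * fourier v (k - int l)) = (\<Sum>l\<le>nat k. coef u l * coef v (nat k - l))"
      proof (rule sum.mono_neutral_cong_right)
        show "\<forall>i\<in>{..<n} - {..nat k}. coef u i * fourier v (k - int i) = 0"
          using plus_part_L2D(2)[OF v] False by auto
        show "coef u x * fourier v (k - int x) = coef u x * coef v (nat k - x)" if "x \<in> {..nat k}" for x
          using that False by (simp add: coef_def of_nat_diff)
      qed (use n in auto)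
      then show ?thesis using False by (simp add: conv_def)
    qed
    finally show ?thesis .
  qed
  have "\<forall>\<^sub>F n in sequentially. L2_inner w (psum (coef u) n) = cnj (if k < 0 then 0 else conv (coef u) (coef v) (nat k))"
    unfolding eventually_sequentially using val by (intro exI[of _ "Suc (nat k)"]) simp
  then have "(\<lambda>n. L2_inner w (psum (coef u) n)) \<longlonglongrightarrow> cnj (if k < 0 then 0 else conv (coef u) (coef v) (nat k))"
    by (rule tendsto_eventually)
  then have "L2_inner w u = cnj (if k < 0 then 0 else conv (coef u) (coef v) (nat k))"
    using lim LIMSEQ_unique by blast
  then show ?thesis unfolding w_inner fourier_def by (simp only: complex_cnj_cancel_iff)
qed

definition energy :: "(complex \<Rightarrow> complex) \<Rightarrow> real" where
  "energy u = (LINT z|circle. cmod (u z) ^ 4)"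

lemma energy_eq_mass_conv:
  assumes u: "u \<in> plus_part H_half"
  shows "integrable circle (\<lambda>z. cmod (u z) ^ 4)" "energy u = mass (conv (coef u) (coef u))"
proof -
  note uL = plus_part_H_halfD(1)[OF u]
  have f: "fourier (\<lambda>z. u z * u z) k = (if k < 0 then 0 else conv (coef u) (coef u) (nat k))" for k
    by (rule fourier_mult[OF uL uL])
  have p: "(\<lambda>z. u z * u z) \<in> plus_part L2"
    using H_half_square_L2[OF u] by (simp add: plus_part_def f)
  have eq: "(cmod (u z * u z))\<^sup>2 = cmod (u z) ^ 4" for z
    by (simp add: norm_mult eval_nat_numeral)
  show "integrable circle (\<lambda>z. cmod (u z) ^ 4)"
    using L2_integrable_square[OF H_half_square_L2[OF u]] unfolding eq .
  have "energy u = (L2_norm (\<lambda>z. u z * u z))\<^sup>2" unfolding energy_def L2_norm_square eq ..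
  also have "\<dots> = mass (coef (\<lambda>z. u z * u z))" by (rule L2_norm_mass(2)[OF p])
  also have "coef (\<lambda>z. u z * u z) = conv (coef u) (coef u)"
    unfolding coef_def[of "\<lambda>z. u z * u z", abs_def] f by simp
  finally show "energy u = mass (conv (coef u) (coef u))" .
qed

section \<open>Conservation of mass and energy\<close>

text \<open>Functions represent elements of L2 modulo null sets and \<open>L2_norm\<close> is only a
  seminorm on them, so differentiability is expressed by the norm of the error of the difference
  quotient.\<close>

definition has_L2_derivative :: "(real \<Rightarrow> complex \<Rightarrow> complex) \<Rightarrow> (complex \<Rightarrow> complex) \<Rightarrow> real \<Rightarrow> bool" where
  "has_L2_derivative w w' t \<longleftrightarrow> (\<forall>s. w s \<in> L2) \<and> w' \<in> L2 \<and>
    ((\<lambda>h. L2_norm (\<lambda>z. (w (t + h) z - w t z) / of_real h - w' z)) \<longlongrightarrow> 0) (at 0)"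

lemma L2_difference_quotient:
  "(\<forall>s. w s \<in> L2) \<Longrightarrow> (\<lambda>z. (w (t + h) z - w t z) / of_real h) \<in> L2"
  using L2_cmult[OF L2_diff[of "w (t + h)" "w t"], of "1 / of_real h"] by simp

lemma has_L2_derivative_norm_square:
  assumes "has_L2_derivative w w' t"
  shows "((\<lambda>s. (L2_norm (w s))\<^sup>2) has_real_derivative 2 * Re (L2_inner w' (w t))) (at t)"
proof -
  have wL: "\<forall>s. w s \<in> L2" and w'L: "w' \<in> L2"
    and lim: "((\<lambda>h. L2_norm (\<lambda>z. (w (t + h) z - w t z) / of_real h - w' z)) \<longlongrightarrow> 0) (at 0)"
    using assms by (auto simp: has_L2_derivative_def)
  define q where "q h z = (w (t + h) z - w t z) / of_real h" for h z
  have qL: "q h \<in> L2" for h unfolding q_def[abs_def] by (rule L2_difference_quotient[OF wL])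
  define e where "e h = L2_norm (\<lambda>z. q h z - w' z)" for h
  have e: "(e \<longlongrightarrow> 0) (at 0)" using lim by (simp add: e_def[abs_def] q_def)
  have inner: "((\<lambda>h. L2_inner (q h) (w t)) \<longlongrightarrow> L2_inner w' (w t)) (at 0)"
  proof (rule LIM_zero_cancel, rule Lim_null_comparison)
    show "\<forall>\<^sub>F h in at 0. norm (L2_inner (q h) (w t) - L2_inner w' (w t)) \<le> e h * L2_norm (w t)"
      using L2_Cauchy_Schwarz[OF L2_diff[OF qL w'L]] wL w'L qL
      by (simp add: L2_inner_diff_left e_def)
    show "((\<lambda>h. e h * L2_norm (w t)) \<longlongrightarrow> 0) (at 0)"
      using tendsto_mult[OF e tendsto_const] by simp
  qed
  have small: "((\<lambda>h. h * (L2_norm (q h))\<^sup>2) \<longlongrightarrow> 0) (at 0)"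
  proof (rule Lim_null_comparison)
    show "\<forall>\<^sub>F h in at 0. norm (h * (L2_norm (q h))\<^sup>2) \<le> \<bar>h\<bar> * (e h + L2_norm w')\<^sup>2"
    proof (intro always_eventually allI)
      fix h
      have "L2_norm (q h) \<le> e h + L2_norm w'"
        using L2_triangle[OF L2_diff[OF qL[of h] w'L] w'L] by (simp add: e_def)
      then show "norm (h * (L2_norm (q h))\<^sup>2) \<le> \<bar>h\<bar> * (e h + L2_norm w')\<^sup>2"
        by (simp add: abs_mult mult_left_mono power_mono)
    qed
    have "((\<lambda>h. \<bar>h\<bar> * (e h + L2_norm w')\<^sup>2) \<longlongrightarrow> \<bar>0\<bar> * (0 + L2_norm w')\<^sup>2) (at 0)"
      by (intro tendsto_intros e)
    then show "((\<lambda>h. \<bar>h\<bar> * (e h + L2_norm w')\<^sup>2) \<longlongrightarrow> 0) (at 0)" by simp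
  qed
  have quot: "((L2_norm (w (t + h)))\<^sup>2 - (L2_norm (w t))\<^sup>2) / h
      = 2 * Re (L2_inner (q h) (w t)) + h * (L2_norm (q h))\<^sup>2" if "h \<noteq> 0" for h
  proof -
    have "w (t + h) = (\<lambda>z. w t z + of_real h * q h z)"
      using that by (simp add: q_def fun_eq_iff)
    then have "(L2_norm (w (t + h)))\<^sup>2 = (L2_norm (\<lambda>z. w t z + of_real h * q h z))\<^sup>2" by simp
    also have "\<dots> = (L2_norm (w t))\<^sup>2 + 2 * Re (L2_inner (w t) (\<lambda>z. of_real h * q h z))
        + (L2_norm (\<lambda>z. of_real h * q h z))\<^sup>2"
      by (rule L2_norm_square_add) (use wL L2_cmult[OF qL] in auto)
    also have "L2_inner (w t) (\<lambda>z. of_real h * q h z) = cnj (of_real h * L2_inner (q h) (w t))"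
      by (subst L2_inner_commute, subst L2_inner_cmult_left) simp
    also have "L2_norm (\<lambda>z. of_real h * q h z) = \<bar>h\<bar> * L2_norm (q h)"
      by (subst L2_norm_cmult) simp
    finally show ?thesis using that by (simp add: power_mult_distrib field_simps power2_eq_square)
  qed
  have "((\<lambda>h. 2 * Re (L2_inner (q h) (w t)) + h * (L2_norm (q h))\<^sup>2) \<longlongrightarrow> 2 * Re (L2_inner w' (w t)) + 0) (at 0)"
    by (intro tendsto_intros inner small)
  then have "((\<lambda>h. ((L2_norm (w (t + h)))\<^sup>2 - (L2_norm (w t))\<^sup>2) / h) \<longlongrightarrow> 2 * Re (L2_inner w' (w t))) (at 0)"
    by (subst tendsto_cong[where g = "\<lambda>h. 2 * Re (L2_inner (q h) (w t)) + h * (L2_norm (q h))\<^sup>2"])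
      (simp_all add: eventually_at_filter quot)
  then show ?thesis by (simp add: DERIV_def)
qed

lemma has_L2_derivative_diff:
  assumes "has_L2_derivative w w' t" "has_L2_derivative v v' t"
  shows "has_L2_derivative (\<lambda>s z. w s z - v s z) (\<lambda>z. w' z - v' z) t"
proof -
  have L: "\<forall>s. w s \<in> L2" "\<forall>s. v s \<in> L2" "w' \<in> L2" "v' \<in> L2"
    using assms by (auto simp: has_L2_derivative_def)
  let ?q = "\<lambda>w h z. (w (t + h) z - w t z) / of_real h :: complex"
  have "((\<lambda>h. L2_norm (\<lambda>z. (\<lambda>s z. w s z - v s z) (t + h) z / of_real h - (\<lambda>s z. w s z - v s z) t z / of_real h - (w' z - v' z))) \<longlongrightarrow> 0) (at 0)"
  proof (rule Lim_null_comparison)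
    have "L2_norm (\<lambda>z. (?q w h z - w' z) + (-1) * (?q v h z - v' z))
      \<le> L2_norm (\<lambda>z. ?q w h z - w' z) + L2_norm (\<lambda>z. (-1) * (?q v h z - v' z))" for h
      by (intro L2_triangle L2_cmult L2_diff L2_difference_quotient L)
    then have "L2_norm (\<lambda>z. (?q w h z - w' z) + (-1) * (?q v h z - v' z))
      \<le> L2_norm (\<lambda>z. ?q w h z - w' z) + L2_norm (\<lambda>z. ?q v h z - v' z)" for h
      unfolding L2_norm_cmult by simp
    moreover have "(\<lambda>z. (\<lambda>s z. w s z - v s z) (t + h) z / of_real h - (\<lambda>s z. w s z - v s z) t z / of_real h - (w' z - v' z))
       = (\<lambda>z. (?q w h z - w' z) + (-1) * (?q v h z - v' z))" for h :: real
      by (simp add: fun_eq_iff diff_divide_distrib)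
    ultimately show "\<forall>\<^sub>F h in at 0. norm (L2_norm (\<lambda>z. (\<lambda>s z. w s z - v s z) (t + h) z / of_real h - (\<lambda>s z. w s z - v s z) t z / of_real h - (w' z - v' z)))
        \<le> L2_norm (\<lambda>z. ?q w h z - w' z) + L2_norm (\<lambda>z. ?q v h z - v' z)"
      by simp
    show "((\<lambda>h. L2_norm (\<lambda>z. ?q w h z - w' z) + L2_norm (\<lambda>z. ?q v h z - v' z)) \<longlongrightarrow> 0) (at 0)"
      using assms by (intro tendsto_add_zero) (simp_all add: has_L2_derivative_def)
  qed
  then show ?thesis using L by (auto simp: has_L2_derivative_def diff_divide_distrib intro: L2_diff)
qed

section \<open>The nonlinearity along a solution\<close>

definition cubic :: "(complex \<Rightarrow> complex) \<Rightarrow> complex \<Rightarrow> complex" where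
  "cubic u z = complex_of_real ((cmod (u z))\<^sup>2) * u z"

lemma cubic_L2:
  assumes "u \<in> plus_part H_half"
  shows "cubic u \<in> L2" "(L2_norm (cubic u))\<^sup>2 \<le> (2 * zeta32)\<^sup>2 * hsum (coef u) ^ 3"
  using H_half_cubic_L2[OF assms] by (simp_all add: cubic_def[abs_def])

lemma solution_plus: "szego_solution u \<Longrightarrow> u t \<in> plus_part H_half"
  by (simp add: szego_solution_def)

lemma solution_derivative:
  assumes u: "szego_solution u"
  shows "has_L2_derivative u (\<lambda>z. - \<i> * szego_proj (cubic (u t)) z) t"
proof -
  let ?g = "szego_proj (cubic (u t))"
  have gL: "?g \<in> L2"
    using szego_proj_plus_part[OF cubic_L2(1)[OF solution_plus[OF u]]] by (rule plus_part_L2D(1))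
  have "L2_norm (\<lambda>z. \<i> * ((u (t + h) z - u t z) / of_real h) - ?g z)
    = L2_norm (\<lambda>z. (u (t + h) z - u t z) / of_real h - (- \<i> * ?g z))" for h
  proof -
    have "L2_norm (\<lambda>z. \<i> * ((u (t + h) z - u t z) / of_real h - (- \<i> * ?g z)))
        = L2_norm (\<lambda>z. (u (t + h) z - u t z) / of_real h - (- \<i> * ?g z))"
      by (subst L2_norm_cmult) simp
    then show ?thesis by (simp add: algebra_simps)
  qed
  moreover have "((\<lambda>h. L2_norm (\<lambda>z. \<i> * ((u (t + h) z - u t z) / of_real h) - ?g z)) \<longlongrightarrow> 0) (at 0)"
    using u unfolding szego_solution_def cubic_def[abs_def] by blast
  ultimately have "((\<lambda>h. L2_norm (\<lambda>z. (u (t + h) z - u t z) / of_real h - (- \<i> * ?g z))) \<longlongrightarrow> 0) (at 0)"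
    by (simp only:)
  then show ?thesis
    unfolding has_L2_derivative_def
    using plus_part_H_halfD(3)[OF solution_plus[OF u]] L2_cmult[OF gL, of "- \<i>"] by blast
qed

lemma cubic_inner_self:
  assumes "u \<in> plus_part H_half"
  shows "L2_inner (cubic u) u = of_real (energy u)"
proof -
  have "cubic u z * cnj (u z) = of_real (cmod (u z) ^ 4)" for z
    by (simp add: cubic_def mult.assoc complex_norm_square[symmetric] flip: of_real_mult of_real_power)
  then show ?thesis unfolding L2_inner_def energy_def by (simp only: integral_complex_of_real)
qed

text \<open>Pairing the equation with \<open>u t\<close> removes the projector and leaves
  \<open>- \<i>\<close> times the energy, a real number, so the real part vanishes.\<close>

lemma solution_mass_const:
  assumes u: "szego_solution u"
  shows "mass (coef (u s)) = mass (coef (u t))"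
proof -
  have "((\<lambda>s. (L2_norm (u s))\<^sup>2) has_real_derivative 0) (at t)" for t
  proof -
    note H = solution_plus[OF u, of t]
    have "L2_inner (\<lambda>z. - \<i> * szego_proj (cubic (u t)) z) (u t) = - \<i> * of_real (energy (u t))"
      unfolding L2_inner_cmult_left
        szego_proj_inner[OF cubic_L2(1)[OF H] plus_part_H_halfD(1)[OF H]] cubic_inner_self[OF H] ..
    then show ?thesis
      using has_L2_derivative_norm_square[OF solution_derivative[OF u, of t]] by simp
  qed
  then have "(L2_norm (u s))\<^sup>2 = (L2_norm (u t))\<^sup>2"
    using DERIV_isconst_all[of "\<lambda>s. (L2_norm (u s))\<^sup>2"] by blast
  then show ?thesis
    using L2_norm_mass(2)[OF plus_part_H_halfD(1)[OF solution_plus[OF u]]] by simp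
qed

lemma young_2_4:
  fixes x y e :: real
  assumes "0 \<le> x" "0 \<le> y" "0 < e"
  shows "x\<^sup>2 * y ^ 4 \<le> e * y ^ 6 + x ^ 6 / e\<^sup>2"
proof (cases "x\<^sup>2 \<le> e * y\<^sup>2")
  case True
  then have "x\<^sup>2 * y ^ 4 \<le> (e * y\<^sup>2) * y ^ 4" by (intro mult_right_mono) auto
  also have "\<dots> = e * y ^ 6" by (simp add: eval_nat_numeral)
  finally show ?thesis using assms by (simp add: add_increasing2)
next
  case False
  then have "y\<^sup>2 \<le> x\<^sup>2 / e" using assms by (simp add: field_simps)
  then have "(y\<^sup>2)\<^sup>2 \<le> (x\<^sup>2 / e)\<^sup>2" by (intro power_mono) auto
  then have "x\<^sup>2 * (y\<^sup>2)\<^sup>2 \<le> x\<^sup>2 * (x\<^sup>2 / e)\<^sup>2" by (intro mult_left_mono) auto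
  also have "x\<^sup>2 * (x\<^sup>2 / e)\<^sup>2 = x ^ 6 / e\<^sup>2" by (simp add: power_divide eval_nat_numeral)
  also have "x\<^sup>2 * (y\<^sup>2)\<^sup>2 = x\<^sup>2 * y ^ 4" by (simp add: eval_nat_numeral)
  finally show ?thesis using assms by (simp add: add_increasing)
qed

text \<open>\<open>G\<close> plays the part of a gradient between two points:
  \<open>cmod a ^ 4 - cmod b ^ 4 = Re ((a - b) * cnj G)\<close>, and for \<open>a = b\<close> it
  equals four times the cubic term. The parameter \<open>e\<close> separates the two variables, so
  that only sixth powers have to be integrated; it is later tied to the size of the
  increment.\<close>

lemma cubic_polarized_bound:
  fixes a b :: complex
  defines "G \<equiv> (a + b) * of_real ((cmod a)\<^sup>2 + (cmod b)\<^sup>2)"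
  assumes e: "0 < e"
  shows "(cmod (G - 4 * (of_real ((cmod b)\<^sup>2) * b)))\<^sup>2
    \<le> 729 * (e * cmod b ^ 6 + (1 / e\<^sup>2 + 1) * cmod (a - b) ^ 6)"
proof -
  define d y where "d = cmod (a - b)" and "y = cmod b"
  have d0: "0 \<le> d" "0 \<le> y" by (simp_all add: d_def y_def)
  have a: "cmod a \<le> y + d" unfolding d_def y_def using norm_triangle_sub[of a b] by simp
  have diff: "\<bar>(cmod a)\<^sup>2 - y\<^sup>2\<bar> \<le> d * (2 * y + d)"
  proof -
    have "\<bar>(cmod a)\<^sup>2 - y\<^sup>2\<bar> = \<bar>cmod a - y\<bar> * (cmod a + y)"
    proof -
      have "(cmod a)\<^sup>2 - y\<^sup>2 = (cmod a - y) * (cmod a + y)"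
        by (simp add: power2_eq_square algebra_simps)
      then show ?thesis using d0 by (simp add: abs_mult)
    qed
    also have "\<dots> \<le> d * (2 * y + d)"
      using a d0 norm_triangle_ineq3[of a b] by (intro mult_mono) (auto simp: d_def y_def)
    finally show ?thesis .
  qed
  have "G - 4 * (of_real (y\<^sup>2) * b)
      = (a - b) * of_real ((cmod a)\<^sup>2 + y\<^sup>2) + 2 * b * of_real ((cmod a)\<^sup>2 - y\<^sup>2)"
    by (simp add: G_def y_def algebra_simps)
  then have "cmod (G - 4 * (of_real (y\<^sup>2) * b))
      \<le> cmod ((a - b) * of_real ((cmod a)\<^sup>2 + y\<^sup>2)) + cmod (2 * b * of_real ((cmod a)\<^sup>2 - y\<^sup>2))"
    by (simp only: norm_triangle_ineq)
  also have "\<dots> = d * ((cmod a)\<^sup>2 + y\<^sup>2) + 2 * y * \<bar>(cmod a)\<^sup>2 - y\<^sup>2\<bar>"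
    by (simp only: norm_mult norm_of_real d_def y_def norm_numeral) simp
  also have "\<dots> \<le> d * ((y + d)\<^sup>2 + y\<^sup>2) + 2 * y * (d * (2 * y + d))"
    using a d0 diff by (intro add_mono mult_left_mono power_mono) auto
  finally have le: "cmod (G - 4 * (of_real (y\<^sup>2) * b)) \<le> d * ((y + d)\<^sup>2 + y\<^sup>2) + 2 * y * (d * (2 * y + d))" .
  define m where "m = max d y"
  have m: "d \<le> m" "y \<le> m" "0 \<le> m" using d0 by (auto simp: m_def)
  have "(y + d)\<^sup>2 \<le> (2 * m)\<^sup>2" by (rule power_mono) (use m d0 in linarith)+
  moreover have "y\<^sup>2 \<le> m\<^sup>2" using m d0 by (intro power_mono)
  ultimately have "d * ((y + d)\<^sup>2 + y\<^sup>2) \<le> d * (5 * m\<^sup>2)" using d0 by (intro mult_left_mono) (auto simp: power_mult_distrib)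
  moreover have "y * (2 * y + d) \<le> m * (3 * m)" using m d0 by (intro mult_mono) auto
  then have "d * (y * (2 * y + d)) \<le> d * (m * (3 * m))" using d0 by (intro mult_left_mono)
  moreover have "2 * y * (d * (2 * y + d)) = 2 * (d * (y * (2 * y + d)))" by simp
  moreover have "d * (m * (3 * m)) = 3 * (d * m\<^sup>2)" "d * (5 * m\<^sup>2) = 5 * (d * m\<^sup>2)"
    by (simp_all add: power2_eq_square)
  moreover have "0 \<le> d * m\<^sup>2" using d0 by simp
  \<comment> \<open>The two terms contribute 5 and 6 times \<open>d * m\<^sup>2\<close>, well below
    27; the constant 729 is the square of 27.\<close>
  ultimately have "cmod (G - 4 * (of_real (y\<^sup>2) * b)) \<le> 27 * (d * m\<^sup>2)"
    using le by linarith
  then have "(cmod (G - 4 * (of_real (y\<^sup>2) * b)))\<^sup>2 \<le> (27 * (d * m\<^sup>2))\<^sup>2" by (intro power_mono) auto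
  also have "\<dots> = 729 * (d\<^sup>2 * m ^ 4)" by (simp add: eval_nat_numeral)
  also have "d\<^sup>2 * m ^ 4 \<le> d\<^sup>2 * (y ^ 4 + d ^ 4)"
    unfolding m_def max_def using d0 by (intro mult_left_mono) auto
  also have "d\<^sup>2 * (y ^ 4 + d ^ 4) \<le> e * y ^ 6 + (1 / e\<^sup>2 + 1) * d ^ 6"
    using young_2_4[OF d0 e] by (simp add: eval_nat_numeral algebra_simps)
  finally show ?thesis unfolding d_def y_def by simp
qed

lemma solution_continuous:
  assumes u: "szego_solution u"
  shows "((\<lambda>h. hsum (coef (\<lambda>z. u (t + h) z - u t z))) \<longlongrightarrow> 0) (at 0)"
proof -
  have "((\<lambda>s. H_half_norm (\<lambda>z. u s z - u t z)) \<longlongrightarrow> 0) (at t)"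
    using u unfolding szego_solution_def by blast
  then have "((\<lambda>h. H_half_norm (\<lambda>z. u (t + h) z - u t z)) \<longlongrightarrow> 0) (at 0)"
    by (rule LIM_offset_zero)
  then have "((\<lambda>h. (H_half_norm (\<lambda>z. u (t + h) z - u t z))\<^sup>2) \<longlongrightarrow> 0\<^sup>2) (at 0)"
    by (intro tendsto_intros)
  moreover have "(H_half_norm (\<lambda>z. u (t + h) z - u t z))\<^sup>2 = hsum (coef (\<lambda>z. u (t + h) z - u t z))" for h
    using hsum_nonneg[OF plus_part_H_halfD(2)[OF plus_part_H_half_diff[OF solution_plus[OF u] solution_plus[OF u]]]]
    by (simp add: H_half_norm_hsum)
  ultimately show ?thesis by simp
qed

text \<open>The difference quotient of the energy is exactly
  \<open>Re (L2_inner (q h) (G h))\<close>. Here \<open>q h\<close> converges in L2 by the equation,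
  and \<open>G h\<close> converges in L2 to four times the cubic term \<open>f\<close> by continuity
  in H^(1/2) and the L6 bound. The limit is the real part of \<open>- 4 * \<i>\<close> times the
  squared norm of \<open>szego_proj f\<close>, hence 0.\<close>

lemma solution_energy_const:
  assumes u: "szego_solution u"
  shows "energy (u s) = energy (u t)"
proof -
  have "((\<lambda>s. energy (u s)) has_real_derivative 0) (at t)" for t
  proof -
    note H = solution_plus[OF u]
    define f where "f = cubic (u t)"
    define w' where "w' z = - \<i> * szego_proj f z" for z
    have fL: "f \<in> L2" unfolding f_def by (rule cubic_L2(1)[OF H])
    have gp: "szego_proj f \<in> plus_part L2" by (rule szego_proj_plus_part[OF fL])
    define q where "q h z = (u (t + h) z - u t z) / of_real h" for h z
    have uL: "\<forall>s. u s \<in> L2" using plus_part_H_halfD(3)[OF H] by blast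
    have qL: "q h \<in> L2" for h unfolding q_def[abs_def] by (rule L2_difference_quotient[OF uL])
    have w'L: "w' \<in> L2" and lim: "((\<lambda>h. L2_norm (\<lambda>z. q h z - w' z)) \<longlongrightarrow> 0) (at 0)"
      using solution_derivative[OF u, of t]
      by (simp_all add: has_L2_derivative_def q_def w'_def[abs_def] f_def)
    define G where "G h z = (u (t + h) z + u t z) * of_real ((cmod (u (t + h) z))\<^sup>2 + (cmod (u t z))\<^sup>2)" for h z
    define S where "S h = hsum (coef (\<lambda>z. u (t + h) z - u t z))" for h
    have S: "(S \<longlongrightarrow> 0) (at 0)" unfolding S_def[abs_def] by (rule solution_continuous[OF u])
    have S0: "0 \<le> S h" for h
      unfolding S_def by (intro hsum_nonneg plus_part_H_halfD plus_part_H_half_diff H)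
    define B where "B = (LINT z|circle. cmod (u t z) ^ 6)"
    define K where "K = (2 * zeta32)\<^sup>2"
    have K0: "0 \<le> K" by (simp add: K_def)
    have Gbound: "(\<lambda>z. G h z - 4 * f z) \<in> L2 \<and>
        (L2_norm (\<lambda>z. G h z - 4 * f z))\<^sup>2 \<le> 729 * ((S h + \<bar>h\<bar>) * B + K * S h + K * S h ^ 3)"
      if h: "h \<noteq> 0" for h
    proof -
      \<comment> \<open>The summand \<open>\<bar>h\<bar>\<close> keeps \<open>e\<close> positive
        when \<open>S h = 0\<close>; since \<open>S h \<le> e\<close>, the quotient
        \<open>S h ^ 3 / e\<^sup>2\<close> is at most \<open>S h\<close>.\<close>
      define e where "e = S h + \<bar>h\<bar>"
      have e: "0 < e" using S0[of h] h by (simp add: e_def)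
      have [measurable]: "u s \<in> borel_measurable circle" for s using uL by (simp add: L2_def)
      have m: "(\<lambda>z. G h z - 4 * f z) \<in> borel_measurable circle"
        unfolding G_def f_def cubic_def by measurable
      have d6: "integrable circle (\<lambda>z. cmod (u (t + h) z - u t z) ^ 6)"
        "(LINT z|circle. cmod (u (t + h) z - u t z) ^ 6) \<le> K * S h ^ 3"
        unfolding K_def S_def by (intro H_half_L6 plus_part_H_half_diff H)+
      have I: "integrable circle (\<lambda>z. 729 * (e * cmod (u t z) ^ 6 + (1 / e\<^sup>2 + 1) * cmod (u (t + h) z - u t z) ^ 6))"
        using d6(1) H_half_L6(1)[OF H] by simp
      have le: "(cmod (G h z - 4 * f z))\<^sup>2
          \<le> 729 * (e * cmod (u t z) ^ 6 + (1 / e\<^sup>2 + 1) * cmod (u (t + h) z - u t z) ^ 6)" for z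
        unfolding G_def f_def cubic_def by (rule cubic_polarized_bound[OF e])
      note L2_of_square_bound[OF m I le]
      moreover have "(LINT z|circle. 729 * (e * cmod (u t z) ^ 6 + (1 / e\<^sup>2 + 1) * cmod (u (t + h) z - u t z) ^ 6))
          \<le> 729 * ((S h + \<bar>h\<bar>) * B + K * S h + K * S h ^ 3)"
      proof -
        have "(LINT z|circle. 729 * (e * cmod (u t z) ^ 6 + (1 / e\<^sup>2 + 1) * cmod (u (t + h) z - u t z) ^ 6))
          = 729 * (e * B + (1 / e\<^sup>2 + 1) * (LINT z|circle. cmod (u (t + h) z - u t z) ^ 6))"
          using d6(1) H_half_L6(1)[OF H] by (simp add: B_def)
        also have "\<dots> \<le> 729 * (e * B + (1 / e\<^sup>2 + 1) * (K * S h ^ 3))"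
          using d6(2) by (intro mult_left_mono add_left_mono) auto
        also have "(1 / e\<^sup>2 + 1) * (K * S h ^ 3) = K * (S h ^ 3 / e\<^sup>2) + K * S h ^ 3"
          by (simp add: algebra_simps)
        also have "729 * (e * B + (K * (S h ^ 3 / e\<^sup>2) + K * S h ^ 3)) \<le> 729 * (e * B + (K * S h + K * S h ^ 3))"
        proof -
          have "S h * (S h)\<^sup>2 \<le> S h * e\<^sup>2"
            using S0[of h] by (intro mult_left_mono power_mono) (auto simp: e_def)
          then have "S h ^ 3 / e\<^sup>2 \<le> S h"
            using e by (simp add: field_simps eval_nat_numeral)
          then have "K * (S h ^ 3 / e\<^sup>2) \<le> K * S h" using K0 by (rule mult_left_mono)
          then show ?thesis by simp
        qed
        finally show ?thesis by (simp add: e_def algebra_simps)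
      qed
      ultimately show ?thesis by auto
    qed
    define n where "n h = L2_norm (\<lambda>z. G h z - 4 * f z)" for h
    have "((\<lambda>h. (n h)\<^sup>2) \<longlongrightarrow> 0) (at 0)"
    proof (rule Lim_null_comparison)
      show "\<forall>\<^sub>F h in at 0. norm ((n h)\<^sup>2) \<le> 729 * ((S h + \<bar>h\<bar>) * B + K * S h + K * S h ^ 3)"
        unfolding eventually_at_filter using Gbound by (auto simp: n_def)
      have "((\<lambda>h. 729 * ((S h + \<bar>h\<bar>) * B + K * S h + K * S h ^ 3)) \<longlongrightarrow>
          729 * ((0 + \<bar>0\<bar>) * B + K * 0 + K * 0 ^ 3)) (at 0)"
        by (intro tendsto_intros S)
      then show "((\<lambda>h. 729 * ((S h + \<bar>h\<bar>) * B + K * S h + K * S h ^ 3)) \<longlongrightarrow> 0) (at 0)" by simp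
    qed
    then have n: "(n \<longlongrightarrow> 0) (at 0)"
      using tendsto_real_sqrt[of "\<lambda>h. (n h)\<^sup>2" 0] by (simp add: n_def[abs_def])
    have f4L: "(\<lambda>z. 4 * f z) \<in> L2" by (rule L2_cmult[OF fL])
    have GL: "G h \<in> L2" if "h \<noteq> 0" for h
      using L2_add[OF conjunct1[OF Gbound[OF that]] f4L] by simp
    have inner: "((\<lambda>h. L2_inner (q h) (G h)) \<longlongrightarrow> L2_inner w' (\<lambda>z. 4 * f z)) (at 0)"
    proof (rule LIM_zero_cancel, rule Lim_null_comparison)
      show "\<forall>\<^sub>F h in at 0. norm (L2_inner (q h) (G h) - L2_inner w' (\<lambda>z. 4 * f z))
          \<le> L2_norm (\<lambda>z. q h z - w' z) * (n h + L2_norm (\<lambda>z. 4 * f z)) + L2_norm w' * n h"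
        unfolding eventually_at_filter
      proof (intro always_eventually allI impI)
        fix h :: real assume h: "h \<noteq> 0"
        have "L2_inner (q h) (G h) - L2_inner w' (\<lambda>z. 4 * f z)
          = L2_inner (\<lambda>z. q h z - w' z) (G h) + L2_inner w' (\<lambda>z. G h z - 4 * f z)"
          using qL w'L GL[OF h] f4L by (simp add: L2_inner_diff_left L2_inner_diff_right)
        also have "norm \<dots> \<le> L2_norm (\<lambda>z. q h z - w' z) * L2_norm (G h) + L2_norm w' * n h"
          unfolding n_def
          by (intro order_trans[OF norm_triangle_ineq] add_mono L2_Cauchy_Schwarz L2_diff qL w'L GL h f4L)
        also have "\<dots> \<le> L2_norm (\<lambda>z. q h z - w' z) * (n h + L2_norm (\<lambda>z. 4 * f z)) + L2_norm w' * n h"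
          using L2_triangle[OF L2_diff[OF GL[OF h] f4L] f4L]
          by (intro add_right_mono mult_left_mono) (auto simp: n_def)
        finally show "norm (L2_inner (q h) (G h) - L2_inner w' (\<lambda>z. 4 * f z))
          \<le> L2_norm (\<lambda>z. q h z - w' z) * (n h + L2_norm (\<lambda>z. 4 * f z)) + L2_norm w' * n h" .
      qed
      have "((\<lambda>h. L2_norm (\<lambda>z. q h z - w' z) * (n h + L2_norm (\<lambda>z. 4 * f z)) + L2_norm w' * n h)
        \<longlongrightarrow> 0 * (0 + L2_norm (\<lambda>z. 4 * f z)) + L2_norm w' * 0) (at 0)"
        by (intro tendsto_intros lim n)
      then show "((\<lambda>h. L2_norm (\<lambda>z. q h z - w' z) * (n h + L2_norm (\<lambda>z. 4 * f z)) + L2_norm w' * n h)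
        \<longlongrightarrow> 0) (at 0)" by simp
    qed
    have quot: "(energy (u (t + h)) - energy (u t)) / h = Re (L2_inner (q h) (G h))" if h: "h \<noteq> 0" for h
    proof -
      have id: "cmod a ^ 4 - cmod b ^ 4 = Re ((a - b) * cnj ((a + b) * of_real ((cmod a)\<^sup>2 + (cmod b)\<^sup>2)))" for a b
      proof -
        have "Re ((a - b) * cnj (a + b)) = (cmod a)\<^sup>2 - (cmod b)\<^sup>2"
          by (simp only: cmod_power2) (simp add: power2_eq_square algebra_simps)
        moreover have "Re ((a - b) * cnj ((a + b) * of_real ((cmod a)\<^sup>2 + (cmod b)\<^sup>2)))
           = Re ((a - b) * cnj (a + b)) * ((cmod a)\<^sup>2 + (cmod b)\<^sup>2)"
        proof -
          have "Re (x * of_real r) = Re x * r" for x r by simp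
          then show ?thesis
            by (simp only: complex_cnj_mult complex_cnj_complex_of_real mult.assoc[symmetric])
        qed
        ultimately have "Re ((a - b) * cnj ((a + b) * of_real ((cmod a)\<^sup>2 + (cmod b)\<^sup>2)))
          = ((cmod a)\<^sup>2 - (cmod b)\<^sup>2) * ((cmod a)\<^sup>2 + (cmod b)\<^sup>2)" by (simp only:)
        then show ?thesis by (simp only:) (simp add: eval_nat_numeral algebra_simps)
      qed
      have "energy (u (t + h)) - energy (u t) = (LINT z|circle. cmod (u (t + h) z) ^ 4 - cmod (u t z) ^ 4)"
        unfolding energy_def using energy_eq_mass_conv(1)[OF H] by simp
      also have "\<dots> = (LINT z|circle. Re (of_real h * (q h z * cnj (G h z))))"
        unfolding id G_def q_def using h by (simp add: mult.assoc[symmetric] del: times_complex.sel complex_cnj_mult)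
      also have "\<dots> = Re (LINT z|circle. of_real h * (q h z * cnj (G h z)))"
        using L2_integrable_inner[OF qL GL[OF h]] by (intro integral_Re) simp
      also have "\<dots> = h * Re (L2_inner (q h) (G h))"
        by (simp add: L2_inner_def)
      finally show ?thesis using h by simp
    qed
    have zero: "Re (L2_inner w' (\<lambda>z. 4 * f z)) = 0"
    proof -
      have "L2_inner (szego_proj f) f = cnj (L2_inner f (szego_proj f))" by (rule L2_inner_commute)
      also have "L2_inner f (szego_proj f) = of_real ((L2_norm (szego_proj f))\<^sup>2)"
        by (simp only: szego_proj_inner[OF fL gp, symmetric] L2_inner_self)
      finally have 1: "L2_inner (szego_proj f) f = of_real ((L2_norm (szego_proj f))\<^sup>2)" by simp
      have "L2_inner w' (\<lambda>z. 4 * f z) = cnj (4 * cnj (- \<i> * L2_inner (szego_proj f) f))"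
        by (subst L2_inner_commute, subst L2_inner_cmult_left, subst L2_inner_commute)
          (simp only: w'_def[abs_def] L2_inner_cmult_left)
      then show ?thesis unfolding 1 by simp
    qed
    have "((\<lambda>h. Re (L2_inner (q h) (G h))) \<longlongrightarrow> 0) (at 0)"
      using tendsto_Re[OF inner] zero by simp
    then have "((\<lambda>h. (energy (u (t + h)) - energy (u t)) / h) \<longlongrightarrow> 0) (at 0)"
      by (subst tendsto_cong[where g = "\<lambda>h. Re (L2_inner (q h) (G h))"])
        (simp_all add: eventually_at_filter quot)
    then show ?thesis by (simp add: DERIV_def)
  qed
  then show ?thesis using DERIV_isconst_all[of "\<lambda>s. energy (u s)"] by blast
qed

section \<open>Ordinary differential equations and the Galerkin system\<close>

text \<open>The fixed point argument lives in bounded continuous functions on the whole line.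
  Freezing a function at both ends of the interval places it there.\<close>

lemma clamp_bcontfun:
  fixes f :: "real \<Rightarrow> 'a::real_normed_vector"
  assumes "continuous_on {0..T} f" "0 \<le> T"
  shows "(\<lambda>t. f (max 0 (min T t))) \<in> bcontfun"
proof -
  have "continuous_on UNIV (\<lambda>t. f (max 0 (min T t)))"
    by (rule continuous_on_compose2[OF assms(1)]) (use assms(2) in \<open>auto intro!: continuous_intros\<close>)
  moreover have "bounded (f ` {0..T})"
    by (intro compact_imp_bounded compact_continuous_image assms) simp
  then have "bounded (range (\<lambda>t. f (max 0 (min T t))))"
    by (rule bounded_subset) (use assms(2) in auto)
  ultimately show ?thesis by (simp add: bcontfun_def)
qed

lemma integral_exp_scaled:
  fixes r t :: real
  assumes "0 < r" "0 \<le> t"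
  shows "((\<lambda>s. exp (r * s)) has_integral (exp (r * t) - 1) / r) {0..t}"
proof -
  have "((\<lambda>s. exp (r * s)) has_integral (exp (r * t) / r - exp (r * 0) / r)) {0..t}"
  proof (rule fundamental_theorem_of_calculus[OF assms(2)])
    fix s
    show "((\<lambda>s. exp (r * s) / r) has_vector_derivative exp (r * s)) (at s within {0..t})"
      unfolding has_real_derivative_iff_has_vector_derivative[symmetric]
      using assms(1) by (auto intro!: derivative_eq_intros)
  qed
  then show ?thesis by (simp add: diff_divide_distrib)
qed

text \<open>The weight \<open>exp (- 2 L t)\<close> turns the Picard operator into a contraction on the whole
  interval at once, so that no solutions have to be concatenated.\<close>

lemma Picard_Lindeloef:
  fixes F :: "'a::banach \<Rightarrow> 'a"
  assumes lip: "\<And>x y. norm (F x - F y) \<le> L * norm (x - y)" and L: "0 < L" and T: "0 \<le> T"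
  obtains x where "x 0 = x0"
    "\<And>t. t \<in> {0..T} \<Longrightarrow> (x has_vector_derivative F (x t)) (at t within {0..T})"
proof -
  define r where "r = 2 * L"
  have r: "0 < r" using L by (simp add: r_def)
  have contF: "continuous_on UNIV F"
    using lipschitz_on_continuous_on[of L UNIV F] lip L by (auto simp: lipschitz_on_def dist_norm)
  \<comment> \<open>The Picard operator in the unknown
    \<open>g t = exp (- r * t) *\<^sub>R x t\<close>, for which the weighted supremum norm of
    \<open>x\<close> is the ordinary norm of \<open>g\<close>.\<close>
  define I where "I g t = exp (- r * t) *\<^sub>R (x0 + integral {0..t} (\<lambda>s. F (exp (r * s) *\<^sub>R apply_bcontfun g s)))" for g t
  have contFg: "continuous_on S (\<lambda>s. F (exp (r * s) *\<^sub>R apply_bcontfun g s))" for g S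
    by (rule continuous_on_compose2[OF contF]) (auto intro!: continuous_intros)
  have contI: "continuous_on {0..T} (I g)" for g
    unfolding I_def[abs_def]
    by (intro continuous_intros indefinite_integral_continuous_1 integrable_continuous_real contFg)
  define \<Phi> where "\<Phi> g = Bcontfun (\<lambda>t. I g (max 0 (min T t)))" for g
  have \<Phi>: "apply_bcontfun (\<Phi> g) t = I g (max 0 (min T t))" for g t
    unfolding \<Phi>_def using Bcontfun_inverse[OF clamp_bcontfun[OF contI T]] by simp
  have I_dist: "norm (I g t - I h t) \<le> (1 / 2) * norm (g - h)" if t: "0 \<le> t" for g h t
  proof -
    let ?f = "\<lambda>g s. F (exp (r * s) *\<^sub>R apply_bcontfun g s)"
    have int: "?f g integrable_on {0..t}" for g by (intro integrable_continuous_real contFg)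
    have "norm (integral {0..t} (\<lambda>s. ?f g s - ?f h s)) \<le> integral {0..t} (\<lambda>s. exp (r * s) * (L * norm (g - h)))"
    proof (rule integral_norm_bound_integral)
      show "(\<lambda>s. ?f g s - ?f h s) integrable_on {0..t}" by (intro integrable_diff int)
      show "(\<lambda>s. exp (r * s) * (L * norm (g - h))) integrable_on {0..t}"
        by (intro integrable_continuous_real continuous_intros)
      fix s
      have "norm (?f g s - ?f h s) \<le> L * norm (exp (r * s) *\<^sub>R apply_bcontfun g s - exp (r * s) *\<^sub>R apply_bcontfun h s)"
        by (rule lip)
      also have "\<dots> = exp (r * s) * (L * norm (apply_bcontfun (g - h) s))"
        by (simp flip: scaleR_diff_right)
      also have "\<dots> \<le> exp (r * s) * (L * norm (g - h))"
        using L norm_bounded[of "g - h" s] by (intro mult_left_mono) auto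
      finally show "norm (?f g s - ?f h s) \<le> exp (r * s) * (L * norm (g - h))" .
    qed
    also have "\<dots> = (exp (r * t) - 1) / r * (L * norm (g - h))"
      by (rule integral_unique[OF has_integral_mult_left[OF integral_exp_scaled[OF r t]]])
    \<comment> \<open>The factor 1/2 is \<open>L / r\<close>; the term -1 has been dropped.\<close>
    also have "\<dots> \<le> exp (r * t) * ((1 / 2) * norm (g - h))"
      using L by (simp add: r_def field_simps)
    finally have le: "norm (integral {0..t} (?f g) - integral {0..t} (?f h)) \<le> exp (r * t) * ((1 / 2) * norm (g - h))"
      by (simp only: integral_diff[OF int int])
    have "norm (I g t - I h t) = exp (- r * t) * norm (integral {0..t} (?f g) - integral {0..t} (?f h))"
      unfolding I_def by (simp flip: scaleR_diff_right)
    also have "\<dots> \<le> exp (- r * t) * (exp (r * t) * ((1 / 2) * norm (g - h)))"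
      using le by (intro mult_left_mono) auto
    also have "\<dots> = (1 / 2) * norm (g - h)" by (simp add: exp_minus)
    finally show ?thesis .
  qed
  have "dist (\<Phi> g) (\<Phi> h) \<le> (1 / 2) * dist g h" for g h
    unfolding dist_norm
  proof (rule norm_bound)
    show "norm (apply_bcontfun (\<Phi> g - \<Phi> h) t) \<le> 1 / 2 * norm (g - h)" for t
      using I_dist[of "max 0 (min T t)" g h] by (simp add: \<Phi>)
  qed
  then obtain g where g: "\<Phi> g = g" using banach_fix_type[of "1 / 2" \<Phi>] by auto
  define x where "x t = exp (r * t) *\<^sub>R apply_bcontfun g t" for t
  have x: "x t = x0 + integral {0..t} (\<lambda>s. F (x s))" if t: "t \<in> {0..T}" for t
  proof -
    have "apply_bcontfun g t = I g t" using \<Phi>[of g t] g t by simp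
    then show ?thesis unfolding x_def I_def by (simp add: exp_minus)
  qed
  have "(x has_vector_derivative F (x t)) (at t within {0..T})" if t: "t \<in> {0..T}" for t
  proof -
    have "((\<lambda>t. x0 + integral {0..t} (\<lambda>s. F (x s))) has_vector_derivative 0 + F (x t)) (at t within {0..T})"
      unfolding x_def
      by (intro has_vector_derivative_add has_vector_derivative_const
          integral_has_vector_derivative contFg t[unfolded x_def])
    then show ?thesis
      using t x by (simp cong: has_vector_derivative_cong_ev)
        (rule has_vector_derivative_transform[OF t], auto)
  qed
  moreover have "x 0 = x0" using x[of 0] T by simp
  ultimately show ?thesis using that by blast
qed

text \<open>A cutoff: composed with a field that is Lipschitz on the ball of radius \<open>R\<close>
  it gives a globally Lipschitz field. The constant 2 comes from the triangle inequality in a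
  general normed space.\<close>

lemma radial_projection_lipschitz:
  fixes x y :: "'a::real_normed_vector"
  assumes R: "0 < R"
  shows "norm (min 1 (R / norm x) *\<^sub>R x - min 1 (R / norm y) *\<^sub>R y) \<le> 2 * norm (x - y)"
proof -
  have main: "norm (min 1 (R / norm x) *\<^sub>R x - min 1 (R / norm y) *\<^sub>R y) \<le> 2 * norm (x - y)"
    if le: "norm x \<le> norm y" for x y :: 'a
  proof -
    let ?p = "\<lambda>x::'a. min 1 (R / norm x)"
    have p1: "?p y \<le> 1" "0 \<le> ?p y" using R by auto
    have "norm (?p x *\<^sub>R x - ?p y *\<^sub>R y) = norm (?p y *\<^sub>R (x - y) + (?p x - ?p y) *\<^sub>R x)"
      by (simp add: algebra_simps)
    also have "\<dots> \<le> ?p y * norm (x - y) + \<bar>?p x - ?p y\<bar> * norm x"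
      using norm_triangle_ineq[of "?p y *\<^sub>R (x - y)" "(?p x - ?p y) *\<^sub>R x"] p1 by simp
    also have "?p y * norm (x - y) \<le> norm (x - y)" using p1 by (simp add: mult_left_le_one_le)
    also have "\<bar>?p x - ?p y\<bar> * norm x \<le> norm y - norm x"
    proof (cases "x = 0")
      case False
      then have x0: "0 < norm x" and y0: "0 < norm y" using le by (auto intro: order.strict_trans2)
      have mono: "?p y \<le> ?p x"
        using le x0 y0 R by (intro min.mono divide_left_mono) auto
      consider "norm y \<le> R" | "R < norm y" "norm x \<le> R" | "R < norm x" using le by linarith
      then show ?thesis
      proof cases
        case 1
        then have "?p x = 1" "?p y = 1" using le x0 y0 by (auto simp: field_simps)
        then show ?thesis using le by simp
      next
        case 2
        then have p: "?p x = 1" "?p y = R / norm y" using x0 y0 by (auto simp: field_simps)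
        have "(1 - R / norm y) * norm x \<le> (1 - R / norm y) * norm y"
          using 2 le y0 by (intro mult_left_mono) (auto simp: field_simps)
        also have "\<dots> = norm y - R" using y0 by (simp add: field_simps)
        finally show ?thesis using 2 mono p by simp
      next
        case 3
        then have p: "?p x = R / norm x" "?p y = R / norm y" using x0 y0 le by (auto simp: field_simps)
        have "(R / norm x - R / norm y) * norm x = R / norm y * (norm y - norm x)"
          using x0 y0 by (simp add: field_simps)
        also have "\<dots> \<le> 1 * (norm y - norm x)"
          using 3 le y0 by (intro mult_right_mono) (auto simp: field_simps)
        finally show ?thesis using mono p by simp
      qed
    qed (use le in simp)
    also have "norm y - norm x \<le> norm (x - y)" by (metis norm_minus_commute norm_triangle_ineq2)
    finally show ?thesis by simp
  qed
  show ?thesis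
    using main[of x y] main[of y x] by (cases "norm x \<le> norm y") (auto simp: norm_minus_commute)
qed

text \<open>For \<open>c\<close> supported below \<open>N\<close> and \<open>k < N\<close> this is
  the Fourier coefficient at \<open>k\<close> of the cubic term of the polynomial with coefficients
  \<open>c\<close>, as \<open>fourier_cubic_psum\<close> confirms.\<close>

definition cubic_coef :: "nat \<Rightarrow> (nat \<Rightarrow> complex) \<Rightarrow> nat \<Rightarrow> complex" where
  "cubic_coef N c k = (\<Sum>m<N. conv c c (k + m) * cnj (c m))"

text \<open>The radial cutoff multiplies the argument by a real number. By homogeneity the field is
  then also multiplied by a real number, which leaves the conservation laws intact.\<close>

lemma cubic_coef_scale:
  "cubic_coef N (\<lambda>k. of_real s * c k) k = of_real (s ^ 3) * cubic_coef N c k"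
proof -
  have "conv (\<lambda>k. of_real s * c k) (\<lambda>k. of_real s * c k) n = of_real (s ^ 2) * conv c c n" for n
    unfolding conv_def sum_distrib_left by (rule sum.cong[OF refl]) (simp add: power2_eq_square)
  then show ?thesis
    unfolding cubic_coef_def sum_distrib_left
    by (intro sum.cong refl) (simp add: power2_eq_square power3_eq_cube)
qed

text \<open>Summation along antidiagonals. With \<open>h n = conv c c n\<close>, or \<open>n\<close>
  times it, the right side is visibly real; the conservation of mass and momentum by the truncated
  system rests on this.\<close>

lemma sum_pairs_conv:
  fixes c :: "nat \<Rightarrow> complex"
  assumes c: "\<And>k. N \<le> k \<Longrightarrow> c k = 0"
  shows "(\<Sum>k<N. \<Sum>m<N. h (k + m) * (cnj (c k) * cnj (c m))) = (\<Sum>n<2 * N. h n * cnj (conv c c n))"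
proof -
  let ?f = "\<lambda>k m. h (k + m) * (cnj (c k) * cnj (c m))"
  have "(\<Sum>k<N. \<Sum>m<N. ?f k m) = (\<Sum>(k, m)\<in>{..<N} \<times> {..<N}. ?f k m)"
    by (rule sum.cartesian_product)
  \<comment> \<open>The square is enlarged to the triangle \<open>k + m < 2 * N\<close>; the added
    terms vanish by the support of \<open>c\<close>.\<close>
  also have "\<dots> = (\<Sum>(k, m)\<in>{(k, m). k + m < 2 * N}. ?f k m)"
  proof (rule sum.mono_neutral_left)
    show "finite {(k, m). k + m < 2 * N}"
      by (rule finite_subset[of _ "{..<2 * N} \<times> {..<2 * N}"]) auto
    show "\<forall>i\<in>{(k, m). k + m < 2 * N} - {..<N} \<times> {..<N}. (case i of (k, m) \<Rightarrow> ?f k m) = 0"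
      using c by (auto simp: not_less) (metis not_less)+
  qed auto
  also have "\<dots> = (\<Sum>n<2 * N. \<Sum>k\<le>n. ?f k (n - k))" by (rule sum.triangle_reindex)
  also have "\<dots> = (\<Sum>n<2 * N. h n * cnj (conv c c n))"
    by (rule sum.cong[OF refl]) (simp add: conv_def sum_distrib_left)
  finally show ?thesis .
qed

lemma cubic_coef_mass:
  assumes "\<And>k. N \<le> k \<Longrightarrow> c k = 0"
  shows "Im (\<Sum>k<N. cubic_coef N c k * cnj (c k)) = 0"
proof -
  have "(\<Sum>k<N. cubic_coef N c k * cnj (c k)) = (\<Sum>k<N. \<Sum>m<N. conv c c (k + m) * (cnj (c k) * cnj (c m)))"
    unfolding cubic_coef_def sum_distrib_right by (intro sum.cong refl) (simp add: mult_ac)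
  also have "\<dots> = (\<Sum>n<2 * N. conv c c n * cnj (conv c c n))" by (rule sum_pairs_conv[OF assms])
  finally show ?thesis by (simp add: complex_mult_cnj)
qed

text \<open>The pairing is real because of the symmetry between the two conjugated factors.\<close>

lemma cubic_coef_momentum:
  assumes "\<And>k. N \<le> k \<Longrightarrow> c k = 0"
  shows "Im (\<Sum>k<N. of_nat k * (cubic_coef N c k * cnj (c k))) = 0"
proof -
  let ?S = "\<Sum>k<N. of_nat k * (cubic_coef N c k * cnj (c k))"
  let ?t = "\<lambda>k m. conv c c (k + m) * (cnj (c k) * cnj (c m))"
  have sym: "?t k m = ?t m k" for k m
    unfolding add.commute[of k m] mult.commute[of "cnj (c k)" "cnj (c m)"] ..
  have 1: "?S = (\<Sum>k<N. \<Sum>m<N. of_nat k * ?t k m)"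
    unfolding cubic_coef_def sum_distrib_right sum_distrib_left by (intro sum.cong refl) (simp add: mult_ac)
  also have "\<dots> = (\<Sum>m<N. \<Sum>k<N. of_nat k * ?t k m)" by (rule sum.swap)
  also have "\<dots> = (\<Sum>k<N. \<Sum>m<N. of_nat m * ?t k m)"
    by (intro sum.cong refl arg_cong2[where f = "(*)"] sym)
  finally have 2: "?S = (\<Sum>k<N. \<Sum>m<N. of_nat m * ?t k m)" .
  \<comment> \<open>Averaging leaves the weight \<open>k + m\<close>, which depends only on the
    index of the convolution.\<close>
  have "2 * ?S = (\<Sum>k<N. \<Sum>m<N. of_nat k * ?t k m) + (\<Sum>k<N. \<Sum>m<N. of_nat m * ?t k m)"
    using 1 2 by simp
  also have "\<dots> = (\<Sum>k<N. \<Sum>m<N. (of_nat (k + m) * conv c c (k + m)) * (cnj (c k) * cnj (c m)))"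
    unfolding sum.distrib[symmetric] by (intro sum.cong refl) (simp add: algebra_simps)
  also have "\<dots> = (\<Sum>n<2 * N. of_nat n * conv c c n * cnj (conv c c n))"
    by (rule sum_pairs_conv[where h = "\<lambda>n. of_nat n * conv c c n", OF assms])
  finally have "Im (2 * ?S) = 0" by (simp add: complex_mult_cnj mult.assoc)
  then show ?thesis by simp
qed

lemma cubic_coef_lipschitz:
  fixes c d :: "nat \<Rightarrow> complex"
  assumes c: "\<And>k. cmod (c k) \<le> R" and d: "\<And>k. cmod (d k) \<le> R" and cd: "\<And>k. cmod (c k - d k) \<le> e"
    and k: "k < N"
  shows "cmod (cubic_coef N c k - cubic_coef N d k) \<le> real N * (real (2 * N) * (3 * R\<^sup>2 * e))"
proof -
  have R0: "0 \<le> R" using c[of 0] norm_ge_zero order_trans by blast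
  have e0: "0 \<le> e" using cd[of 0] norm_ge_zero order_trans by blast
  have tri: "cmod (x1 * x2 * cnj x3 - y1 * y2 * cnj y3) \<le> 3 * R\<^sup>2 * e"
    if x: "cmod x1 \<le> R" "cmod x2 \<le> R" "cmod x3 \<le> R" "cmod y1 \<le> R" "cmod y2 \<le> R" "cmod y3 \<le> R"
      and xy: "cmod (x1 - y1) \<le> e" "cmod (x2 - y2) \<le> e" "cmod (x3 - y3) \<le> e" for x1 x2 x3 y1 y2 y3
  proof -
    have "x1 * x2 * cnj x3 - y1 * y2 * cnj y3
        = (x1 - y1) * x2 * cnj x3 + y1 * (x2 - y2) * cnj x3 + y1 * y2 * cnj (x3 - y3)"
      by (simp add: algebra_simps)
    also have "cmod \<dots> \<le> cmod ((x1 - y1) * x2 * cnj x3) + cmod (y1 * (x2 - y2) * cnj x3) + cmod (y1 * y2 * cnj (x3 - y3))"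
      by (intro order_trans[OF norm_triangle_ineq] add_right_mono norm_triangle_ineq)
    also have "\<dots> \<le> e * R * R + R * e * R + R * R * e"
      unfolding norm_mult complex_mod_cnj using x xy R0 e0
      by (intro add_mono mult_mono) (auto intro!: mult_nonneg_nonneg)
    finally show ?thesis by (simp add: power2_eq_square algebra_simps)
  qed
  have "cubic_coef N c k - cubic_coef N d k
    = (\<Sum>m<N. \<Sum>l\<le>k + m. c l * c (k + m - l) * cnj (c m) - d l * d (k + m - l) * cnj (d m))"
    unfolding cubic_coef_def conv_def sum_distrib_right sum_subtractf ..
  also have "cmod \<dots> \<le> (\<Sum>m<N. real (2 * N) * (3 * R\<^sup>2 * e))"
  proof (rule sum_norm_le)
    fix m assume m: "m \<in> {..<N}"
    have "cmod (\<Sum>l\<le>k + m. c l * c (k + m - l) * cnj (c m) - d l * d (k + m - l) * cnj (d m))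
      \<le> (\<Sum>l\<le>k + m. 3 * R\<^sup>2 * e)"
      by (intro sum_norm_le tri c d cd)
    also have "\<dots> = real (k + m + 1) * (3 * R\<^sup>2 * e)" by simp
    also have "\<dots> \<le> real (2 * N) * (3 * R\<^sup>2 * e)"
      using m k e0 by (intro mult_right_mono) auto
    finally show "cmod (\<Sum>l\<le>k + m. c l * c (k + m - l) * cnj (c m) - d l * d (k + m - l) * cnj (d m))
      \<le> real (2 * N) * (3 * R\<^sup>2 * e)" .
  qed
  finally show ?thesis by simp
qed

text \<open>\<open>'a \<Rightarrow>\<^sub>C complex\<close> is only known to be complete over a metric space \<open>'a\<close>.\<close>

instantiation nat :: metric_space
begin

definition dist_nat :: "nat \<Rightarrow> nat \<Rightarrow> real" where
  "dist_nat m n = \<bar>real m - real n\<bar>"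

definition uniformity_nat :: "(nat \<times> nat) filter" where
  "uniformity_nat = (INF e\<in>{0 <..}. principal {(m, n). dist m n < e})"

instance
proof
  fix U :: "nat set"
  have eq: "m = n" if "\<bar>real m - real n\<bar> < 1" for m n
  proof -
    have "real m < real (n + 1)" "real n < real (m + 1)" using that by auto
    then show ?thesis unfolding of_nat_less_iff by linarith
  qed
  have "\<forall>\<^sub>F (m', n) in uniformity. m' = m \<longrightarrow> n \<in> U" if "m \<in> U" for m
  proof -
    have "\<forall>\<^sub>F p in principal {(m, n :: nat). dist m n < 1}. (case p of (m', n) \<Rightarrow> m' = m \<longrightarrow> n \<in> U)"
      using that eq by (auto simp: eventually_principal dist_nat_def)
    then show ?thesis
      unfolding uniformity_nat_def
      by (rule filter_leD[rotated]) (rule INF_lower, simp)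
  qed
  then show "open U \<longleftrightarrow> (\<forall>m\<in>U. \<forall>\<^sub>F (m', n) in uniformity. m' = m \<longrightarrow> n \<in> U)"
    by (simp add: open_discrete)
qed (auto simp: dist_nat_def uniformity_nat_def)

end

instance bcontfun :: (metric_space, banach) banach ..

section \<open>Existence and conservation laws of the Galerkin system\<close>

lemma continuous_on_nat: "continuous_on UNIV (f :: nat \<Rightarrow> 'a::topological_space)"
  by (simp add: continuous_on_discrete)

lemma finite_support_bcontfun:
  fixes f :: "nat \<Rightarrow> complex"
  assumes "\<And>k. N \<le> k \<Longrightarrow> f k = 0"
  shows "f \<in> bcontfun"
proof -
  have "range f \<subseteq> insert 0 (f ` {..<N})" using assms not_less by auto
  then have "bounded (range f)" by (rule bounded_subset[rotated]) (simp add: finite_imp_bounded)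
  then show ?thesis by (simp add: bcontfun_def continuous_on_nat)
qed

lemma has_vector_derivative_cmod_square:
  fixes x :: "real \<Rightarrow> complex"
  assumes "(x has_vector_derivative x') (at t within S)"
  shows "((\<lambda>s. (cmod (x s))\<^sup>2) has_vector_derivative 2 * Re (x' * cnj (x t))) (at t within S)"
proof -
  have "((\<lambda>s. x s \<bullet> x s) has_vector_derivative (x t \<bullet> x' + x' \<bullet> x t)) (at t within S)"
    by (rule bounded_bilinear.has_vector_derivative[OF bounded_bilinear_inner assms assms])
  then show ?thesis
    by (simp add: power2_norm_eq_inner inner_complex_def algebra_simps)
qed

lemma has_vector_derivative_zero_const:
  fixes f :: "real \<Rightarrow> 'a::real_normed_vector"
  assumes "\<And>t. t \<in> {0..T} \<Longrightarrow> (f has_vector_derivative 0) (at t within {0..T})" "t \<in> {0..T}"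
  shows "f t = f 0"
proof -
  have "\<exists>c. \<forall>t\<in>{0..T}. f t = c"
    by (rule has_derivative_zero_constant) (use assms in \<open>auto simp: has_vector_derivative_def\<close>)
  then show ?thesis using assms(2) by auto
qed

text \<open>The system is solved with a radial cutoff, which makes the field globally Lipschitz on
  bounded sequences. The modified system already conserves mass, and this keeps the solution in the
  ball where the cutoff is inactive. The factor \<open>\<sigma>\<close> serves to run time in either
  direction.\<close>

lemma Galerkin_exists:
  fixes c0 :: "nat \<Rightarrow> complex" and \<sigma> T :: real
  assumes T: "0 \<le> T"
  obtains x :: "real \<Rightarrow> nat \<Rightarrow> complex" where
    "\<And>k. x 0 k = (if k < N then c0 k else 0)"
    "\<And>t k. t \<in> {0..T} \<Longrightarrow> N \<le> k \<Longrightarrow> x t k = 0"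
    "\<And>t k. t \<in> {0..T} \<Longrightarrow> k < N \<Longrightarrow>
      ((\<lambda>s. x s k) has_vector_derivative - \<i> * of_real \<sigma> * cubic_coef N (x t) k) (at t within {0..T})"
    "\<And>t. t \<in> {0..T} \<Longrightarrow> (\<Sum>k<N. (cmod (x t k))\<^sup>2) = (\<Sum>k<N. (cmod (c0 k))\<^sup>2)"
    "\<And>t. t \<in> {0..T} \<Longrightarrow> (\<Sum>k<N. real k * (cmod (x t k))\<^sup>2) = (\<Sum>k<N. real k * (cmod (c0 k))\<^sup>2)"
proof -
  define Q where "Q = (\<Sum>k<N. (cmod (c0 k))\<^sup>2)"
  \<comment> \<open>Mass conservation bounds every coefficient by \<open>sqrt Q\<close>, so the ball
    of radius \<open>R\<close> is never left; the added 1 keeps \<open>R\<close> positive when the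
    initial truncation vanishes.\<close>
  define R where "R = sqrt Q + 1"
  have Q0: "0 \<le> Q" by (simp add: Q_def sum_nonneg)
  have R: "0 < R" using Q0 by (simp add: R_def add_nonneg_pos)
  define tr where "tr c k = (if k < N then c k else 0)" for c :: "nat \<Rightarrow> complex" and k
  define G where "G y = Bcontfun (tr (\<lambda>k. - \<i> * of_real \<sigma> * cubic_coef N (tr (apply_bcontfun y)) k))" for y
  have G: "apply_bcontfun (G y) = tr (\<lambda>k. - \<i> * of_real \<sigma> * cubic_coef N (tr (apply_bcontfun y)) k)" for y
    unfolding G_def by (rule Bcontfun_inverse, rule finite_support_bcontfun[of N]) (simp add: tr_def)
  define p where "p y = min 1 (R / norm y)" for y :: "nat \<Rightarrow>\<^sub>C complex"
  define F where "F y = G (p y *\<^sub>R y)" for y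
  have p_norm: "norm (p y *\<^sub>R y) \<le> R" for y
    using R by (cases "y = 0") (auto simp: p_def min_def field_simps)
  have G_lip: "norm (G y - G z) \<le> (\<bar>\<sigma>\<bar> * (real N * (real (2 * N) * (3 * R\<^sup>2))) + 1) * norm (y - z)"
    if "norm y \<le> R" "norm z \<le> R" for y z
  proof (rule norm_bound)
    fix k
    have le: "cmod (tr (apply_bcontfun y) k) \<le> R" if "norm y \<le> R" for y :: "nat \<Rightarrow>\<^sub>C complex" and k
      using norm_bounded[of y k] that R by (simp add: tr_def)
    have cd: "cmod (tr (apply_bcontfun y) k - tr (apply_bcontfun z) k) \<le> norm (y - z)" for k
      using norm_bounded[of "y - z" k] by (simp add: tr_def)
    show "norm (apply_bcontfun (G y - G z) k) \<le> (\<bar>\<sigma>\<bar> * (real N * (real (2 * N) * (3 * R\<^sup>2))) + 1) * norm (y - z)"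
    proof (cases "k < N")
      case True
      have "apply_bcontfun (G y - G z) k
        = - \<i> * of_real \<sigma> * (cubic_coef N (tr (apply_bcontfun y)) k - cubic_coef N (tr (apply_bcontfun z)) k)"
        unfolding minus_bcontfun.rep_eq G using True by (simp add: tr_def right_diff_distrib)
      then have "norm (apply_bcontfun (G y - G z) k)
        = \<bar>\<sigma>\<bar> * cmod (cubic_coef N (tr (apply_bcontfun y)) k - cubic_coef N (tr (apply_bcontfun z)) k)"
        by (simp only: norm_mult norm_minus_cancel norm_ii norm_of_real)
      also have "\<dots> \<le> \<bar>\<sigma>\<bar> * (real N * (real (2 * N) * (3 * R\<^sup>2 * norm (y - z))))"
        by (intro mult_left_mono cubic_coef_lipschitz le cd that True) simp
      also have "\<dots> \<le> (\<bar>\<sigma>\<bar> * (real N * (real (2 * N) * (3 * R\<^sup>2))) + 1) * norm (y - z)"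
        by (simp add: algebra_simps)
      finally show ?thesis .
    qed (simp add: G tr_def)
  qed
  define L where "L = (\<bar>\<sigma>\<bar> * (real N * (real (2 * N) * (3 * R\<^sup>2))) + 1) * 2"
  have L: "0 < L" unfolding L_def by (intro mult_pos_pos add_nonneg_pos) auto
  have F_lip: "norm (F y - F z) \<le> L * norm (y - z)" for y z
  proof -
    have "norm (F y - F z) \<le> (\<bar>\<sigma>\<bar> * (real N * (real (2 * N) * (3 * R\<^sup>2))) + 1) * norm (p y *\<^sub>R y - p z *\<^sub>R z)"
      unfolding F_def by (intro G_lip p_norm)
    also have "\<dots> \<le> (\<bar>\<sigma>\<bar> * (real N * (real (2 * N) * (3 * R\<^sup>2))) + 1) * (2 * norm (y - z))"
      unfolding p_def by (intro mult_left_mono radial_projection_lipschitz R) auto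
    finally show ?thesis by (simp add: L_def algebra_simps)
  qed
  define y0 where "y0 = Bcontfun (tr c0)"
  have y0: "apply_bcontfun y0 = tr c0"
    unfolding y0_def by (rule Bcontfun_inverse, rule finite_support_bcontfun[of N]) (simp add: tr_def)
  obtain y where y_0: "y 0 = y0"
    and y': "\<And>t. t \<in> {0..T} \<Longrightarrow> (y has_vector_derivative F (y t)) (at t within {0..T})"
    using Picard_Lindeloef[OF F_lip L T] by blast
  define x where "x t = apply_bcontfun (y t)" for t
  have ev: "bounded_linear (\<lambda>f::nat \<Rightarrow>\<^sub>C complex. apply_bcontfun f k)" for k
    by (rule bounded_linear_intro[where K = 1]) (use norm_bounded in auto)
  have x'F: "((\<lambda>s. x s k) has_vector_derivative apply_bcontfun (F (y t)) k) (at t within {0..T})" if "t \<in> {0..T}" for t k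
    unfolding x_def by (rule bounded_linear.has_vector_derivative[OF ev y'[OF that]])
  have x0: "x 0 k = (if k < N then c0 k else 0)" for k by (simp add: x_def y_0 y0 tr_def)
  have xN: "x t k = 0" if t: "t \<in> {0..T}" and k: "N \<le> k" for t k
  proof -
    have "apply_bcontfun (F (y s)) k = 0" for s using k by (simp add: F_def G tr_def)
    then have "x t k = x 0 k"
      using x'F[of _ k] by (intro has_vector_derivative_zero_const[OF _ t, of "\<lambda>s. x s k"]) simp
    then show ?thesis using k by (simp add: x0)
  qed
  have tr_x: "tr (x t) = x t" if "t \<in> {0..T}" for t using xN[OF that] by (auto simp: tr_def)
  have Fx: "apply_bcontfun (F (y t)) k = of_real (p (y t) ^ 3) * (- \<i> * of_real \<sigma> * cubic_coef N (x t) k)"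
    if t: "t \<in> {0..T}" and k: "k < N" for t k
  proof -
    have "tr (apply_bcontfun (p (y t) *\<^sub>R y t)) = (\<lambda>k. of_real (p (y t)) * x t k)"
      using tr_x[OF t] by (auto simp: tr_def x_def scaleR_conv_of_real fun_eq_iff) metis
    then have "apply_bcontfun (F (y t)) k = - \<i> * of_real \<sigma> * cubic_coef N (\<lambda>k. of_real (p (y t)) * x t k) k"
      using k unfolding F_def G by (simp add: tr_def)
    then show ?thesis by (simp add: cubic_coef_scale)
  qed
  \<comment> \<open>Shown with the cutoff still in place, since the mass bound is needed to remove
    it. The cutoff enters only as the real factor \<open>p (y t) ^ 3\<close>.\<close>
  have conserved: "(\<Sum>k<N. w k * (cmod (x t k))\<^sup>2) = (\<Sum>k<N. w k * (cmod (c0 k))\<^sup>2)"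
    if t: "t \<in> {0..T}" and w: "\<And>t. t \<in> {0..T} \<Longrightarrow> Im (\<Sum>k<N. of_real (w k) * (cubic_coef N (x t) k * cnj (x t k))) = 0" for w t
  proof -
    have "(\<Sum>k<N. w k * (cmod (x t k))\<^sup>2) = (\<Sum>k<N. w k * (cmod (x 0 k))\<^sup>2)"
    proof (rule has_vector_derivative_zero_const[OF _ t])
      fix t assume t: "t \<in> {0..T}"
      have "((\<lambda>t. \<Sum>k<N. w k * (cmod (x t k))\<^sup>2) has_vector_derivative
          (\<Sum>k<N. w k * (2 * Re (apply_bcontfun (F (y t)) k * cnj (x t k))))) (at t within {0..T})"
        by (intro has_vector_derivative_sum has_vector_derivative_mult_right
            has_vector_derivative_cmod_square x'F t)
      also have "(\<Sum>k<N. w k * (2 * Re (apply_bcontfun (F (y t)) k * cnj (x t k))))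
          = (\<Sum>k<N. 2 * \<sigma> * p (y t) ^ 3 * Im (of_real (w k) * (cubic_coef N (x t) k * cnj (x t k))))"
      proof (rule sum.cong[OF refl])
        fix k assume "k \<in> {..<N}"
        then have "apply_bcontfun (F (y t)) k * cnj (x t k)
          = of_real (p (y t) ^ 3 * \<sigma>) * (- \<i> * (cubic_coef N (x t) k * cnj (x t k)))"
          using Fx[OF t] by simp
        then have "Re (apply_bcontfun (F (y t)) k * cnj (x t k))
          = p (y t) ^ 3 * \<sigma> * Im (cubic_coef N (x t) k * cnj (x t k))"
          by (simp only: Re_complex_of_real Im_complex_of_real times_complex.sel) simp
        then show "w k * (2 * Re (apply_bcontfun (F (y t)) k * cnj (x t k)))
          = 2 * \<sigma> * p (y t) ^ 3 * Im (of_real (w k) * (cubic_coef N (x t) k * cnj (x t k)))"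
          by simp
      qed
      also have "\<dots> = 0"
        using w[OF t] by (simp only: sum_distrib_left[symmetric] Im_sum[symmetric] mult_zero_right)
      finally show "((\<lambda>t. \<Sum>k<N. w k * (cmod (x t k))\<^sup>2) has_vector_derivative 0) (at t within {0..T})" .
    qed
    then show ?thesis by (simp add: x0)
  qed
  have mass: "(\<Sum>k<N. (cmod (x t k))\<^sup>2) = Q" if t: "t \<in> {0..T}" for t
    using conserved[of t "\<lambda>_. 1", OF t] cubic_coef_mass[OF xN] by (simp add: Q_def)
  have momentum: "(\<Sum>k<N. real k * (cmod (x t k))\<^sup>2) = (\<Sum>k<N. real k * (cmod (c0 k))\<^sup>2)" if t: "t \<in> {0..T}" for t
    using conserved[of t "\<lambda>k. real k", OF t] cubic_coef_momentum[OF xN] by simp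
  \<comment> \<open>At \<open>y t = 0\<close> division by zero makes the cutoff factor 0 instead of
    1. The field vanishes there anyway, and \<open>x'\<close> treats that case separately.\<close>
  have p1: "p (y t) = 1" if t: "t \<in> {0..T}" and nz: "y t \<noteq> 0" for t
  proof -
    have "norm (y t) \<le> R"
    proof (rule norm_bound)
      fix k
      show "norm (apply_bcontfun (y t) k) \<le> R"
      proof (cases "k < N")
        case True
        then have "(cmod (x t k))\<^sup>2 \<le> (\<Sum>k<N. (cmod (x t k))\<^sup>2)" by (intro member_le_sum) auto
        then have "(cmod (x t k))\<^sup>2 \<le> (sqrt Q)\<^sup>2" using mass[OF t] Q0 by simp
        then have "cmod (x t k) \<le> sqrt Q" by (rule power2_le_imp_le) (use Q0 in simp)
        then show ?thesis by (simp add: x_def R_def)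
      next
        case False
        then show ?thesis using xN[OF t, of k] R by (simp add: x_def)
      qed
    qed
    then show ?thesis using nz by (simp add: p_def min_def field_simps)
  qed
  have x': "((\<lambda>s. x s k) has_vector_derivative - \<i> * of_real \<sigma> * cubic_coef N (x t) k) (at t within {0..T})"
    if "t \<in> {0..T}" "k < N" for t k
  proof (cases "y t = 0")
    case True
    then have "cubic_coef N (x t) k = 0" by (simp add: x_def cubic_coef_def)
    then show ?thesis using x'F[OF that(1), of k] Fx[OF that] by simp
  next
    case False
    then show ?thesis using x'F[OF that(1), of k] Fx[OF that] p1[OF that(1)] by simp
  qed
  show ?thesis
    by (rule that[of x]) (use x0 xN x' mass momentum in \<open>auto simp: Q_def\<close>)
qed

section \<open>Conservation of momentum\<close>

lemma Gronwall_linear: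
  fixes f :: "real \<Rightarrow> real"
  assumes T: "0 \<le> T" and cont: "continuous_on {0..T} f" and a: "0 \<le> a" and b: "0 \<le> b"
    and deriv: "\<And>t. 0 < t \<Longrightarrow> t < T \<Longrightarrow> \<exists>d. (f has_real_derivative d) (at t) \<and> d \<le> a * f t + b"
  shows "f T \<le> (f 0 + b * T) * exp (a * T)"
proof (cases "T = 0")
  case False
  then have T0: "0 < T" using T by simp
  \<comment> \<open>An integrating factor; subtracting \<open>b * t\<close> itself is enough because
    \<open>exp (- a * t) \<le> 1\<close>.\<close>
  define g where "g t = exp (- a * t) * f t - b * t" for t
  have d: "\<exists>l. (g has_real_derivative l) (at t) \<and> l \<le> 0" if t: "0 < t" "t < T" for t
  proof -
    obtain d where d: "(f has_real_derivative d) (at t)" "d \<le> a * f t + b" using deriv[OF t] by blast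
    have "(g has_real_derivative (exp (- a * t) * (d - a * f t) - b)) (at t)"
      unfolding g_def[abs_def] by (auto intro!: derivative_eq_intros d(1) simp: algebra_simps)
    moreover have "exp (- a * t) * (d - a * f t) - b \<le> 0"
    proof -
      have "exp (- a * t) * (d - a * f t) \<le> exp (- a * t) * b"
        using d(2) by (intro mult_left_mono) auto
      also have "\<dots> \<le> 1 * b" using a b t by (intro mult_right_mono) auto
      finally show ?thesis by simp
    qed
    ultimately show ?thesis by blast
  qed
  have contg: "continuous_on {0..T} g" unfolding g_def[abs_def] by (intro continuous_intros cont)
  have "\<exists>l z. 0 < z \<and> z < T \<and> DERIV g z :> l \<and> g T - g 0 = (T - 0) * l"
    by (rule MVT[OF T0 contg]) (use d real_differentiable_def in blast)
  then obtain l z where z: "0 < z" "z < T" "DERIV g z :> l" "g T - g 0 = (T - 0) * l" by blast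
  then have "l \<le> 0" using d[OF z(1,2)] DERIV_unique by blast
  then have "T * l \<le> 0" using T0 by (intro mult_nonneg_nonpos) auto
  then have "g T \<le> g 0" using z(4) by simp
  then have "exp (- a * T) * f T \<le> f 0 + b * T" by (simp add: g_def)
  then have "exp (a * T) * (exp (- a * T) * f T) \<le> exp (a * T) * (f 0 + b * T)" by (intro mult_left_mono) auto
  moreover have "exp (a * T) * (exp (- a * T) * f T) = f T" by (simp add: exp_minus)
  ultimately have "f T \<le> exp (a * T) * (f 0 + b * T)" by (simp only:)
  then show ?thesis by (simp only: mult.commute[of "exp (a * T)"])
qed simp

text \<open>Each dyadic block of the harmonic sum contributes at most 1.\<close>

lemma harm_pow2_le: "(\<Sum>k<2 ^ j. 1 / (real k + 1)) \<le> real j + 1"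
proof (induction j)
  case (Suc j)
  have "(\<Sum>k<2 ^ Suc j. 1 / (real k + 1)) = (\<Sum>k<2 ^ j. 1 / (real k + 1)) + (\<Sum>k=2 ^ j..<2 ^ Suc j. 1 / (real k + 1))"
    using sum.atLeastLessThan_concat[of 0 "2 ^ j" "2 ^ Suc j" "\<lambda>k. 1 / (real k + 1)"]
    unfolding atLeast0LessThan by simp
  also have "(\<Sum>k=2 ^ j..<2 ^ Suc j. 1 / (real k + 1)) \<le> (\<Sum>k\<in>{2 ^ j..<(2::nat) ^ Suc j}. 1 / 2 ^ j)"
  proof (intro sum_mono divide_left_mono)
    fix k :: nat assume "k \<in> {2 ^ j..<2 ^ Suc j}"
    then have "2 ^ j \<le> k" by simp
    then have "real (2 ^ j) \<le> real k" by (rule of_nat_mono)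
    moreover have "(2 :: real) ^ j = real (2 ^ j)" by simp
    ultimately show "2 ^ j \<le> real k + 1" by linarith
  qed auto
  also have "\<dots> = 1" by simp
  finally show ?case using Suc by simp
qed simp

text \<open>Cauchy--Schwarz against the harmonic sum. The factor \<open>j + 1\<close> measures the
  logarithm of the number of frequencies, which is how narrowly H^(1/2) misses the bounded
  functions.\<close>

lemma psum_sup_bound:
  assumes c: "h_summable c" and z: "cmod z = 1"
  shows "(cmod (psum c (2 ^ j) z))\<^sup>2 \<le> (real j + 1) * hsum c"
proof -
  let ?x = "\<lambda>k. 1 / sqrt (real k + 1)" and ?y = "\<lambda>k. sqrt (real k + 1) * cmod (c k)"
  have "cmod (psum c (2 ^ j) z) \<le> (\<Sum>k<2 ^ j. cmod (c k))"
    unfolding psum_def by (rule sum_norm_le) (simp add: norm_mult norm_power z)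
  also have "\<dots> = (\<Sum>k<2 ^ j. ?x k * ?y k)"
    by (rule sum.cong[OF refl]) simp
  finally have "(cmod (psum c (2 ^ j) z))\<^sup>2 \<le> (\<Sum>k<2 ^ j. ?x k * ?y k)\<^sup>2" by (intro power_mono) auto
  also have "\<dots> \<le> (\<Sum>k<2 ^ j. (?x k)\<^sup>2) * (\<Sum>k<2 ^ j. (?y k)\<^sup>2)" by (rule Cauchy_Schwarz_ineq_sum)
  also have "\<dots> \<le> (real j + 1) * hsum c"
  proof (rule mult_mono)
    show "(\<Sum>k<2 ^ j. (?x k)\<^sup>2) \<le> real j + 1" using harm_pow2_le[of j] by (simp add: power_divide)
    show "(\<Sum>k<2 ^ j. (?y k)\<^sup>2) \<le> hsum c"
      unfolding hsum_def using c by (simp add: power_mult_distrib) (intro sum_le_suminf, auto simp: h_summable_def)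
  qed (auto intro: sum_nonneg)
  finally show ?thesis .
qed

lemma tail_props:
  assumes u: "u \<in> plus_part H_half" and n: "0 < n"
  defines "v \<equiv> \<lambda>z. u z - psum (coef u) n z"
  shows "v \<in> plus_part H_half" "hsum (coef v) \<le> hsum (coef u)" "mass (coef v) \<le> hsum (coef u) / real n"
proof -
  note uL = plus_part_H_halfD[OF u]
  show v: "v \<in> plus_part H_half" unfolding v_def by (intro plus_part_H_half_diff u psum_H_half)
  have cv: "coef v = (\<lambda>k. if k < n then 0 else coef u k)"
    unfolding v_def by (simp add: coef_diff uL L2_psum coef_psum fun_eq_iff)
  show h: "hsum (coef v) \<le> hsum (coef u)"
    using uL(2) plus_part_H_halfD(2)[OF v] unfolding hsum_def h_summable_def
    by (intro suminf_le) (auto simp: cv)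
  have "mass (coef v) \<le> hsum (coef v) / real n"
    by (rule mass_le_tail[OF plus_part_H_halfD(2)[OF v] _ n]) (simp add: cv)
  also have "\<dots> \<le> hsum (coef u) / real n" using h by (intro divide_right_mono) auto
  finally show "mass (coef v) \<le> hsum (coef u) / real n" .
qed

lemma energy_le: "u \<in> plus_part H_half \<Longrightarrow> energy u \<le> 2 * mass (coef u) * hsum (coef u)"
  using energy_eq_mass_conv(2)[of u] mass_conv_le[OF plus_part_H_halfD(2)] by simp

lemma squares_product_integrable:
  assumes "a \<in> plus_part H_half" "w \<in> plus_part H_half"
  shows "integrable circle (\<lambda>z. (cmod (a z))\<^sup>2 * (cmod (w z))\<^sup>2)"
    "(LINT z|circle. (cmod (a z))\<^sup>2 * (cmod (w z))\<^sup>2) \<le> sqrt (energy a) * sqrt (energy w)"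
proof -
  have [measurable]: "a \<in> borel_measurable circle" "w \<in> borel_measurable circle"
    using assms plus_part_H_halfD(3) by (auto simp: L2_def)
  have m: "(\<lambda>z. (cmod (a z))\<^sup>2) \<in> borel_measurable circle" "(\<lambda>z. (cmod (w z))\<^sup>2) \<in> borel_measurable circle"
    by measurable
  have eq: "((cmod x)\<^sup>2)\<^sup>2 = cmod x ^ 4" for x by simp
  have i: "integrable circle (\<lambda>z. ((cmod (a z))\<^sup>2)\<^sup>2)" "integrable circle (\<lambda>z. ((cmod (w z))\<^sup>2)\<^sup>2)"
    unfolding eq using assms energy_eq_mass_conv(1) by blast+
  show "integrable circle (\<lambda>z. (cmod (a z))\<^sup>2 * (cmod (w z))\<^sup>2)"
    by (rule integrable_mult_of_squares[OF m i])
  show "(LINT z|circle. (cmod (a z))\<^sup>2 * (cmod (w z))\<^sup>2) \<le> sqrt (energy a) * sqrt (energy w)"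
    using integral_Cauchy_Schwarz[OF m i] unfolding eq energy_def by linarith
qed

text \<open>The substitute for the missing embedding of \<open>H\<^sup>1\<^sup>/\<^sup>2\<close> into \<open>L\<^sup>\<infinity>\<close>: frequencies below
  \<open>2\<^sup>j\<close> cost a factor linear in \<open>j\<close>, the others gain a factor exponentially small in \<open>j\<close>.\<close>

lemma quadratic_form_bound:
  assumes a: "a \<in> plus_part H_half" and w: "w \<in> plus_part H_half"
    and R: "hsum (coef a) \<le> R" and W: "hsum (coef w) \<le> W"
  shows "(LINT z|circle. (cmod (a z))\<^sup>2 * (cmod (w z))\<^sup>2)
    \<le> 2 * (real j + 1) * R * (L2_norm w)\<^sup>2 + 4 * R * W / sqrt (2 ^ j)"
proof -
  let ?s = "psum (coef a) (2 ^ j)"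
  define v where "v z = a z - ?s z" for z
  have v: "v \<in> plus_part H_half" "hsum (coef v) \<le> hsum (coef a)" "mass (coef v) \<le> hsum (coef a) / real (2 ^ j)"
    unfolding v_def[abs_def] by (rule tail_props[OF a], simp)+
  note hv0 = hsum_nonneg[OF plus_part_H_halfD(2)[OF v(1)]]
  have R0: "0 \<le> R" using hsum_nonneg[OF plus_part_H_halfD(2)[OF a]] R by linarith
  have W0: "0 \<le> W" using hsum_nonneg[OF plus_part_H_halfD(2)[OF w]] W by linarith
  note wL = plus_part_H_halfD(3)[OF w]
  have "(LINT z|circle. (cmod (a z))\<^sup>2 * (cmod (w z))\<^sup>2)
      \<le> (LINT z|circle. 2 * ((real j + 1) * R) * (cmod (w z))\<^sup>2 + 2 * ((cmod (v z))\<^sup>2 * (cmod (w z))\<^sup>2))"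
  proof (rule integral_mono)
    show "integrable circle (\<lambda>z. (cmod (a z))\<^sup>2 * (cmod (w z))\<^sup>2)" by (rule squares_product_integrable(1)[OF a w])
    show "integrable circle (\<lambda>z. 2 * ((real j + 1) * R) * (cmod (w z))\<^sup>2 + 2 * ((cmod (v z))\<^sup>2 * (cmod (w z))\<^sup>2))"
      using squares_product_integrable(1)[OF v(1) w] L2_integrable_square[OF wL] by simp
    fix z assume "z \<in> space circle"
    then have z: "cmod z = 1" by simp
    have "(cmod (a z))\<^sup>2 \<le> (cmod (?s z) + cmod (v z))\<^sup>2"
      using norm_triangle_ineq[of "?s z" "v z"] by (intro power_mono) (auto simp: v_def)
    also have "\<dots> \<le> 2 * (cmod (?s z))\<^sup>2 + 2 * (cmod (v z))\<^sup>2"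
      using sum_squares_bound[of "cmod (?s z)" "cmod (v z)"] by (simp add: power2_sum)
    also have "(cmod (?s z))\<^sup>2 \<le> (real j + 1) * hsum (coef a)"
      by (rule psum_sup_bound[OF plus_part_H_halfD(2)[OF a] z])
    also have "(real j + 1) * hsum (coef a) \<le> (real j + 1) * R" using R by (intro mult_left_mono) auto
    finally have "(cmod (a z))\<^sup>2 * (cmod (w z))\<^sup>2 \<le> (2 * ((real j + 1) * R) + 2 * (cmod (v z))\<^sup>2) * (cmod (w z))\<^sup>2"
      by (intro mult_right_mono) auto
    then show "(cmod (a z))\<^sup>2 * (cmod (w z))\<^sup>2
      \<le> 2 * ((real j + 1) * R) * (cmod (w z))\<^sup>2 + 2 * ((cmod (v z))\<^sup>2 * (cmod (w z))\<^sup>2)"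
      by (simp add: algebra_simps)
  qed
  also have "\<dots> = 2 * ((real j + 1) * R) * (L2_norm w)\<^sup>2 + 2 * (LINT z|circle. (cmod (v z))\<^sup>2 * (cmod (w z))\<^sup>2)"
    using squares_product_integrable(1)[OF v(1) w] L2_integrable_square[OF wL] by (simp add: L2_norm_square)
  also have "(LINT z|circle. (cmod (v z))\<^sup>2 * (cmod (w z))\<^sup>2) \<le> sqrt (energy v) * sqrt (energy w)"
    by (rule squares_product_integrable(2)[OF v(1) w])
  \<comment> \<open>The L4 inequality \<open>energy_le\<close> keeps a factor of the mass, and the
    tail \<open>v\<close> has mass at most \<open>R / 2 ^ j\<close>; its square root is the
    gain.\<close>
  also have "sqrt (energy v) * sqrt (energy w) \<le> sqrt (2 * (R / 2 ^ j) * R) * sqrt (2 * W * W)"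
  proof (intro mult_mono real_sqrt_le_mono)
    have "energy v \<le> 2 * mass (coef v) * hsum (coef v)" by (rule energy_le[OF v(1)])
    also have "\<dots> \<le> 2 * (R / 2 ^ j) * R"
    proof -
      have "mass (coef v) \<le> R / 2 ^ j" using v(3) divide_right_mono[OF R, of "2 ^ j"] by simp
      then show ?thesis
        using v(2) R hv0 R0 mass_nonneg[OF h_summable_imp_l2_summable[OF plus_part_H_halfD(2)[OF v(1)]]]
        by (intro mult_mono) auto
    qed
    finally show "energy v \<le> 2 * (R / 2 ^ j) * R" .
    have "energy w \<le> 2 * mass (coef w) * hsum (coef w)" by (rule energy_le[OF w])
    also have "\<dots> \<le> 2 * W * W"
      using W mass_le_hsum[OF plus_part_H_halfD(2)[OF w]] hsum_nonneg[OF plus_part_H_halfD(2)[OF w]] W0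
        mass_nonneg[OF h_summable_imp_l2_summable[OF plus_part_H_halfD(2)[OF w]]]
      by (intro mult_mono) auto
    finally show "energy w \<le> 2 * W * W" .
  qed (use R0 in \<open>auto simp: energy_def\<close>)
  also have "sqrt (2 * (R / 2 ^ j) * R) * sqrt (2 * W * W) = 2 * R * W / sqrt (2 ^ j)"
  proof -
    have "sqrt (2 * (R / 2 ^ j) * R) * sqrt (2 * W * W) = sqrt ((2 * R * W)\<^sup>2 / 2 ^ j)"
      unfolding real_sqrt_mult[symmetric] by (simp add: power2_eq_square)
    then show ?thesis using R0 W0 by (simp add: real_sqrt_divide)
  qed
  finally show ?thesis by (simp add: algebra_simps)
qed

section \<open>Differences of the nonlinearity paired with differences\<close>

lemma cubic_diff_norm:
  "cmod (cubic u z - cubic v z) \<le> 3 / 2 * ((cmod (u z))\<^sup>2 + (cmod (v z))\<^sup>2) * cmod (u z - v z)"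
proof -
  let ?a = "cmod (u z)" and ?b = "cmod (v z)" and ?d = "cmod (u z - v z)"
  have "cubic u z - cubic v z = of_real (?a\<^sup>2) * (u z - v z) + of_real (?a\<^sup>2 - ?b\<^sup>2) * v z"
    by (simp add: cubic_def algebra_simps)
  then have "cmod (cubic u z - cubic v z) \<le> cmod (of_real (?a\<^sup>2) * (u z - v z)) + cmod (of_real (?a\<^sup>2 - ?b\<^sup>2) * v z)"
    by (simp only: norm_triangle_ineq)
  also have "\<dots> = ?a\<^sup>2 * ?d + \<bar>?a\<^sup>2 - ?b\<^sup>2\<bar> * ?b"
    by (simp only: norm_mult norm_of_real abs_power2)
  also have "\<bar>?a\<^sup>2 - ?b\<^sup>2\<bar> = \<bar>?a - ?b\<bar> * (?a + ?b)"
    by (simp add: square_diff_square_factored power2_eq_square abs_mult)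
  also have "\<bar>?a - ?b\<bar> * (?a + ?b) * ?b \<le> ?d * (?a + ?b) * ?b"
    by (intro mult_right_mono norm_triangle_ineq3) auto
  also have "?a\<^sup>2 * ?d + ?d * (?a + ?b) * ?b = (?a\<^sup>2 + ?a * ?b + ?b\<^sup>2) * ?d"
    by (simp add: algebra_simps power2_eq_square)
  also have "\<dots> \<le> 3 / 2 * (?a\<^sup>2 + ?b\<^sup>2) * ?d"
    using sum_squares_bound[of ?a ?b] by (intro mult_right_mono) (auto simp: algebra_simps)
  finally show ?thesis by simp
qed

text \<open>The pairing reduces to two quadratic forms in the difference, with potentials given by
  \<open>u\<close> and \<open>v\<close>. The triangle inequality bounds \<open>hsum\<close> of the
  difference by \<open>4 * R\<close>, whence 48 = 3/2 * 2 * 16; likewise 6 = 3/2 * 2 * 2.\<close>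

lemma cubic_diff_inner_bound:
  assumes u: "u \<in> plus_part H_half" and v: "v \<in> plus_part H_half"
    and R: "hsum (coef u) \<le> R" "hsum (coef v) \<le> R"
  shows "cmod (L2_inner (\<lambda>z. cubic u z - cubic v z) (\<lambda>z. u z - v z))
    \<le> 6 * (real j + 1) * R * (L2_norm (\<lambda>z. u z - v z))\<^sup>2 + 48 * R\<^sup>2 / sqrt (2 ^ j)"
proof -
  define w where "w z = u z - v z" for z
  have w: "w \<in> plus_part H_half" unfolding w_def[abs_def] by (intro plus_part_H_half_diff u v)
  have R0: "0 \<le> R" using hsum_nonneg[OF plus_part_H_halfD(2)[OF u]] R by linarith
  have W: "hsum (coef w) \<le> 4 * R"
  proof -
    have cw: "coef w = (\<lambda>k. coef u k + - coef v k)"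
      unfolding w_def[abs_def] by (simp add: coef_diff plus_part_H_halfD(3) u v)
    have neg: "h_summable (\<lambda>k. - coef v k)" "hsum (\<lambda>k. - coef v k) = hsum (coef v)"
      using plus_part_H_halfD(2)[OF v] by (simp_all add: h_summable_def hsum_def)
    have "sqrt (hsum (coef w)) \<le> sqrt (hsum (coef u)) + sqrt (hsum (coef v))"
      unfolding cw using hsum_add_sqrt[OF plus_part_H_halfD(2)[OF u] neg(1)] neg(2) by simp
    also have "\<dots> \<le> 2 * sqrt R" using real_sqrt_le_mono[OF R(1)] real_sqrt_le_mono[OF R(2)] by linarith
    finally have "(sqrt (hsum (coef w)))\<^sup>2 \<le> (2 * sqrt R)\<^sup>2"
      using hsum_nonneg[OF plus_part_H_halfD(2)[OF w]] by (intro power_mono) auto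
    then show ?thesis
      using R0 hsum_nonneg[OF plus_part_H_halfD(2)[OF w]] by (simp add: power_mult_distrib)
  qed
  note iu = squares_product_integrable(1)[OF u w] and iv = squares_product_integrable(1)[OF v w]
  have cL: "(\<lambda>z. cubic u z - cubic v z) \<in> L2" by (intro L2_diff cubic_L2 u v)
  note wL = plus_part_H_halfD(3)[OF w]
  have "cmod (L2_inner (\<lambda>z. cubic u z - cubic v z) w)
      \<le> (LINT z|circle. cmod ((cubic u z - cubic v z) * cnj (w z)))"
    unfolding L2_inner_def by (rule integral_norm_bound)
  also have "\<dots> \<le> (LINT z|circle. 3 / 2 * ((cmod (u z))\<^sup>2 * (cmod (w z))\<^sup>2 + (cmod (v z))\<^sup>2 * (cmod (w z))\<^sup>2))"
  proof (rule integral_mono)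
    show "integrable circle (\<lambda>z. cmod ((cubic u z - cubic v z) * cnj (w z)))"
      by (intro integrable_norm L2_integrable_inner cL wL)
    show "integrable circle (\<lambda>z. 3 / 2 * ((cmod (u z))\<^sup>2 * (cmod (w z))\<^sup>2 + (cmod (v z))\<^sup>2 * (cmod (w z))\<^sup>2))"
      using iu iv by simp
    fix z
    have "cmod ((cubic u z - cubic v z) * cnj (w z)) = cmod (cubic u z - cubic v z) * cmod (w z)"
      by (simp add: norm_mult)
    also have "\<dots> \<le> 3 / 2 * ((cmod (u z))\<^sup>2 + (cmod (v z))\<^sup>2) * cmod (w z) * cmod (w z)"
      using cubic_diff_norm[of u z v] by (intro mult_right_mono) (auto simp: w_def)
    finally show "cmod ((cubic u z - cubic v z) * cnj (w z))
      \<le> 3 / 2 * ((cmod (u z))\<^sup>2 * (cmod (w z))\<^sup>2 + (cmod (v z))\<^sup>2 * (cmod (w z))\<^sup>2)"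
      by (simp add: power2_eq_square algebra_simps)
  qed
  also have "\<dots> = 3 / 2 * ((LINT z|circle. (cmod (u z))\<^sup>2 * (cmod (w z))\<^sup>2) + (LINT z|circle. (cmod (v z))\<^sup>2 * (cmod (w z))\<^sup>2))"
    using iu iv by simp
  also have "\<dots> \<le> 3 / 2 * ((2 * (real j + 1) * R * (L2_norm w)\<^sup>2 + 4 * R * (4 * R) / sqrt (2 ^ j))
      + (2 * (real j + 1) * R * (L2_norm w)\<^sup>2 + 4 * R * (4 * R) / sqrt (2 ^ j)))"
    by (intro mult_left_mono add_mono quadratic_form_bound u v w R W) auto
  also have "\<dots> = 6 * (real j + 1) * R * (L2_norm w)\<^sup>2 + 48 * R\<^sup>2 / sqrt (2 ^ j)"
    by (simp add: algebra_simps power2_eq_square)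
  finally show ?thesis unfolding w_def[abs_def] .
qed

text \<open>With \<open>v = psum c N\<close>, the cubic term times \<open>z powi (- k)\<close> is
  \<open>v z * v z\<close> times the conjugate of \<open>v z * z powi k\<close>. The coefficient is
  thus a pairing of the convolution square with a shifted copy of \<open>c\<close>.\<close>

lemma fourier_cubic_psum:
  assumes c: "\<And>k. N \<le> k \<Longrightarrow> c k = 0" and k: "k < N"
  shows "fourier (cubic (psum c N)) (int k) = cubic_coef N c k"
proof -
  let ?v = "psum c N"
  let ?g = "\<lambda>z. ?v z * z powi (int k)"
  have gL: "?g \<in> L2" by (intro continuous_L2 continuous_intros)
  have fg: "fourier ?g (int n) = (if k \<le> n \<and> n < k + N then c (n - k) else 0)" for n
  proof -
    have "fourier ?g (int n) = fourier ?v (int n - int k)"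
      unfolding fourier_def
    proof (rule Bochner_Integration.integral_cong[OF refl])
      fix z assume "z \<in> space circle"
      then have "z \<noteq> 0" by auto
      then have "z powi (int k + - int n) = z powi (int k) * z powi (- int n)"
        by (intro power_int_add) simp
      moreover have "- (int n - int k) = int k + - int n" by simp
      ultimately have "z powi (- (int n - int k)) = z powi (int k) * z powi (- int n)" by (simp only:)
      then show "?g z * z powi (- int n) = ?v z * z powi (- (int n - int k))"
        by (simp only: mult.assoc)
    qed
    then show ?thesis by (auto simp: fourier_psum of_nat_diff nat_diff_distrib)
  qed
  have "fourier (cubic ?v) (int k) = L2_inner (psum (conv c c) (N + N)) ?g"
    unfolding fourier_def L2_inner_def
  proof (rule Bochner_Integration.integral_cong[OF refl])
    fix z assume "z \<in> space circle"
    then have "cnj (z powi int k) = z powi (- int k)" by (intro cnj_powi_sphere) simp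
    moreover have "psum (conv c c) (N + N) z = ?v z * ?v z" using psum_mult[of N c N c z] c by simp
    ultimately show "cubic ?v z * z powi (- int k) = psum (conv c c) (N + N) z * cnj (?g z)"
      by (simp only: cubic_def complex_norm_square complex_cnj_mult mult_ac)
  qed
  also have "\<dots> = (\<Sum>n<N + N. conv c c n * cnj (fourier ?g (int n)))"
    unfolding psum_eq_trig_sum[of "conv c c"]
    by (subst L2_inner_trig_sum_left[OF gL]) (simp add: sum.reindex)
  also have "\<dots> = (\<Sum>n\<in>(\<lambda>m. k + m) ` {..<N}. conv c c n * cnj (c (n - k)))"
  proof (rule sum.mono_neutral_cong_right)
    show "\<forall>i\<in>{..<N + N} - (\<lambda>m. k + m) ` {..<N}. conv c c i * cnj (fourier ?g (int i)) = 0"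
    proof
      fix i assume i: "i \<in> {..<N + N} - (\<lambda>m. k + m) ` {..<N}"
      have "\<not> (k \<le> i \<and> i < k + N)"
      proof
        assume "k \<le> i \<and> i < k + N"
        then have "i = k + (i - k)" "i - k < N" by auto
        then show False using i by blast
      qed
      then show "conv c c i * cnj (fourier ?g (int i)) = 0" unfolding fg by auto
    qed
    show "conv c c i * cnj (fourier ?g (int i)) = conv c c i * cnj (c (i - k))"
      if "i \<in> (\<lambda>m. k + m) ` {..<N}" for i
      unfolding fg using that by auto
  qed (use k in auto)
  also have "\<dots> = cubic_coef N c k"
    by (simp add: sum.reindex cubic_coef_def)
  finally show ?thesis .
qed

section \<open>Comparison of the flow with its truncations\<close>

lemma psum_has_L2_derivative:
  assumes "\<And>k. k < N \<Longrightarrow> ((\<lambda>s. x s k) has_vector_derivative x' k) (at t)"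
  shows "has_L2_derivative (\<lambda>s. psum (x s) N) (psum x' N) t"
proof -
  have "((\<lambda>h. L2_norm (psum (\<lambda>k. (x (t + h) k - x t k) / of_real h - x' k) N)) \<longlongrightarrow> 0) (at 0)"
  proof -
    have "((\<lambda>h. (\<Sum>k<N. (cmod ((x (t + h) k - x t k) / of_real h - x' k))\<^sup>2)) \<longlongrightarrow> (\<Sum>k<N. 0)) (at 0)"
    proof (rule tendsto_sum)
      fix k assume "k \<in> {..<N}"
      then have "((\<lambda>h. norm ((x (t + h) k - x t k) - h *\<^sub>R x' k) / \<bar>h\<bar>) \<longlongrightarrow> 0) (at 0)"
        using assms[of k] unfolding has_vector_derivative_def has_derivative_at by simp
      then have "((\<lambda>h. (norm ((x (t + h) k - x t k) - h *\<^sub>R x' k) / \<bar>h\<bar>)\<^sup>2) \<longlongrightarrow> 0\<^sup>2) (at 0)"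
        by (intro tendsto_intros)
      moreover have "norm ((x (t + h) k - x t k) - h *\<^sub>R x' k) / \<bar>h\<bar> = cmod ((x (t + h) k - x t k) / of_real h - x' k)"
        if "h \<noteq> 0" for h
      proof -
        have "(x (t + h) k - x t k) / of_real h - x' k = ((x (t + h) k - x t k) - h *\<^sub>R x' k) / of_real h"
          using that by (simp add: scaleR_conv_of_real field_simps)
        then show ?thesis by (simp add: norm_divide)
      qed
      ultimately show "((\<lambda>h. (cmod ((x (t + h) k - x t k) / of_real h - x' k))\<^sup>2) \<longlongrightarrow> 0) (at 0)"
        by (subst tendsto_cong[where g = "\<lambda>h. (norm ((x (t + h) k - x t k) - h *\<^sub>R x' k) / \<bar>h\<bar>)\<^sup>2"])
          (simp_all add: eventually_at_filter)
    qed
    then have "((\<lambda>h. (L2_norm (psum (\<lambda>k. (x (t + h) k - x t k) / of_real h - x' k) N))\<^sup>2) \<longlongrightarrow> 0) (at 0)"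
      by (simp add: L2_norm_psum)
    from tendsto_real_sqrt[OF this] show ?thesis by simp
  qed
  moreover have "psum (\<lambda>k. (x (t + h) k - x t k) / of_real h - x' k) N
      = (\<lambda>z. (psum (x (t + h)) N z - psum (x t) N z) / of_real h - psum x' N z)" for h
    unfolding psum_def
    by (simp add: fun_eq_iff left_diff_distrib sum_subtractf sum_divide_distrib diff_divide_distrib)
  ultimately show ?thesis by (simp add: has_L2_derivative_def L2_psum)
qed

text \<open>Both signs are needed: the argument for the momentum shows only that it does not
  increase in the direction in which the flow is followed.\<close>

lemma solution_derivative_reparam:
  assumes u: "szego_solution u" and \<sigma>: "\<sigma> = 1 \<or> \<sigma> = - 1"
  shows "has_L2_derivative (\<lambda>s. u (t + \<sigma> * s)) (\<lambda>z. - \<i> * of_real \<sigma> * szego_proj (cubic (u (t + \<sigma> * s))) z) s"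
proof -
  define t' where "t' = t + \<sigma> * s"
  define g where "g = szego_proj (cubic (u t'))"
  have d: "has_L2_derivative u (\<lambda>z. - \<i> * g z) t'"
    using solution_derivative[OF u, of t'] by (simp add: g_def)
  then have L: "\<forall>s. u s \<in> L2" "(\<lambda>z. - \<i> * g z) \<in> L2"
    and lim: "((\<lambda>h. L2_norm (\<lambda>z. (u (t' + h) z - u t' z) / of_real h - (- \<i> * g z))) \<longlongrightarrow> 0) (at 0)"
    by (auto simp: has_L2_derivative_def)
  have "filterlim (\<lambda>h. \<sigma> * h) (at 0) (at 0)"
    unfolding filterlim_at using \<sigma> by (auto simp: eventually_at_filter intro!: tendsto_eq_intros)
  from filterlim_compose[OF lim this]
  have "((\<lambda>h. L2_norm (\<lambda>z. (u (t' + \<sigma> * h) z - u t' z) / of_real (\<sigma> * h) - (- \<i> * g z))) \<longlongrightarrow> 0) (at 0)" .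
  moreover have "L2_norm (\<lambda>z. (u (t' + \<sigma> * h) z - u t' z) / of_real (\<sigma> * h) - (- \<i> * g z))
      = L2_norm (\<lambda>z. (u (t' + \<sigma> * h) z - u t' z) / of_real h - (- \<i> * of_real \<sigma> * g z))" for h
  proof -
    have "(u (t' + \<sigma> * h) z - u t' z) / of_real h - (- \<i> * of_real \<sigma> * g z)
        = of_real \<sigma> * ((u (t' + \<sigma> * h) z - u t' z) / of_real (\<sigma> * h) - (- \<i> * g z))" for z
      using \<sigma> by (elim disjE) simp_all
    then show ?thesis using \<sigma> by (simp only: L2_norm_cmult norm_of_real) auto
  qed
  ultimately have "((\<lambda>h. L2_norm (\<lambda>z. (u (t' + \<sigma> * h) z - u t' z) / of_real h - (- \<i> * of_real \<sigma> * g z))) \<longlongrightarrow> 0) (at 0)"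
    by (simp only:)
  moreover have "t + \<sigma> * (s + h) = t' + \<sigma> * h" for h by (simp add: t'_def algebra_simps)
  moreover have "(\<lambda>z. - \<i> * of_real \<sigma> * g z) \<in> L2"
    using L2_cmult[OF L(2), of "of_real \<sigma>"] by (simp add: mult_ac)
  ultimately show ?thesis
    using L(1) unfolding has_L2_derivative_def g_def[symmetric] t'_def[symmetric] by (simp only:) simp
qed

lemma cmod_coef_le_hsum: "h_summable c \<Longrightarrow> (cmod (c k))\<^sup>2 \<le> hsum c"
proof -
  assume c: "h_summable c"
  have "(cmod (c k))\<^sup>2 \<le> (real k + 1) * (cmod (c k))\<^sup>2" by (simp add: algebra_simps)
  also have "\<dots> \<le> (\<Sum>n\<in>{k}. (real n + 1) * (cmod (c n))\<^sup>2)" by simp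
  also have "\<dots> \<le> hsum c"
    unfolding hsum_def using c by (intro sum_le_suminf) (auto simp: h_summable_def)
  finally show ?thesis .
qed

lemma solution_coef_continuous:
  assumes u: "szego_solution u"
  shows "continuous_on S (\<lambda>t. coef (u t) k)"
proof -
  note H = solution_plus[OF u]
  have "isCont (\<lambda>t. coef (u t) k) t" for t
  proof -
    have "((\<lambda>h. sqrt (hsum (coef (\<lambda>z. u (t + h) z - u t z)))) \<longlongrightarrow> sqrt 0) (at 0)"
      by (intro tendsto_intros solution_continuous[OF u])
    then have lim: "((\<lambda>h. sqrt (hsum (coef (\<lambda>z. u (t + h) z - u t z)))) \<longlongrightarrow> 0) (at 0)" by simp
    have "((\<lambda>h. coef (u (t + h)) k - coef (u t) k) \<longlongrightarrow> 0) (at 0)"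
    proof (rule Lim_null_comparison[OF _ lim])
      show "\<forall>\<^sub>F h in at 0. norm (coef (u (t + h)) k - coef (u t) k) \<le> sqrt (hsum (coef (\<lambda>z. u (t + h) z - u t z)))"
      proof (intro always_eventually allI real_le_rsqrt)
        fix h
        have d: "(\<lambda>z. u (t + h) z - u t z) \<in> plus_part H_half" by (intro plus_part_H_half_diff H)
        show "(norm (coef (u (t + h)) k - coef (u t) k))\<^sup>2 \<le> hsum (coef (\<lambda>z. u (t + h) z - u t z))"
          using cmod_coef_le_hsum[OF plus_part_H_halfD(2)[OF d], of k]
          by (simp add: coef_diff plus_part_H_halfD(3)[OF H])
      qed
    qed
    then have "((\<lambda>h. coef (u (t + h)) k) \<longlongrightarrow> coef (u t) k) (at 0)" by (rule LIM_zero_cancel)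
    then show ?thesis unfolding isCont_def using LIM_offset_zero_iff[of t "\<lambda>t. coef (u t) k"] by simp
  qed
  then show ?thesis by (simp add: continuous_at_imp_continuous_on)
qed

text \<open>With \<open>w\<close> the error and \<open>P\<close> the truncation to frequencies below
  \<open>N\<close>, the derivative of the squared error splits into the pairing of a difference of
  cubic terms with \<open>w\<close>, which carries the logarithmic loss, and the pairing of one
  cubic term with \<open>w - P w\<close>, which is small like the root of \<open>1 / N\<close>. One
  \<open>X\<close> has to serve all \<open>j\<close>, because \<open>j\<close> is chosen only
  afterwards to balance loss and gain.\<close>

lemma Galerkin_error:
  assumes u: "szego_solution u" and \<sigma>: "\<sigma> = 1 \<or> \<sigma> = - 1" and T: "0 \<le> T" and N: "0 < N"
    and R: "\<And>s. s \<in> {0..T} \<Longrightarrow> hsum (coef (u (t + \<sigma> * s))) \<le> R"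
  shows "\<exists>X. (\<Sum>k<N. real k * (cmod (X k))\<^sup>2) = (\<Sum>k<N. real k * (cmod (coef (u t) k))\<^sup>2) \<and>
    (\<forall>j. (L2_norm (\<lambda>z. u (t + \<sigma> * T) z - psum X N z))\<^sup>2
      \<le> (R / real N + (2 * (2 * zeta32 * sqrt (R ^ 3) * sqrt (R / real N)) + 96 * R\<^sup>2 / sqrt (2 ^ j)) * T)
        * exp (12 * (real j + 1) * R * T))"
proof -
  note H = solution_plus[OF u]
  note hs = plus_part_H_halfD(2)[OF H]
  define y where "y s = u (t + \<sigma> * s)" for s
  have yH: "y s \<in> plus_part H_half" for s unfolding y_def by (rule H)
  note yL = plus_part_H_halfD(3)[OF yH]
  have R0: "0 \<le> R" using R[of 0] hsum_nonneg[OF hs[of t]] T by simp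
  obtain x where x0: "\<And>k. x 0 k = (if k < N then coef (u t) k else 0)"
    and xN: "\<And>s k. s \<in> {0..T} \<Longrightarrow> N \<le> k \<Longrightarrow> x s k = 0"
    and x': "\<And>s k. s \<in> {0..T} \<Longrightarrow> k < N \<Longrightarrow>
      ((\<lambda>s. x s k) has_vector_derivative - \<i> * of_real \<sigma> * cubic_coef N (x s) k) (at s within {0..T})"
    and xmass: "\<And>s. s \<in> {0..T} \<Longrightarrow> (\<Sum>k<N. (cmod (x s k))\<^sup>2) = (\<Sum>k<N. (cmod (coef (u t) k))\<^sup>2)"
    and xmom: "\<And>s. s \<in> {0..T} \<Longrightarrow> (\<Sum>k<N. real k * (cmod (x s k))\<^sup>2) = (\<Sum>k<N. real k * (cmod (coef (u t) k))\<^sup>2)"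
    using Galerkin_exists[OF T, where ?N = N and ?c0.0 = "coef (u t)" and \<sigma> = \<sigma>] by blast
  define v where "v s = psum (x s) N" for s
  have vH: "v s \<in> plus_part H_half" for s unfolding v_def by (rule psum_H_half)
  have cv: "coef (v s) = x s" if "s \<in> {0..T}" for s
    using xN[OF that] by (auto simp: v_def coef_psum fun_eq_iff)
  \<comment> \<open>The truncated system conserves mass and momentum, so the H^(1/2) norm remains
    that of the truncated initial value.\<close>
  have Rv: "hsum (coef (v s)) \<le> R" if s: "s \<in> {0..T}" for s
  proof -
    have "hsum (x s) = (\<Sum>k<N. (real k + 1) * (cmod (x s k))\<^sup>2)"
      unfolding hsum_def by (rule suminf_finite) (use xN[OF s] in auto)
    also have "\<dots> = (\<Sum>k<N. (real k + 1) * (cmod (coef (u t) k))\<^sup>2)"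
      using xmass[OF s] xmom[OF s] by (simp add: distrib_right sum.distrib)
    also have "\<dots> \<le> hsum (coef (u t))"
      unfolding hsum_def using hs[of t] by (intro sum_le_suminf) (auto simp: h_summable_def)
    also have "\<dots> \<le> R" using R[of 0] T by simp
    finally show ?thesis by (simp add: cv[OF s])
  qed
  define f where "f s = (L2_norm (\<lambda>z. y s z - v s z))\<^sup>2" for s
  \<comment> \<open>Conservation of mass expresses the error through finitely many coefficients,
    from which continuity up to the endpoints follows.\<close>
  have f_eq: "f s = mass (coef (u t)) - (\<Sum>k<N. (cmod (coef (y s) k))\<^sup>2) + (\<Sum>k<N. (cmod (coef (y s) k - x s k))\<^sup>2)" for s
  proof -
    have "(L2_norm (y s))\<^sup>2 = mass (coef (u t))"
      using L2_norm_mass(2)[OF plus_part_H_halfD(1)[OF yH[of s]]] solution_mass_const[OF u] by (simp add: y_def)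
    then show ?thesis unfolding f_def v_def by (simp add: L2_norm_diff_psum[OF yL] coef_def)
  qed
  have contf: "continuous_on {0..T} f"
  proof -
    have "continuous_on {0..T} (\<lambda>s. coef (y s) k)" for k
      unfolding y_def
      by (rule continuous_on_compose2[OF solution_coef_continuous[OF u, of UNIV]]) (auto intro!: continuous_intros)
    moreover have "continuous_on {0..T} (\<lambda>s. x s k)" if "k < N" for k
      using x'[OF _ that] has_vector_derivative_continuous continuous_on_eq_continuous_within by blast
    ultimately show ?thesis unfolding f_eq[abs_def] by (intro continuous_intros) auto
  qed
  have f0: "f 0 \<le> R / real N"
  proof -
    have "v 0 = psum (coef (y 0)) N" unfolding v_def by (rule psum_cong) (simp add: x0 y_def)
    then have "f 0 = (L2_norm (\<lambda>z. y 0 z - psum (coef (y 0)) N z))\<^sup>2" by (simp add: f_def)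
    also have "\<dots> = mass (coef (\<lambda>z. y 0 z - psum (coef (y 0)) N z))"
      by (rule L2_norm_mass(2)[OF plus_part_H_halfD(1)[OF tail_props(1)[OF yH N]]])
    also have "\<dots> \<le> hsum (coef (y 0)) / real N" by (rule tail_props(3)[OF yH N])
    also have "\<dots> \<le> R / real N" using R[of 0] T by (intro divide_right_mono) (auto simp: y_def)
    finally show ?thesis .
  qed
  define B where "B j = 2 * (2 * zeta32 * sqrt (R ^ 3) * sqrt (R / real N)) + 96 * R\<^sup>2 / sqrt (2 ^ j)" for j :: nat
  have deriv: "\<exists>d. (f has_real_derivative d) (at s) \<and> d \<le> 12 * (real j + 1) * R * f s + B j"
    if s: "0 < s" "s < T" for s j
  proof -
    have sT: "s \<in> {0..T}" using s by simp
    have at_s: "at s within {0..T} = at s" using s by (intro at_within_interior) simp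
    let ?g = "szego_proj (cubic (y s))" and ?B = "cubic_coef N (x s)"
    let ?w = "\<lambda>z. y s z - v s z"
    have wH: "?w \<in> plus_part H_half" by (intro plus_part_H_half_diff yH vH)
    note wL = plus_part_H_halfD(3)[OF wH] and wP = plus_part_H_halfD(1)[OF wH]
    have cy: "cubic (y s) \<in> L2" and cvL: "cubic (v s) \<in> L2" by (intro cubic_L2 yH vH)+
    have dy: "has_L2_derivative y (\<lambda>z. - \<i> * of_real \<sigma> * ?g z) s"
      unfolding y_def[abs_def] by (rule solution_derivative_reparam[OF u \<sigma>])
    have dv: "has_L2_derivative v (psum (\<lambda>k. - \<i> * of_real \<sigma> * ?B k) N) s"
      unfolding v_def[abs_def] by (rule psum_has_L2_derivative) (use x'[OF sT] at_s in simp)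
    have psum_scale: "psum (\<lambda>k. - \<i> * of_real \<sigma> * ?B k) N = (\<lambda>z. - \<i> * of_real \<sigma> * psum ?B N z)"
      by (simp add: psum_def sum_distrib_left fun_eq_iff mult.assoc)
    let ?w' = "\<lambda>z. - \<i> * of_real \<sigma> * ?g z - psum (\<lambda>k. - \<i> * of_real \<sigma> * ?B k) N z"
    have df: "(f has_real_derivative 2 * Re (L2_inner ?w' ?w)) (at s)"
      unfolding f_def[abs_def] by (rule has_L2_derivative_norm_square[OF has_L2_derivative_diff[OF dy dv]])
    let ?P = "psum (coef ?w) N"
    have gL: "?g \<in> L2" by (rule plus_part_L2D(1)[OF szego_proj_plus_part[OF cy]])
    \<comment> \<open>The truncation of the nonlinearity is moved onto the other argument.\<close>
    have PB: "L2_inner (psum ?B N) ?w = L2_inner (cubic (v s)) ?P"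
    proof -
      have "L2_inner (psum ?B N) ?w = (\<Sum>k<N. ?B k * cnj (coef ?w k))"
        unfolding psum_eq_trig_sum by (subst L2_inner_trig_sum_left[OF wL]) (simp add: sum.reindex coef_def)
      also have "\<dots> = (\<Sum>k<N. cnj (coef ?w k * cnj (fourier (cubic (v s)) (int k))))"
        using fourier_cubic_psum[of N "x s"] xN[OF sT] by (intro sum.cong refl) (simp add: v_def mult.commute)
      also have "\<dots> = cnj (L2_inner ?P (cubic (v s)))"
        unfolding psum_eq_trig_sum by (subst L2_inner_trig_sum_left[OF cvL]) (simp add: sum.reindex)
      also have "\<dots> = L2_inner (cubic (v s)) ?P" by (rule L2_inner_commute[symmetric])
      finally show ?thesis .
    qed
    have "L2_inner ?w' ?w = - \<i> * of_real \<sigma> * (L2_inner ?g ?w - L2_inner (psum ?B N) ?w)"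
    proof -
      have "?w' = (\<lambda>z. (- \<i> * of_real \<sigma>) * (?g z - psum ?B N z))"
        unfolding psum_scale by (simp add: fun_eq_iff algebra_simps)
      then show ?thesis
        using L2_inner_cmult_left[of "- \<i> * of_real \<sigma>" "\<lambda>z. ?g z - psum ?B N z" ?w]
        by (simp only: L2_inner_diff_left[OF gL L2_psum wL])
    qed
    also have "L2_inner ?g ?w - L2_inner (psum ?B N) ?w
        = L2_inner (\<lambda>z. cubic (y s) z - cubic (v s) z) ?w + L2_inner (cubic (v s)) (\<lambda>z. ?w z - ?P z)"
      unfolding szego_proj_inner[OF cy wP] PB
      by (simp only: L2_inner_diff_left[OF cy cvL wL] L2_inner_diff_right[OF wL L2_psum cvL]) simp
    finally have inner: "L2_inner ?w' ?w = - \<i> * of_real \<sigma> *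
      (L2_inner (\<lambda>z. cubic (y s) z - cubic (v s) z) ?w + L2_inner (cubic (v s)) (\<lambda>z. ?w z - ?P z))" .
    have "Re (L2_inner ?w' ?w) \<le> cmod (L2_inner ?w' ?w)" by (rule complex_Re_le_cmod)
    also have "\<dots> = cmod (L2_inner (\<lambda>z. cubic (y s) z - cubic (v s) z) ?w + L2_inner (cubic (v s)) (\<lambda>z. ?w z - ?P z))"
      unfolding inner using \<sigma> by (auto simp: norm_mult)
    also have "\<dots> \<le> cmod (L2_inner (\<lambda>z. cubic (y s) z - cubic (v s) z) ?w) + cmod (L2_inner (cubic (v s)) (\<lambda>z. ?w z - ?P z))"
      by (rule norm_triangle_ineq)
    finally have 1: "Re (L2_inner ?w' ?w) \<le>
      cmod (L2_inner (\<lambda>z. cubic (y s) z - cubic (v s) z) ?w) + cmod (L2_inner (cubic (v s)) (\<lambda>z. ?w z - ?P z))" .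
    have 2: "cmod (L2_inner (\<lambda>z. cubic (y s) z - cubic (v s) z) ?w) \<le> 6 * (real j + 1) * R * f s + 48 * R\<^sup>2 / sqrt (2 ^ j)"
      unfolding f_def by (rule cubic_diff_inner_bound[OF yH vH]) (use R[OF sT] Rv[OF sT] in \<open>auto simp: y_def\<close>)
    have 3: "cmod (L2_inner (cubic (v s)) (\<lambda>z. ?w z - ?P z)) \<le> 2 * zeta32 * sqrt (R ^ 3) * sqrt (R / real N)"
    proof -
      have "cmod (L2_inner (cubic (v s)) (\<lambda>z. ?w z - ?P z)) \<le> L2_norm (cubic (v s)) * L2_norm (\<lambda>z. ?w z - ?P z)"
        by (intro L2_Cauchy_Schwarz cvL L2_diff wL L2_psum)
      also have "\<dots> \<le> (2 * zeta32 * sqrt (R ^ 3)) * sqrt (R / real N)"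
      proof (rule mult_mono)
        have "(L2_norm (cubic (v s)))\<^sup>2 \<le> (2 * zeta32)\<^sup>2 * hsum (coef (v s)) ^ 3" by (rule cubic_L2(2)[OF vH])
        also have "\<dots> \<le> (2 * zeta32)\<^sup>2 * R ^ 3"
          using Rv[OF sT] hsum_nonneg[OF plus_part_H_halfD(2)[OF vH]] by (intro mult_left_mono power_mono) auto
        also have "\<dots> = (2 * zeta32 * sqrt (R ^ 3))\<^sup>2" using R0 by (simp add: power_mult_distrib)
        finally show "L2_norm (cubic (v s)) \<le> 2 * zeta32 * sqrt (R ^ 3)"
          by (rule power2_le_imp_le) (use R0 zeta32_nonneg in auto)
        \<comment> \<open>The truncated solution has no frequencies from \<open>N\<close> on, so the
          tail of the error is the tail of \<open>y s\<close>.\<close>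
        have eq: "(\<lambda>z. ?w z - ?P z) = (\<lambda>z. y s z - psum (coef (y s)) N z)"
        proof -
          have "coef ?w k = coef (y s) k - x s k" for k
            using cv[OF sT] by (simp add: coef_diff yL plus_part_H_halfD(3)[OF vH])
          then have "?P z = psum (coef (y s)) N z - v s z" for z
            unfolding psum_def v_def by (simp add: left_diff_distrib sum_subtractf)
          then show ?thesis by simp
        qed
        have "(L2_norm (\<lambda>z. ?w z - ?P z))\<^sup>2 = mass (coef (\<lambda>z. y s z - psum (coef (y s)) N z))"
          unfolding eq by (rule L2_norm_mass(2)[OF plus_part_H_halfD(1)[OF tail_props(1)[OF yH N]]])
        also have "\<dots> \<le> hsum (coef (y s)) / real N" by (rule tail_props(3)[OF yH N])
        also have "\<dots> \<le> R / real N" using R[OF sT] by (intro divide_right_mono) (auto simp: y_def)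
        finally show "L2_norm (\<lambda>z. ?w z - ?P z) \<le> sqrt (R / real N)" by (rule real_le_rsqrt)
      qed (use R0 zeta32_nonneg in auto)
      finally show ?thesis .
    qed
    have "2 * Re (L2_inner ?w' ?w)
        \<le> 2 * (6 * (real j + 1) * R * f s + 48 * R\<^sup>2 / sqrt (2 ^ j) + 2 * zeta32 * sqrt (R ^ 3) * sqrt (R / real N))"
      by (intro mult_left_mono order_trans[OF 1 add_mono[OF 2 3]]) simp
    also have "\<dots> = 12 * (real j + 1) * R * f s + B j" by (simp add: B_def algebra_simps)
    finally have "2 * Re (L2_inner ?w' ?w) \<le> 12 * (real j + 1) * R * f s + B j" .
    with df show ?thesis by blast
  qed
  have B0: "0 \<le> B j" for j using R0 zeta32_nonneg by (simp add: B_def)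
  have "f T \<le> (R / real N + B j * T) * exp (12 * (real j + 1) * R * T)" for j
  proof -
    have "f T \<le> (f 0 + B j * T) * exp (12 * (real j + 1) * R * T)"
      by (rule Gronwall_linear[OF T contf _ B0 deriv]) (use R0 in auto)
    also have "\<dots> \<le> (R / real N + B j * T) * exp (12 * (real j + 1) * R * T)"
      using f0 by (intro mult_right_mono) auto
    finally show ?thesis .
  qed
  then show ?thesis
    using xmom[of T] T unfolding f_def y_def v_def B_def by (intro exI[of _ "x T"]) simp
qed

text \<open>By \<open>small\<close>, \<open>12 * R * T\<close> is at most \<open>ln 2 / 4\<close>,
  so the Gronwall factor is at most 2^((j+1)/4) and loses against the remainder of order 2^(-j/2).
  Hence the truncations converge in L2 and their coefficients converge one by one. Their momenta are
  at most that of \<open>u t\<close>, and in the limit momentum can only be lost.\<close>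

lemma momentum_local:
  assumes u: "szego_solution u" and \<sigma>: "\<sigma> = 1 \<or> \<sigma> = - 1" and T: "0 \<le> T"
    and R: "\<And>s. s \<in> {0..T} \<Longrightarrow> hsum (coef (u (t + \<sigma> * s))) \<le> R" and small: "48 * R * T \<le> ln 2"
  shows "momentum (coef (u (t + \<sigma> * T))) \<le> momentum (coef (u t))"
proof -
  note H = solution_plus[OF u]
  note hs = plus_part_H_halfD(2)[OF H]
  define y where "y = u (t + \<sigma> * T)"
  have yL: "y \<in> L2" unfolding y_def by (rule plus_part_H_halfD(3)[OF H])
  have R0: "0 \<le> R" using R[of 0] hsum_nonneg[OF hs[of t]] T by simp
  define b where "b n j = (R / real (Suc n) + (2 * (2 * zeta32 * sqrt (R ^ 3) * sqrt (R / real (Suc n))) + 96 * R\<^sup>2 / sqrt (2 ^ j)) * T)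
        * exp (12 * (real j + 1) * R * T)" for n j :: nat
  have "\<exists>X. (\<Sum>k<Suc n. real k * (cmod (X k))\<^sup>2) = (\<Sum>k<Suc n. real k * (cmod (coef (u t) k))\<^sup>2)
      \<and> (\<forall>j. (L2_norm (\<lambda>z. y z - psum X (Suc n) z))\<^sup>2 \<le> b n j)" for n
    unfolding y_def b_def by (rule Galerkin_error[OF u \<sigma> T zero_less_Suc[of n] R])
  then have "\<exists>X. \<forall>n. (\<Sum>k<Suc n. real k * (cmod (X n k))\<^sup>2) = (\<Sum>k<Suc n. real k * (cmod (coef (u t) k))\<^sup>2)
      \<and> (\<forall>j. (L2_norm (\<lambda>z. y z - psum (X n) (Suc n) z))\<^sup>2 \<le> b n j)"
    by (intro choice allI)
  then obtain X where "\<forall>n. (\<Sum>k<Suc n. real k * (cmod (X n k))\<^sup>2) = (\<Sum>k<Suc n. real k * (cmod (coef (u t) k))\<^sup>2)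
      \<and> (\<forall>j. (L2_norm (\<lambda>z. y z - psum (X n) (Suc n) z))\<^sup>2 \<le> b n j)"
    by (rule exE)
  then have X: "(\<Sum>k<Suc n. real k * (cmod (X n k))\<^sup>2) = (\<Sum>k<Suc n. real k * (cmod (coef (u t) k))\<^sup>2)"
      "(L2_norm (\<lambda>z. y z - psum (X n) (Suc n) z))\<^sup>2 \<le> b n j" for n j
    by (simp_all only:)
  define E where "E j = exp (12 * (real j + 1) * R * T)" for j :: nat
  have high: "(\<lambda>j. 96 * R\<^sup>2 / sqrt (2 ^ j) * T * E j) \<longlonglongrightarrow> 0"
  proof (rule tendsto_sandwich[OF _ _ tendsto_const])
    show "\<forall>\<^sub>F j in sequentially. 96 * R\<^sup>2 / sqrt (2 ^ j) * T * E j \<le> 96 * R\<^sup>2 * T * exp (ln 2 / 4) * exp (- (ln 2 / 4)) ^ j"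
    proof (intro always_eventually allI)
      fix j :: nat
      have "(exp (real j * (ln 2 / 2)))\<^sup>2 = (2 :: real) ^ j"
      proof -
        have "(exp (ln 2 / 2))\<^sup>2 = (2 :: real)" using exp_double[of "ln 2 / 2 :: real"] by simp
        moreover have "(exp (ln 2 / 2) ^ j)\<^sup>2 = ((exp (ln 2 / 2 :: real))\<^sup>2) ^ j"
          by (simp only: power_mult[symmetric] mult.commute[of j 2])
        ultimately show ?thesis by (simp only: exp_of_nat_mult)
      qed
      then have sq: "sqrt (2 ^ j) = exp (real j * (ln 2 / 2))"
        by (metis abs_exp_cancel real_sqrt_abs)
      have "12 * (real j + 1) * R * T = (real j + 1) * (12 * R * T)" by simp
      also have "\<dots> \<le> (real j + 1) * (ln 2 / 4)" using small by (intro mult_left_mono) auto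
      finally have "E j \<le> exp ((real j + 1) * (ln 2 / 4))" by (simp add: E_def)
      then have "96 * R\<^sup>2 / sqrt (2 ^ j) * T * E j \<le> 96 * R\<^sup>2 / sqrt (2 ^ j) * T * exp ((real j + 1) * (ln 2 / 4))"
        using T by (intro mult_left_mono) auto
      also have "\<dots> = 96 * R\<^sup>2 * T * (exp ((real j + 1) * (ln 2 / 4)) / exp (real j * (ln 2 / 2)))"
        unfolding sq by simp
      also have "exp ((real j + 1) * (ln 2 / 4)) / exp (real j * (ln 2 / 2)) = exp (ln 2 / 4 + real j * (- (ln 2 / 4)))"
        by (simp add: exp_diff[symmetric] algebra_simps)
      also have "\<dots> = exp (ln 2 / 4) * exp (- (ln 2 / 4)) ^ j"
        by (simp only: exp_add exp_of_nat_mult)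
      finally show "96 * R\<^sup>2 / sqrt (2 ^ j) * T * E j \<le> 96 * R\<^sup>2 * T * exp (ln 2 / 4) * exp (- (ln 2 / 4)) ^ j"
        by simp
    qed
    have "(\<lambda>j. exp (- (ln 2 / 4)) ^ j) \<longlonglongrightarrow> (0 :: real)" by (rule LIMSEQ_power_zero) simp
    then show "(\<lambda>j. 96 * R\<^sup>2 * T * exp (ln 2 / 4) * exp (- (ln 2 / 4)) ^ j) \<longlonglongrightarrow> 0"
      by (rule tendsto_mult_right_zero)
  qed (use T in \<open>simp add: E_def\<close>)
  have low: "(\<lambda>n. (R / real (Suc n) + 2 * (2 * zeta32 * sqrt (R ^ 3) * sqrt (R / real (Suc n))) * T) * E j) \<longlonglongrightarrow> 0" for j
  proof -
    have "(\<lambda>n. R / real (Suc n)) \<longlonglongrightarrow> 0" by (rule LIMSEQ_Suc[OF lim_const_over_n])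
    then have "(\<lambda>n. (R / real (Suc n) + 2 * (2 * zeta32 * sqrt (R ^ 3) * sqrt (R / real (Suc n))) * T) * E j)
        \<longlonglongrightarrow> (0 + 2 * (2 * zeta32 * sqrt (R ^ 3) * sqrt 0) * T) * E j"
      by (intro tendsto_intros)
    then show ?thesis by simp
  qed
  have "(\<lambda>n. (L2_norm (\<lambda>z. y z - psum (X n) (Suc n) z))\<^sup>2) \<longlonglongrightarrow> 0"
  proof (rule LIMSEQ_I)
    fix e :: real assume "0 < e"
    then have e: "0 < e / 2" by simp
    \<comment> \<open>The cut \<open>j\<close> is fixed before the truncation level, since the other
      part of the bound tends to 0 in \<open>n\<close> only for fixed \<open>j\<close>.\<close>
    obtain j where j: "96 * R\<^sup>2 / sqrt (2 ^ j) * T * E j < e / 2"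
      using order_tendstoD(2)[OF high e] by (meson eventually_happens trivial_limit_sequentially)
    obtain n0 where n0: "\<And>n. n0 \<le> n \<Longrightarrow>
        (R / real (Suc n) + 2 * (2 * zeta32 * sqrt (R ^ 3) * sqrt (R / real (Suc n))) * T) * E j < e / 2"
      using order_tendstoD(2)[OF low e, of j] unfolding eventually_sequentially by blast
    show "\<exists>n0. \<forall>n\<ge>n0. norm ((L2_norm (\<lambda>z. y z - psum (X n) (Suc n) z))\<^sup>2 - 0) < e"
    proof (intro exI[of _ n0] allI impI)
      fix n assume n: "n0 \<le> n"
      have "b n j = (R / real (Suc n) + 2 * (2 * zeta32 * sqrt (R ^ 3) * sqrt (R / real (Suc n))) * T) * E j
          + 96 * R\<^sup>2 / sqrt (2 ^ j) * T * E j"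
        unfolding b_def E_def by (simp only: distrib_right add.assoc)
      also have "\<dots> < e / 2 + e / 2" by (rule add_strict_mono[OF n0[OF n] j])
      finally have "(L2_norm (\<lambda>z. y z - psum (X n) (Suc n) z))\<^sup>2 < e" using X(2)[of n j] by linarith
      then show "norm ((L2_norm (\<lambda>z. y z - psum (X n) (Suc n) z))\<^sup>2 - 0) < e" by simp
    qed
  qed
  from tendsto_real_sqrt[OF this] have lim: "(\<lambda>n. L2_norm (\<lambda>z. y z - psum (X n) (Suc n) z)) \<longlonglongrightarrow> 0" by simp
  have Xlim: "(\<lambda>n. X n k) \<longlonglongrightarrow> coef y k" for k
  proof -
    have "(\<lambda>n. fourier (psum (X n) (Suc n)) (int k)) \<longlonglongrightarrow> coef y k"
      unfolding coef_def by (rule fourier_of_limit[OF yL L2_psum lim])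
    moreover have "\<forall>\<^sub>F n in sequentially. fourier (psum (X n) (Suc n)) (int k) = X n k"
      unfolding eventually_sequentially by (intro exI[of _ k]) (auto simp: fourier_psum)
    ultimately show ?thesis by (rule Lim_transform_eventually)
  qed
  have "(\<Sum>k<m. real k * (cmod (coef y k))\<^sup>2) \<le> momentum (coef (u t))" for m
  proof (rule LIMSEQ_le_const2)
    show "(\<lambda>n. \<Sum>k<m. real k * (cmod (X n k))\<^sup>2) \<longlonglongrightarrow> (\<Sum>k<m. real k * (cmod (coef y k))\<^sup>2)"
      by (intro tendsto_intros Xlim)
    \<comment> \<open>A finite section lies within the truncation as soon as
      \<open>m \<le> n\<close>, where the momentum is known exactly.\<close>
    show "\<exists>N. \<forall>n\<ge>N. (\<Sum>k<m. real k * (cmod (X n k))\<^sup>2) \<le> momentum (coef (u t))"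
    proof (intro exI[of _ m] allI impI)
      fix n assume "m \<le> n"
      then have "(\<Sum>k<m. real k * (cmod (X n k))\<^sup>2) \<le> (\<Sum>k<Suc n. real k * (cmod (X n k))\<^sup>2)"
        by (intro sum_mono2) auto
      also have "\<dots> \<le> momentum (coef (u t))"
        unfolding X(1) momentum_def by (intro sum_le_suminf momentum_summable hs) auto
      finally show "(\<Sum>k<m. real k * (cmod (X n k))\<^sup>2) \<le> momentum (coef (u t))" .
    qed
  qed
  then show ?thesis
    unfolding y_def[symmetric] momentum_def[of "coef y"]
    using momentum_summable[OF hs[of "t + \<sigma> * T"]] by (intro suminf_le_const) (simp_all add: y_def)
qed

text \<open>The local inequality is applied from \<open>t\<close> to \<open>t + h\<close> and back
  again. Near every \<open>t\<close> this gives equality, so the derivative is 0.\<close>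

lemma solution_momentum_const:
  assumes u: "szego_solution u"
  shows "momentum (coef (u s)) = momentum (coef (u t))"
proof -
  note H = solution_plus[OF u]
  note hs = plus_part_H_halfD(2)[OF H]
  let ?M = "\<lambda>t. momentum (coef (u t))"
  have "(?M has_real_derivative 0) (at t)" for t
  proof -
    \<comment> \<open>Bounds \<open>hsum\<close> wherever \<open>u\<close> is within distance 1 of
      \<open>u t\<close>.\<close>
    define R where "R = (sqrt (hsum (coef (u t))) + 1)\<^sup>2"
    have "0 < sqrt (hsum (coef (u t))) + 1" using hsum_nonneg[OF hs[of t]] by (simp add: add_nonneg_pos)
    then have R: "0 < R" unfolding R_def by (rule zero_less_power)
    have "\<forall>\<^sub>F h in at 0. hsum (coef (\<lambda>z. u (t + h) z - u t z)) < 1"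
      by (rule order_tendstoD(2)[OF solution_continuous[OF u]]) simp
    then obtain d where d: "0 < d" "\<And>h. h \<noteq> 0 \<Longrightarrow> \<bar>h\<bar> < d \<Longrightarrow> hsum (coef (\<lambda>z. u (t + h) z - u t z)) < 1"
      unfolding eventually_at by (auto simp: dist_real_def)
    have bound: "hsum (coef (u s)) \<le> R" if "\<bar>s - t\<bar> < d" for s
    proof -
      have "sqrt (hsum (coef (u s))) \<le> sqrt (hsum (coef (u t))) + 1"
      proof (cases "s = t")
        case False
        then have "hsum (coef (\<lambda>z. u s z - u t z)) < 1" using d(2)[of "s - t"] that by simp
        then have "sqrt (hsum (coef (\<lambda>z. u s z - u t z))) \<le> 1" using real_sqrt_le_1_iff by simp
        moreover have "coef (\<lambda>z. u s z - u t z) = (\<lambda>k. coef (u s) k - coef (u t) k)"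
          by (rule coef_diff) (rule plus_part_H_halfD(3)[OF H])+
        ultimately have "sqrt (hsum (\<lambda>k. coef (u s) k - coef (u t) k)) \<le> 1" by (simp only:)
        then show ?thesis using hsum_diff_ge[OF hs[of s] hs[of t]] by linarith
      qed simp
      then have "(sqrt (hsum (coef (u s))))\<^sup>2 \<le> R"
        unfolding R_def by (intro power_mono) (auto simp: hsum_nonneg[OF hs])
      then show ?thesis by (simp add: hsum_nonneg[OF hs])
    qed
    define d' where "d' = min d (ln 2 / (48 * R))"
    have d': "0 < d'" using d(1) R by (simp add: d'_def)
    have "?M (t + h) = ?M t" if h: "\<bar>h\<bar> < d'" for h
    proof -
      define \<sigma> where "\<sigma> = (if 0 \<le> h then 1 else - 1 :: real)"
      have \<sigma>: "\<sigma> = 1 \<or> \<sigma> = - 1" "- \<sigma> = 1 \<or> - \<sigma> = - 1" by (auto simp: \<sigma>_def)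
      have h\<sigma>: "h = \<sigma> * \<bar>h\<bar>" by (simp add: \<sigma>_def)
      have hd: "\<bar>h\<bar> < d" using h by (simp add: d'_def)
      have small: "48 * R * \<bar>h\<bar> \<le> ln 2"
        using h R by (simp add: d'_def field_simps)
      have "?M (t + \<sigma> * \<bar>h\<bar>) \<le> ?M t"
      proof (rule momentum_local[OF u \<sigma>(1) _ _ small])
        fix s assume "s \<in> {0..\<bar>h\<bar>}"
        then have "\<bar>\<sigma> * s\<bar> < d" using hd \<sigma>(1) by auto
        then show "hsum (coef (u (t + \<sigma> * s))) \<le> R" by (intro bound) simp
      qed simp
      \<comment> \<open>The way back stays between \<open>t\<close> and \<open>t + h\<close>, so the
        same bound \<open>R\<close> and the same smallness condition apply.\<close>
      moreover have "?M (t + h + - \<sigma> * \<bar>h\<bar>) \<le> ?M (t + h)"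
      proof (rule momentum_local[OF u \<sigma>(2) _ _ small])
        fix s assume s: "s \<in> {0..\<bar>h\<bar>}"
        have "t + h + - \<sigma> * s - t = \<sigma> * (\<bar>h\<bar> - s)" using h\<sigma> by (simp add: algebra_simps)
        moreover have "\<bar>\<sigma> * (\<bar>h\<bar> - s)\<bar> < d" using s hd \<sigma>(1) by auto
        ultimately show "hsum (coef (u (t + h + - \<sigma> * s))) \<le> R" by (intro bound) simp
      qed simp
      moreover have "t + h + - \<sigma> * \<bar>h\<bar> = t" using h\<sigma> by simp
      ultimately show ?thesis using h\<sigma> by simp
    qed
    then have "\<forall>\<^sub>F h in at 0. (?M (t + h) - ?M t) / h = 0"
      unfolding eventually_at using d' by (intro exI[of _ d']) (simp add: dist_real_def)
    then show ?thesis unfolding DERIV_def by (rule tendsto_eventually)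
  qed
  then show ?thesis using DERIV_isconst_all[of ?M] by blast
qed

section \<open>Sequences with small deficit\<close>

definition geom :: "complex \<Rightarrow> complex \<Rightarrow> nat \<Rightarrow> complex" where
  "geom \<alpha> p k = \<alpha> * p ^ k"

lemma geom_mass:
  assumes "cmod p < 1"
  shows "l2_summable (geom \<alpha> p)" "mass (geom \<alpha> p) = (cmod \<alpha>)\<^sup>2 / (1 - (cmod p)\<^sup>2)"
proof -
  have "norm ((cmod p)\<^sup>2) < 1" using assms by (simp add: power_less_one_iff abs_square_less_1)
  from sums_mult[OF geometric_sums[OF this], of "(cmod \<alpha>)\<^sup>2"]
  have "(\<lambda>k. (cmod (geom \<alpha> p k))\<^sup>2) sums ((cmod \<alpha>)\<^sup>2 / (1 - (cmod p)\<^sup>2))"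
    by (simp add: geom_def norm_mult norm_power power_mult_distrib flip: power_mult) (simp add: mult.commute)
  then show "l2_summable (geom \<alpha> p)" "mass (geom \<alpha> p) = (cmod \<alpha>)\<^sup>2 / (1 - (cmod p)\<^sup>2)"
    by (auto simp: l2_summable_def mass_def sums_iff)
qed

lemma weighted_geometric_sums:
  fixes x :: real
  assumes "\<bar>x\<bar> < 1"
  shows "(\<lambda>k. (real k + 1) * x ^ k) sums (1 / (1 - x)\<^sup>2)"
  using geometric_deriv_sums[of x] assms by (simp add: add.commute)

lemma geom_hsum:
  assumes "cmod p < 1"
  shows "h_summable (geom \<alpha> p)" "hsum (geom \<alpha> p) = (cmod \<alpha>)\<^sup>2 / (1 - (cmod p)\<^sup>2)\<^sup>2"
proof -
  have "\<bar>(cmod p)\<^sup>2\<bar> < 1" using assms by (simp add: power_less_one_iff abs_square_less_1)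
  from sums_mult[OF weighted_geometric_sums[OF this], of "(cmod \<alpha>)\<^sup>2"]
  have "(\<lambda>k. (cmod \<alpha>)\<^sup>2 * ((real k + 1) * ((cmod p)\<^sup>2) ^ k)) sums ((cmod \<alpha>)\<^sup>2 / (1 - (cmod p)\<^sup>2)\<^sup>2)"
    by simp
  moreover have "(cmod \<alpha>)\<^sup>2 * ((real k + 1) * ((cmod p)\<^sup>2) ^ k) = (real k + 1) * (cmod (geom \<alpha> p k))\<^sup>2" for k
    by (simp add: geom_def norm_mult norm_power power_mult_distrib flip: power_mult) (simp add: mult.commute)
  ultimately have "(\<lambda>k. (real k + 1) * (cmod (geom \<alpha> p k))\<^sup>2) sums ((cmod \<alpha>)\<^sup>2 / (1 - (cmod p)\<^sup>2)\<^sup>2)"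
    by (simp only:)
  then show "h_summable (geom \<alpha> p)" "hsum (geom \<alpha> p) = (cmod \<alpha>)\<^sup>2 / (1 - (cmod p)\<^sup>2)\<^sup>2"
    by (auto simp: h_summable_def hsum_def sums_iff)
qed

lemma geom_mult: "l \<le> k \<Longrightarrow> geom \<alpha> p l * geom \<alpha> p (k - l) = \<alpha> * geom \<alpha> p k"
  by (simp add: geom_def mult_ac flip: power_add)

text \<open>The equality case of Cauchy--Schwarz: on each antidiagonal all products of a geometric
  sequence coincide.\<close>

lemma geom_deficit:
  assumes "cmod p < 1"
  shows "deficit (geom \<alpha> p) = 0"
proof -
  let ?c = "geom \<alpha> p"
  have "conv ?c ?c k = of_nat (k + 1) * (\<alpha> * ?c k)" for k
    by (simp add: conv_def geom_mult)
  then have "(real k + 1) * (\<Sum>l\<le>k. (cmod (?c l * ?c (k - l)))\<^sup>2) - (cmod (conv ?c ?c k))\<^sup>2 = 0" for k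
  proof -
    assume c: "\<And>k. conv ?c ?c k = of_nat (k + 1) * (\<alpha> * ?c k)"
    have "cmod (conv ?c ?c k) = (real k + 1) * cmod (\<alpha> * ?c k)"
      unfolding c norm_mult[of "of_nat (k + 1)"] norm_of_nat by simp
    moreover have "(\<Sum>l\<le>k. (cmod (?c l * ?c (k - l)))\<^sup>2) = (real k + 1) * (cmod (\<alpha> * ?c k))\<^sup>2"
      by (simp add: geom_mult)
    ultimately show ?thesis by (simp add: power2_eq_square)
  qed
  then show ?thesis using deficit_sums[OF geom_hsum(1)[OF assms, of \<alpha>]] by (simp add: sums_iff)
qed

text \<open>For \<open>cmod p < 1\<close> the geometric series converges uniformly on the circle,
  where \<open>1 - p * z\<close> has modulus at least \<open>1 - cmod p\<close>.\<close>

lemma soliton_coef: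
  assumes p: "cmod p < 1"
  shows "soliton \<alpha> p \<in> plus_part H_half" "coef (soliton \<alpha> p) = geom \<alpha> p"
proof -
  let ?f = "soliton \<alpha> p"
  have nz: "cmod (1 - p * z) \<ge> 1 - cmod p" if "cmod z = 1" for z
    using norm_triangle_ineq2[of 1 "p * z"] that by (simp add: norm_mult)
  have nz': "1 - p * z \<noteq> 0" if "cmod z = 1" for z using nz[OF that] p by auto
  have fL: "?f \<in> L2"
    unfolding soliton_def[abs_def]
    by (intro continuous_L2 continuous_intros) (use nz' in auto)
  have bound: "L2_norm (\<lambda>z. ?f z - psum (geom \<alpha> p) n z) \<le> cmod \<alpha> / (1 - cmod p) * cmod p ^ n" for n
  proof (rule L2_norm_le_const[OF L2_diff[OF fL L2_psum]])
    show "0 \<le> cmod \<alpha> / (1 - cmod p) * cmod p ^ n" using p by simp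
    fix z :: complex assume "z \<in> sphere 0 1"
    then have z: "cmod z = 1" by simp
    have "psum (geom \<alpha> p) n z = \<alpha> * (\<Sum>k<n. (p * z) ^ k)"
      by (simp add: psum_def geom_def sum_distrib_left power_mult_distrib mult_ac)
    also have "(\<Sum>k<n. (p * z) ^ k) = (1 - (p * z) ^ n) / (1 - p * z)"
      using nz'[OF z] by (subst sum_gp_strict) auto
    finally have "?f z - psum (geom \<alpha> p) n z = \<alpha> * (p * z) ^ n / (1 - p * z)"
      using nz'[OF z] by (simp add: soliton_def field_simps)
    then have "cmod (?f z - psum (geom \<alpha> p) n z) = cmod \<alpha> * cmod p ^ n / cmod (1 - p * z)"
      using z by (simp add: norm_divide norm_mult norm_power)
    also have "\<dots> \<le> cmod \<alpha> * cmod p ^ n / (1 - cmod p)"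
      using nz[OF z] p by (intro divide_left_mono mult_pos_pos) auto
    finally show "cmod (?f z - psum (geom \<alpha> p) n z) \<le> cmod \<alpha> / (1 - cmod p) * cmod p ^ n" by simp
  qed
  have lim: "(\<lambda>n. L2_norm (\<lambda>z. ?f z - psum (geom \<alpha> p) n z)) \<longlonglongrightarrow> 0"
  proof (rule tendsto_sandwich[OF _ _ tendsto_const])
    show "\<forall>\<^sub>F n in sequentially. L2_norm (\<lambda>z. ?f z - psum (geom \<alpha> p) n z) \<le> cmod \<alpha> / (1 - cmod p) * cmod p ^ n"
      using bound by simp
    show "(\<lambda>n. cmod \<alpha> / (1 - cmod p) * cmod p ^ n) \<longlonglongrightarrow> 0"
      using p by (intro tendsto_mult_right_zero LIMSEQ_power_zero) simp
  qed simp
  have f: "fourier ?f k = (if k < 0 then 0 else geom \<alpha> p (nat k))" for k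
  proof -
    have "\<forall>\<^sub>F n in sequentially. fourier (psum (geom \<alpha> p) n) k = (if k < 0 then 0 else geom \<alpha> p (nat k))"
      unfolding eventually_sequentially by (intro exI[of _ "Suc (nat k)"]) (auto simp: fourier_psum)
    then have "(\<lambda>n. fourier (psum (geom \<alpha> p) n) k) \<longlonglongrightarrow> (if k < 0 then 0 else geom \<alpha> p (nat k))"
      by (rule tendsto_eventually)
    then show ?thesis using fourier_of_limit[OF fL L2_psum lim] LIMSEQ_unique by blast
  qed
  show c: "coef ?f = geom \<alpha> p" by (simp add: coef_def[abs_def] f)
  show "?f \<in> plus_part H_half"
    unfolding plus_part_H_half_iff c using geom_hsum(1)[OF p] fL by (simp add: plus_part_def f)
qed

lemma L2_set_norm_triangle:
  "L2_set (\<lambda>i. cmod (f i)) S \<le> L2_set (\<lambda>i. cmod (f i - g i)) S + L2_set (\<lambda>i. cmod (g i)) S"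
proof -
  have "L2_set (\<lambda>i. cmod (f i)) S \<le> L2_set (\<lambda>i. cmod (f i - g i) + cmod (g i)) S"
    by (rule L2_set_mono) (use norm_triangle_sub in \<open>auto simp: add.commute\<close>)
  also have "\<dots> \<le> L2_set (\<lambda>i. cmod (f i - g i)) S + L2_set (\<lambda>i. cmod (g i)) S"
    by (rule L2_set_triangle_ineq)
  finally show ?thesis .
qed

text \<open>In Hilbert--Schmidt norm, \<open>deficit c\<close> controls the distance between the rank one array
  \<open>c l * c m\<close> and the Hankel array \<open>c 0 * c (l + m)\<close>, whose norms are \<open>mass c\<close> and
  \<open>cmod (c 0) * sqrt (hsum c)\<close>.\<close>

lemma deficit_mass_hsum:
  assumes c: "h_summable c"
  shows "\<bar>mass c - cmod (c 0) * sqrt (hsum c)\<bar> \<le> sqrt (deficit c)"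
proof -
  define S where "S n = Sigma {..<n} (\<lambda>k. {..k})" for n :: nat
  define f where "f = (\<lambda>(k, l). c l * c (k - l))"
  \<comment> \<open>Constant in \<open>l\<close>, so that index \<open>k\<close> is counted
    \<open>k + 1\<close> times; this produces \<open>hsum\<close>.\<close>
  define g where "g = (\<lambda>(k, l :: nat). c 0 * c k)"
  have L: "L2_set (\<lambda>i. cmod (h i)) (S n) = sqrt (\<Sum>k<n. \<Sum>l\<le>k. (cmod (h (k, l)))\<^sup>2)" for h n
    unfolding L2_set_def S_def by (subst sum.Sigma) (auto simp: case_prod_unfold)
  have m: "summable (\<lambda>k. norm ((cmod (c k))\<^sup>2))" using h_summable_imp_l2_summable[OF c] by (simp add: l2_summable_def)
  have "(\<lambda>n. \<Sum>k<n. \<Sum>l\<le>k. (cmod (c l))\<^sup>2 * (cmod (c (k - l)))\<^sup>2) \<longlonglongrightarrow> mass c * mass c"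
    using Cauchy_product_sums[OF m m] unfolding sums_def mass_def .
  then have "(\<lambda>n. sqrt (\<Sum>k<n. \<Sum>l\<le>k. (cmod (c l))\<^sup>2 * (cmod (c (k - l)))\<^sup>2)) \<longlonglongrightarrow> sqrt (mass c * mass c)"
    by (rule tendsto_real_sqrt)
  then have flim: "(\<lambda>n. L2_set (\<lambda>i. cmod (f i)) (S n)) \<longlonglongrightarrow> mass c"
    unfolding L f_def using mass_nonneg[OF h_summable_imp_l2_summable[OF c]]
    by (simp add: norm_mult power_mult_distrib)
  have "(\<lambda>n. \<Sum>k<n. (real k + 1) * (cmod (c k))\<^sup>2) \<longlonglongrightarrow> hsum c"
    using summable_LIMSEQ c unfolding h_summable_def hsum_def by blast
  then have "(\<lambda>n. sqrt ((cmod (c 0))\<^sup>2 * (\<Sum>k<n. (real k + 1) * (cmod (c k))\<^sup>2))) \<longlonglongrightarrow> sqrt ((cmod (c 0))\<^sup>2 * hsum c)"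
    by (intro tendsto_intros)
  moreover have "(\<Sum>k<n. \<Sum>l\<le>k. (cmod (g (k, l)))\<^sup>2) = (cmod (c 0))\<^sup>2 * (\<Sum>k<n. (real k + 1) * (cmod (c k))\<^sup>2)" for n
    unfolding sum_distrib_left g_def by (rule sum.cong[OF refl]) (simp add: norm_mult power_mult_distrib)
  ultimately have glim: "(\<lambda>n. L2_set (\<lambda>i. cmod (g i)) (S n)) \<longlonglongrightarrow> cmod (c 0) * sqrt (hsum c)"
    unfolding L by (simp add: real_sqrt_mult)
  have d: "L2_set (\<lambda>i. cmod (f i - g i)) (S n) \<le> sqrt (deficit c)" for n
    unfolding L[of "\<lambda>i. f i - g i"] using deficit_bound[OF c, of n] by (simp add: f_def g_def)
  have d': "L2_set (\<lambda>i. cmod (g i - f i)) (S n) \<le> sqrt (deficit c)" for n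
    using d[of n] by (simp add: norm_minus_commute)
  have "mass c \<le> sqrt (deficit c) + cmod (c 0) * sqrt (hsum c)"
  proof (rule LIMSEQ_le[OF flim tendsto_add[OF tendsto_const glim]])
    show "\<exists>N. \<forall>n\<ge>N. L2_set (\<lambda>i. cmod (f i)) (S n) \<le> sqrt (deficit c) + L2_set (\<lambda>i. cmod (g i)) (S n)"
      using order_trans[OF L2_set_norm_triangle[of f _ g] add_right_mono[OF d]] by blast
  qed
  moreover have "cmod (c 0) * sqrt (hsum c) \<le> sqrt (deficit c) + mass c"
  proof (rule LIMSEQ_le[OF glim tendsto_add[OF tendsto_const flim]])
    show "\<exists>N. \<forall>n\<ge>N. L2_set (\<lambda>i. cmod (g i)) (S n) \<le> sqrt (deficit c) + L2_set (\<lambda>i. cmod (f i)) (S n)"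
      using order_trans[OF L2_set_norm_triangle[of g _ f] add_right_mono[OF d']] by blast
  qed
  ultimately show ?thesis by linarith
qed

section \<open>Distance to the geometric sequence with the same first two terms\<close>

lemma mass_shift:
  assumes "l2_summable c"
  shows "l2_summable (\<lambda>k. c (Suc k))" "mass (\<lambda>k. c (Suc k)) = mass c - (cmod (c 0))\<^sup>2"
proof -
  have s: "summable (\<lambda>k. (cmod (c k))\<^sup>2)" using assms by (simp add: l2_summable_def)
  show "l2_summable (\<lambda>k. c (Suc k))"
    unfolding l2_summable_def using s summable_Suc_iff[of "\<lambda>k. (cmod (c k))\<^sup>2"] by simp
  show "mass (\<lambda>k. c (Suc k)) = mass c - (cmod (c 0))\<^sup>2"
    unfolding mass_def using suminf_split_head[OF s] by simp
qed

text \<open>From each antidiagonal only the entry \<open>c k * c 1\<close> is kept. It shows that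
  \<open>c\<close> nearly obeys the recursion \<open>c 0 * c (Suc k) = c 1 * c k\<close> of a
  geometric sequence.\<close>

lemma deficit_row_one:
  assumes c: "h_summable c"
  shows "mass (\<lambda>k. c 1 * c k - c 0 * c (Suc k)) \<le> deficit c"
proof -
  note l2 = h_summable_imp_l2_summable[OF c]
  have s: "l2_summable (\<lambda>k. c 1 * c k - c 0 * c (Suc k))"
    by (intro l2_summable_diff l2_summable_cmult mass_shift l2)
  have "(\<Sum>l<n. (cmod (c 1 * c l - c 0 * c (Suc l)))\<^sup>2) \<le> deficit c" for n
  proof -
    have "(\<Sum>l<n. (cmod (c 1 * c l - c 0 * c (Suc l)))\<^sup>2)
      \<le> (\<Sum>k<n. \<Sum>l\<le>Suc k. (cmod (c l * c (Suc k - l) - c 0 * c (Suc k)))\<^sup>2)"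
    proof (rule sum_mono)
      fix k
      have "(cmod (c 1 * c k - c 0 * c (Suc k)))\<^sup>2 = (cmod (c k * c (Suc k - k) - c 0 * c (Suc k)))\<^sup>2"
        by (simp add: mult.commute Suc_diff_le)
      also have "\<dots> \<le> (\<Sum>l\<le>Suc k. (cmod (c l * c (Suc k - l) - c 0 * c (Suc k)))\<^sup>2)"
        by (rule member_le_sum[where f = "\<lambda>l. (cmod (c l * c (Suc k - l) - c 0 * c (Suc k)))\<^sup>2"]) auto
      finally show "(cmod (c 1 * c k - c 0 * c (Suc k)))\<^sup>2
        \<le> (\<Sum>l\<le>Suc k. (cmod (c l * c (Suc k - l) - c 0 * c (Suc k)))\<^sup>2)" .
    qed
    also have "\<dots> \<le> (\<Sum>k<Suc n. \<Sum>l\<le>k. (cmod (c l * c (k - l) - c 0 * c k))\<^sup>2)"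
      by (subst sum.lessThan_Suc_shift) simp
    also have "\<dots> \<le> deficit c" by (rule deficit_bound[OF c])
    finally show ?thesis .
  qed
  then show ?thesis unfolding mass_def using s by (intro suminf_le_const) (auto simp: l2_summable_def)
qed

text \<open>Compares the norms of the two sides of the recursion behind
  \<open>deficit_row_one\<close>. Once the mass and the modulus of \<open>c 0\<close> are known,
  this determines the modulus of \<open>c 1\<close>.\<close>

lemma deficit_ratio:
  assumes c: "h_summable c"
  shows "\<bar>cmod (c 1) * sqrt (mass c) - cmod (c 0) * sqrt (mass c - (cmod (c 0))\<^sup>2)\<bar> \<le> sqrt (deficit c)"
proof -
  note l2 = h_summable_imp_l2_summable[OF c]
  have "\<bar>sqrt (mass (\<lambda>k. c 1 * c k)) - sqrt (mass (\<lambda>k. c 0 * c (Suc k)))\<bar>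
      \<le> sqrt (mass (\<lambda>k. c 1 * c k - c 0 * c (Suc k)))"
    by (intro mass_diff_ge l2_summable_cmult mass_shift l2)
  also have "\<dots> \<le> sqrt (deficit c)" by (intro real_sqrt_le_mono deficit_row_one c)
  finally show ?thesis
    by (simp add: mass_cmult l2 mass_shift real_sqrt_mult)
qed

text \<open>The error \<open>w\<close> vanishes at 0 and satisfies
  \<open>w (Suc k) = p * w k + e k\<close> with \<open>p = c 1 / c 0\<close>. Dropping its zero
  first term does not change its norm, and since \<open>cmod p < 1\<close> the term with
  \<open>p\<close> is absorbed on the left.\<close>

lemma deficit_geom_mass:
  assumes c: "h_summable c" and c0: "c 0 \<noteq> 0" and p: "cmod (c 1 / c 0) < 1"
  shows "sqrt (mass (\<lambda>k. c k - geom (c 0) (c 1 / c 0) k)) \<le> sqrt (deficit c) / (cmod (c 0) * (1 - cmod (c 1 / c 0)))"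
proof -
  note l2 = h_summable_imp_l2_summable[OF c]
  let ?p = "c 1 / c 0"
  define w where "w k = c k - geom (c 0) ?p k" for k
  define e where "e k = c (Suc k) - ?p * c k" for k
  have w: "l2_summable w" unfolding w_def[abs_def] by (intro l2_summable_diff l2 geom_mass p)
  have e: "l2_summable e" unfolding e_def[abs_def] by (intro l2_summable_diff l2_summable_cmult mass_shift l2)
  have wSuc: "w (Suc k) = ?p * w k + e k" for k
    by (simp add: w_def e_def geom_def right_diff_distrib)
  have "sqrt (mass w) = sqrt (mass (\<lambda>k. w (Suc k)))"
    using mass_shift(2)[OF w] by (simp add: w_def[of 0] geom_def)
  also have "\<dots> \<le> sqrt (mass (\<lambda>k. ?p * w k)) + sqrt (mass e)"
    unfolding wSuc by (intro l2_summable_triangle l2_summable_cmult w e)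
  also have "sqrt (mass (\<lambda>k. ?p * w k)) = cmod ?p * sqrt (mass w)"
    by (simp only: mass_cmult[OF w] real_sqrt_mult real_sqrt_abs abs_norm_cancel)
  finally have 1: "(1 - cmod ?p) * sqrt (mass w) \<le> sqrt (mass e)" by (simp add: algebra_simps)
  have "cmod (c 0) * sqrt (mass e) = sqrt (mass (\<lambda>k. (- c 0) * e k))"
    by (simp only: mass_cmult[OF e] real_sqrt_mult) simp
  also have "(\<lambda>k. (- c 0) * e k) = (\<lambda>k. c 1 * c k - c 0 * c (Suc k))"
    using c0 by (simp add: e_def fun_eq_iff field_simps)
  also have "sqrt (mass \<dots>) \<le> sqrt (deficit c)" by (intro real_sqrt_le_mono deficit_row_one c)
  finally have 2: "cmod (c 0) * sqrt (mass e) \<le> sqrt (deficit c)" .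
  have "cmod (c 0) * ((1 - cmod ?p) * sqrt (mass w)) \<le> sqrt (deficit c)"
    using mult_left_mono[OF 1, of "cmod (c 0)"] 2 by simp
  moreover have "0 < cmod (c 0) * (1 - cmod ?p)" using c0 p by (intro mult_pos_pos) auto
  ultimately show ?thesis unfolding w_def[symmetric]
    by (subst pos_le_divide_eq) (simp_all only: mult.commute mult.left_commute mult.assoc)
qed

lemma norm_add3_square: "(cmod (x + y + z))\<^sup>2 \<le> 3 * ((cmod x)\<^sup>2 + (cmod y)\<^sup>2 + (cmod z)\<^sup>2)"
proof -
  have "cmod (x + y + z) \<le> cmod x + cmod y + cmod z"
    using norm_triangle_ineq[of "x + y" z] norm_triangle_ineq[of x y] by linarith
  then have "(cmod (x + y + z))\<^sup>2 \<le> (cmod x + cmod y + cmod z)\<^sup>2" by (intro power_mono) auto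
  also have "\<dots> \<le> 3 * ((cmod x)\<^sup>2 + (cmod y)\<^sup>2 + (cmod z)\<^sup>2)"
    using sum_squares_bound[of "cmod x" "cmod y"] sum_squares_bound[of "cmod x" "cmod z"]
      sum_squares_bound[of "cmod y" "cmod z"] by (simp add: power2_eq_square algebra_simps)
  finally show ?thesis .
qed

lemma sum_product_le_mass:
  assumes "l2_summable a" "l2_summable b"
  shows "(\<Sum>k<n. \<Sum>l\<le>k. (cmod (a l * b (k - l)))\<^sup>2) \<le> mass a * mass b"
proof -
  have "(\<lambda>k. \<Sum>l\<le>k. (cmod (a l))\<^sup>2 * (cmod (b (k - l)))\<^sup>2) sums (mass a * mass b)"
    unfolding mass_def by (rule Cauchy_product_sums) (use assms in \<open>simp_all add: l2_summable_def\<close>)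
  then show ?thesis
    using sum_le_suminf[of "\<lambda>k. \<Sum>l\<le>k. (cmod (a l))\<^sup>2 * (cmod (b (k - l)))\<^sup>2" "{..<n}"]
    by (simp add: sums_iff norm_mult power_mult_distrib sum_nonneg)
qed

text \<open>Upgrades closeness in mass to closeness in the weighted norm. For every
  \<open>l \<le> k\<close>, \<open>c 0 * w k\<close> is a deficit entry up to sign plus two products
  with one factor \<open>w\<close>. Summation over \<open>l\<close> creates the weight
  \<open>k + 1\<close> on the left, while the products on the right cost masses only.\<close>

lemma deficit_geom_hsum:
  fixes c :: "nat \<Rightarrow> complex"
  defines "\<phi> \<equiv> geom (c 0) (c 1 / c 0)"
  defines "w \<equiv> \<lambda>k. c k - \<phi> k"
  assumes c: "h_summable c" and p: "cmod (c 1 / c 0) < 1"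
  shows "(cmod (c 0))\<^sup>2 * hsum w \<le> 3 * (deficit c + mass w * mass c + mass \<phi> * mass w)"
proof -
  note l2 = h_summable_imp_l2_summable[OF c]
  have \<phi>: "l2_summable \<phi>" "h_summable \<phi>" unfolding \<phi>_def by (intro geom_mass geom_hsum p)+
  have w: "l2_summable w" "h_summable w" unfolding w_def by (intro l2_summable_diff h_summable_diff l2 c \<phi>)+
  have "(\<Sum>k<n. (cmod (c 0))\<^sup>2 * ((real k + 1) * (cmod (w k))\<^sup>2)) \<le> 3 * (deficit c + mass w * mass c + mass \<phi> * mass w)" for n
  proof -
    have "(\<Sum>k<n. (cmod (c 0))\<^sup>2 * ((real k + 1) * (cmod (w k))\<^sup>2)) = (\<Sum>k<n. \<Sum>l\<le>k. (cmod (c 0 * w k))\<^sup>2)"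
      by (simp add: norm_mult power_mult_distrib mult_ac add.commute)
    also have "\<dots> \<le> (\<Sum>k<n. \<Sum>l\<le>k. 3 * ((cmod (c l * c (k - l) - c 0 * c k))\<^sup>2 + (cmod (w l * c (k - l)))\<^sup>2 + (cmod (\<phi> l * w (k - l)))\<^sup>2))"
    proof (intro sum_mono)
      fix k l :: nat assume "l \<in> {..k}"
      then have "c 0 * w k = - (c l * c (k - l) - c 0 * c k) + w l * c (k - l) + \<phi> l * w (k - l)"
        using geom_mult[of l k "c 0" "c 1 / c 0"] by (simp add: w_def \<phi>_def algebra_simps)
      then show "(cmod (c 0 * w k))\<^sup>2 \<le> 3 * ((cmod (c l * c (k - l) - c 0 * c k))\<^sup>2 + (cmod (w l * c (k - l)))\<^sup>2 + (cmod (\<phi> l * w (k - l)))\<^sup>2)"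
        using norm_add3_square[of "- (c l * c (k - l) - c 0 * c k)" "w l * c (k - l)" "\<phi> l * w (k - l)"]
        by (simp only: norm_minus_cancel)
    qed
    also have "\<dots> = 3 * ((\<Sum>k<n. \<Sum>l\<le>k. (cmod (c l * c (k - l) - c 0 * c k))\<^sup>2)
        + (\<Sum>k<n. \<Sum>l\<le>k. (cmod (w l * c (k - l)))\<^sup>2) + (\<Sum>k<n. \<Sum>l\<le>k. (cmod (\<phi> l * w (k - l)))\<^sup>2))"
      by (simp only: sum_distrib_left[symmetric] sum.distrib)
    also have "\<dots> \<le> 3 * (deficit c + mass w * mass c + mass \<phi> * mass w)"
      by (intro mult_left_mono add_mono deficit_bound sum_product_le_mass c l2 w \<phi>) simp
    finally show ?thesis .
  qed
  then have "(\<Sum>k. (cmod (c 0))\<^sup>2 * ((real k + 1) * (cmod (w k))\<^sup>2)) \<le> 3 * (deficit c + mass w * mass c + mass \<phi> * mass w)"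
    using w(2) by (intro suminf_le_const) (simp_all add: h_summable_def summable_mult)
  then show ?thesis using w(2) by (simp add: hsum_def h_summable_def suminf_mult)
qed

text \<open>The comparison point on the torus keeps the phases of \<open>x\<close> and
  \<open>p\<close>. The difference is then a real sequence times unimodular factors, so that only
  moduli enter.\<close>

lemma geom_same_phase_hsum:
  assumes "x \<noteq> 0" "p \<noteq> 0" "cmod p < 1" "0 < a" "0 < r" "r < 1"
  shows "hsum (\<lambda>k. geom x p k - geom (of_real a * sgn x) (of_real r * sgn p) k)
    = (cmod x)\<^sup>2 / (1 - (cmod p)\<^sup>2)\<^sup>2 - 2 * cmod x * a / (1 - cmod p * r)\<^sup>2 + a\<^sup>2 / (1 - r\<^sup>2)\<^sup>2"
proof -
  have x: "x = of_real (cmod x) * sgn x" and p: "p = of_real (cmod p) * sgn p"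
    using assms by (simp_all add: sgn_eq)
  have sgn1: "cmod (sgn x) = 1" "cmod (sgn p) = 1" using assms by (simp_all add: norm_sgn)
  have "geom x p k - geom (of_real a * sgn x) (of_real r * sgn p) k
      = of_real (cmod x * cmod p ^ k - a * r ^ k) * (sgn x * sgn p ^ k)" for k
  proof -
    have "geom x p k = (of_real (cmod x) * sgn x) * (of_real (cmod p) * sgn p) ^ k"
      unfolding geom_def using x p by simp
    then show ?thesis by (simp add: geom_def power_mult_distrib algebra_simps)
  qed
  then have sq: "(cmod (geom x p k - geom (of_real a * sgn x) (of_real r * sgn p) k))\<^sup>2
      = (cmod x * cmod p ^ k - a * r ^ k)\<^sup>2" for k
    by (simp only: norm_mult norm_power sgn1 norm_of_real) simp
  have b: "\<bar>(cmod p)\<^sup>2\<bar> < 1" "\<bar>cmod p * r\<bar> < 1" "\<bar>r\<^sup>2\<bar> < 1"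
  proof -
    show "\<bar>(cmod p)\<^sup>2\<bar> < 1" "\<bar>r\<^sup>2\<bar> < 1" using assms by (simp_all add: abs_square_less_1)
    have "cmod p * r < 1 * 1" using assms by (intro mult_strict_mono) auto
    then show "\<bar>cmod p * r\<bar> < 1" using assms by (simp add: abs_mult)
  qed
  have "(\<lambda>k. (cmod x)\<^sup>2 * ((real k + 1) * ((cmod p)\<^sup>2) ^ k) - (2 * cmod x * a) * ((real k + 1) * (cmod p * r) ^ k)
      + a\<^sup>2 * ((real k + 1) * (r\<^sup>2) ^ k)) sums
      ((cmod x)\<^sup>2 * (1 / (1 - (cmod p)\<^sup>2)\<^sup>2) - (2 * cmod x * a) * (1 / (1 - cmod p * r)\<^sup>2) + a\<^sup>2 * (1 / (1 - r\<^sup>2)\<^sup>2))"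
    by (intro sums_add sums_diff sums_mult weighted_geometric_sums b)
  moreover have "(cmod x)\<^sup>2 * ((real k + 1) * ((cmod p)\<^sup>2) ^ k) - (2 * cmod x * a) * ((real k + 1) * (cmod p * r) ^ k)
      + a\<^sup>2 * ((real k + 1) * (r\<^sup>2) ^ k) = (real k + 1) * (cmod x * cmod p ^ k - a * r ^ k)\<^sup>2" for k
  proof -
    have "((cmod p)\<^sup>2) ^ k = (cmod p ^ k)\<^sup>2" "(r\<^sup>2) ^ k = (r ^ k)\<^sup>2"
      by (simp_all only: power_mult[symmetric] mult.commute[of 2 k])
    then show ?thesis by (simp add: power_mult_distrib power2_eq_square algebra_simps)
  qed
  ultimately show ?thesis unfolding hsum_def sq by (simp add: sums_iff)
qed

section \<open>Orbital stability\<close>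

text \<open>Phases may vary freely with \<open>n\<close>; only moduli have limits. The Hankel
  comparison fixes the modulus of \<open>c n 0\<close> and the recursion that of the ratio. The
  geometric sequence through the first two coefficients is then close to \<open>c n\<close>, and in
  the end its moduli are moved to \<open>a\<close> and \<open>r\<close> with the phases
  kept.\<close>

lemma soliton_distance_limit:
  fixes c :: "nat \<Rightarrow> nat \<Rightarrow> complex" and a r :: real
  assumes a: "0 < a" and r: "0 < r" "r < 1"
    and c: "\<And>n. h_summable (c n)"
    and mass: "(\<lambda>n. mass (c n)) \<longlonglongrightarrow> a\<^sup>2 / (1 - r\<^sup>2)"
    and hsum: "(\<lambda>n. hsum (c n)) \<longlonglongrightarrow> a\<^sup>2 / (1 - r\<^sup>2)\<^sup>2"
    and deficit: "(\<lambda>n. deficit (c n)) \<longlonglongrightarrow> 0" and e: "0 < e"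
  shows "\<forall>\<^sub>F n in sequentially. \<exists>\<alpha> p. cmod \<alpha> = a \<and> cmod p = r \<and>
    h_summable (geom \<alpha> p) \<and> sqrt (hsum (\<lambda>k. c n k - geom \<alpha> p k)) < e"
proof -
  have r2: "0 < 1 - r\<^sup>2" using r by (simp add: power_less_one_iff abs_square_less_1)
  define q where "q = a\<^sup>2 / (1 - r\<^sup>2)"
  have q: "0 < q" using a r2 by (simp add: q_def)
  \<comment> \<open>For a soliton the mass divided by the root of \<open>hsum\<close> is
    \<open>a\<close>. The identity for \<open>q\<close> minus the square of \<open>a\<close> turns
    \<open>deficit_ratio\<close> into the limit \<open>r\<close> for the ratio.\<close>
  have hq: "sqrt (a\<^sup>2 / (1 - r\<^sup>2)\<^sup>2) = q / a" "q / (q / a) = a" "q - a\<^sup>2 = r\<^sup>2 * q"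
  proof -
    have "sqrt (a\<^sup>2 / (1 - r\<^sup>2)\<^sup>2) = a / (1 - r\<^sup>2)"
      using a r2 by (simp add: real_sqrt_divide)
    then show "sqrt (a\<^sup>2 / (1 - r\<^sup>2)\<^sup>2) = q / a"
      using a by (simp add: q_def power2_eq_square)
    show "q / (q / a) = a" using q by simp
    show "q - a\<^sup>2 = r\<^sup>2 * q" using r2 by (simp add: q_def field_simps)
  qed
  have sd: "(\<lambda>n. sqrt (deficit (c n))) \<longlonglongrightarrow> 0" using tendsto_real_sqrt[OF deficit] by simp
  have m: "(\<lambda>n. mass (c n)) \<longlonglongrightarrow> q" using mass by (simp add: q_def)
  define x where "x n = cmod (c n 0)" for n
  have "(\<lambda>n. mass (c n) - x n * sqrt (hsum (c n))) \<longlonglongrightarrow> 0"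
    by (rule Lim_null_comparison[OF _ sd]) (use deficit_mass_hsum[OF c] in \<open>simp add: x_def\<close>)
  from tendsto_diff[OF m this] have xh: "(\<lambda>n. x n * sqrt (hsum (c n))) \<longlonglongrightarrow> q" by simp
  have sh: "(\<lambda>n. sqrt (hsum (c n))) \<longlonglongrightarrow> q / a" using tendsto_real_sqrt[OF hsum] hq by simp
  have qa: "q / a \<noteq> 0" using q a by simp
  have x: "x \<longlonglongrightarrow> a"
  proof (rule Lim_transform_eventually)
    show "(\<lambda>n. x n * sqrt (hsum (c n)) / sqrt (hsum (c n))) \<longlonglongrightarrow> a"
      using tendsto_divide[OF xh sh qa] hq by simp
    have "\<forall>\<^sub>F n in sequentially. sqrt (hsum (c n)) \<noteq> 0" by (rule tendsto_imp_eventually_ne[OF sh qa])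
    then show "\<forall>\<^sub>F n in sequentially. x n * sqrt (hsum (c n)) / sqrt (hsum (c n)) = x n"
      by eventually_elim simp
  qed
  define p where "p n = c n 1 / c n 0" for n
  have evx: "\<forall>\<^sub>F n in sequentially. 0 < x n" using order_tendstoD(1)[OF x a] .
  have P: "(\<lambda>n. cmod (p n)) \<longlonglongrightarrow> r"
  proof -
    have "(\<lambda>n. cmod (c n 1) * sqrt (mass (c n)) - x n * sqrt (mass (c n) - (x n)\<^sup>2)) \<longlonglongrightarrow> 0"
      by (rule Lim_null_comparison[OF _ sd]) (use deficit_ratio[OF c] in \<open>simp add: x_def\<close>)
    moreover have "(\<lambda>n. x n * sqrt (mass (c n) - (x n)\<^sup>2)) \<longlonglongrightarrow> a * sqrt (q - a\<^sup>2)"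
      by (intro tendsto_intros x m)
    ultimately have "(\<lambda>n. cmod (c n 1) * sqrt (mass (c n)) - x n * sqrt (mass (c n) - (x n)\<^sup>2) + x n * sqrt (mass (c n) - (x n)\<^sup>2))
        \<longlonglongrightarrow> 0 + a * sqrt (q - a\<^sup>2)"
      by (rule tendsto_add)
    then have 1: "(\<lambda>n. cmod (c n 1) * sqrt (mass (c n))) \<longlonglongrightarrow> a * (r * sqrt q)"
      using r q by (simp add: hq real_sqrt_mult)
    have 2: "(\<lambda>n. x n * sqrt (mass (c n))) \<longlonglongrightarrow> a * sqrt q" by (intro tendsto_intros x m)
    have nz: "a * sqrt q \<noteq> 0" using a q by simp
    have "(\<lambda>n. (cmod (c n 1) * sqrt (mass (c n))) / (x n * sqrt (mass (c n)))) \<longlonglongrightarrow> r"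
      using tendsto_divide[OF 1 2 nz] a q by simp
    moreover have "\<forall>\<^sub>F n in sequentially. x n * sqrt (mass (c n)) \<noteq> 0"
      by (rule tendsto_imp_eventually_ne[OF 2 nz])
    then have "\<forall>\<^sub>F n in sequentially. (cmod (c n 1) * sqrt (mass (c n))) / (x n * sqrt (mass (c n))) = cmod (p n)"
      by eventually_elim (simp add: p_def x_def norm_divide)
    ultimately show ?thesis by (rule Lim_transform_eventually)
  qed
  have evp: "\<forall>\<^sub>F n in sequentially. 0 < cmod (p n)" "\<forall>\<^sub>F n in sequentially. cmod (p n) < 1"
    by (rule order_tendstoD(1)[OF P r(1)], rule order_tendstoD(2)[OF P r(2)])
  define \<phi> where "\<phi> n = geom (c n 0) (p n)" for n
  define w where "w n k = c n k - \<phi> n k" for n k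
  have W: "\<forall>\<^sub>F n in sequentially. sqrt (mass (w n)) \<le> sqrt (deficit (c n)) / (x n * (1 - cmod (p n)))"
    using evx evp(2)
  proof eventually_elim
    case (elim n)
    then show ?case using deficit_geom_mass[OF c[of n]] by (auto simp: w_def[abs_def] \<phi>_def p_def x_def)
  qed
  have wl2: "\<forall>\<^sub>F n in sequentially. l2_summable (w n) \<and> h_summable (w n) \<and> h_summable (\<phi> n)"
    using evp(2)
  proof eventually_elim
    case (elim n)
    then show ?case unfolding w_def[abs_def] \<phi>_def
      by (intro conjI l2_summable_diff h_summable_diff h_summable_imp_l2_summable c geom_hsum)
  qed
  have "(\<lambda>n. sqrt (deficit (c n)) / (x n * (1 - cmod (p n)))) \<longlonglongrightarrow> 0 / (a * (1 - r))"
    using a r by (intro tendsto_intros sd x P) auto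
  then have ratio: "(\<lambda>n. sqrt (deficit (c n)) / (x n * (1 - cmod (p n)))) \<longlonglongrightarrow> 0" by simp
  have sw: "(\<lambda>n. sqrt (mass (w n))) \<longlonglongrightarrow> 0"
  proof (rule Lim_null_comparison[OF _ ratio])
    show "\<forall>\<^sub>F n in sequentially. norm (sqrt (mass (w n))) \<le> sqrt (deficit (c n)) / (x n * (1 - cmod (p n)))"
      using W wl2 by eventually_elim (simp add: mass_nonneg)
  qed
  have mw: "(\<lambda>n. mass (w n)) \<longlonglongrightarrow> 0"
  proof (rule Lim_transform_eventually)
    show "(\<lambda>n. (sqrt (mass (w n)))\<^sup>2) \<longlonglongrightarrow> 0" using tendsto_power[OF sw, of 2] by simp
    show "\<forall>\<^sub>F n in sequentially. (sqrt (mass (w n)))\<^sup>2 = mass (w n)"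
      using wl2 by eventually_elim (simp add: mass_nonneg)
  qed
  have mphi: "(\<lambda>n. mass (\<phi> n)) \<longlonglongrightarrow> a\<^sup>2 / (1 - r\<^sup>2)"
  proof (rule Lim_transform_eventually)
    show "(\<lambda>n. (x n)\<^sup>2 / (1 - (cmod (p n))\<^sup>2)) \<longlonglongrightarrow> a\<^sup>2 / (1 - r\<^sup>2)"
      using r2 by (intro tendsto_intros x P) auto
    show "\<forall>\<^sub>F n in sequentially. (x n)\<^sup>2 / (1 - (cmod (p n))\<^sup>2) = mass (\<phi> n)"
      using evp(2) by eventually_elim (simp add: \<phi>_def geom_mass x_def)
  qed
  have hw: "(\<lambda>n. hsum (w n)) \<longlonglongrightarrow> 0"
  proof (rule Lim_null_comparison)
    show "\<forall>\<^sub>F n in sequentially. norm (hsum (w n))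
        \<le> 3 * (deficit (c n) + mass (w n) * mass (c n) + mass (\<phi> n) * mass (w n)) / (x n)\<^sup>2"
      using evx evp(2) wl2
    proof eventually_elim
      case (elim n)
      then have "(x n)\<^sup>2 * hsum (w n) \<le> 3 * (deficit (c n) + mass (w n) * mass (c n) + mass (\<phi> n) * mass (w n))"
        using deficit_geom_hsum[OF c[of n]] by (simp add: w_def[abs_def] \<phi>_def p_def x_def)
      moreover have "0 \<le> hsum (w n)" using elim by (simp add: hsum_nonneg)
      ultimately show ?case using elim(1) by (simp add: field_simps)
    qed
    have "(\<lambda>n. 3 * (deficit (c n) + mass (w n) * mass (c n) + mass (\<phi> n) * mass (w n)) / (x n)\<^sup>2)
        \<longlonglongrightarrow> 3 * (0 + 0 * q + a\<^sup>2 / (1 - r\<^sup>2) * 0) / a\<^sup>2"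
      using a by (intro tendsto_intros deficit mw m mphi x) auto
    then show "(\<lambda>n. 3 * (deficit (c n) + mass (w n) * mass (c n) + mass (\<phi> n) * mass (w n)) / (x n)\<^sup>2) \<longlonglongrightarrow> 0"
      by simp
  qed
  define \<psi> where "\<psi> n = geom (of_real a * sgn (c n 0)) (of_real r * sgn (p n))" for n
  define g where "g n = (x n)\<^sup>2 / (1 - (cmod (p n))\<^sup>2)\<^sup>2 - 2 * x n * a / (1 - cmod (p n) * r)\<^sup>2 + a\<^sup>2 / (1 - r\<^sup>2)\<^sup>2" for n
  have "g \<longlonglongrightarrow> a\<^sup>2 / (1 - r\<^sup>2)\<^sup>2 - 2 * a * a / (1 - r * r)\<^sup>2 + a\<^sup>2 / (1 - r\<^sup>2)\<^sup>2"
    unfolding g_def[abs_def] using r2 by (intro tendsto_intros x P) (auto simp: power2_eq_square)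
  then have g: "g \<longlonglongrightarrow> 0" by (simp add: power2_eq_square field_simps)
  have "(\<lambda>n. sqrt (hsum (w n)) + sqrt (g n)) \<longlonglongrightarrow> sqrt 0 + sqrt 0" by (intro tendsto_intros hw g)
  then have "\<forall>\<^sub>F n in sequentially. sqrt (hsum (w n)) + sqrt (g n) < e"
    using order_tendstoD(2)[of _ "sqrt 0 + sqrt 0"] e by simp
  then show ?thesis using evx evp wl2
  proof eventually_elim
    case (elim n)
    have nz: "c n 0 \<noteq> 0" "p n \<noteq> 0" using elim by (auto simp: x_def)
    have norms: "cmod (of_real a * sgn (c n 0)) = a" "cmod (of_real r * sgn (p n)) = r"
      using nz a r by (simp_all add: norm_mult norm_sgn)
    have \<psi>: "h_summable (\<psi> n)" unfolding \<psi>_def by (rule geom_hsum) (use norms r in simp)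
    have gn: "hsum (\<lambda>k. \<phi> n k - \<psi> n k) = g n"
      unfolding \<phi>_def \<psi>_def g_def x_def by (rule geom_same_phase_hsum) (use nz elim a r in auto)
    have "sqrt (hsum (\<lambda>k. w n k + (\<phi> n k - \<psi> n k))) \<le> sqrt (hsum (w n)) + sqrt (hsum (\<lambda>k. \<phi> n k - \<psi> n k))"
      using elim \<psi> by (intro hsum_add_sqrt h_summable_diff) auto
    then have "sqrt (hsum (\<lambda>k. c n k - \<psi> n k)) < e"
      using elim(1) by (simp add: gn w_def)
    then show ?case using norms \<psi> unfolding \<psi>_def by blast
  qed
qed

section \<open>Continuity of the invariants\<close>

lemma conv_square_diff:
  "conv a a k - conv b b k = conv (\<lambda>k. a k - b k) (\<lambda>k. a k + b k) k"
proof -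
  have "(\<Sum>l\<le>k. a l * b (k - l)) = (\<Sum>l\<le>k. b l * a (k - l))"
    using sum.nat_diff_reindex[of "\<lambda>l. b l * a (k - l)" "Suc k"]
    by (simp add: lessThan_Suc_atMost mult.commute)
  then show ?thesis
    by (simp add: conv_def algebra_simps sum.distrib sum_subtractf)
qed

text \<open>\<open>sqrt (mass (conv a a))\<close> is the squared L4 norm, and the factorisation of a
  difference of squares makes it locally Lipschitz in the weighted norm.\<close>

lemma mass_conv_diff:
  assumes a: "h_summable a" and b: "h_summable b"
  shows "\<bar>sqrt (mass (conv a a)) - sqrt (mass (conv b b))\<bar>
    \<le> sqrt (2 * zeta32 * (hsum (\<lambda>k. a k - b k) * (sqrt (hsum a) + sqrt (hsum b))\<^sup>2))"
proof -
  have "\<bar>sqrt (mass (conv a a)) - sqrt (mass (conv b b))\<bar> \<le> sqrt (mass (\<lambda>k. conv a a k - conv b b k))"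
    by (intro mass_diff_ge conv_l2 a b)
  also have "(\<lambda>k. conv a a k - conv b b k) = conv (\<lambda>k. a k - b k) (\<lambda>k. a k + b k)"
    by (rule ext) (rule conv_square_diff)
  also have "mass \<dots> \<le> 2 * zeta32 * (hsum (\<lambda>k. a k - b k) * hsum (\<lambda>k. a k + b k))"
    by (intro conv_l2 h_summable_diff h_summable_add a b)
  also have "\<dots> \<le> 2 * zeta32 * (hsum (\<lambda>k. a k - b k) * (sqrt (hsum a) + sqrt (hsum b))\<^sup>2)"
  proof -
    have "(sqrt (hsum (\<lambda>k. a k + b k)))\<^sup>2 \<le> (sqrt (hsum a) + sqrt (hsum b))\<^sup>2"
      by (intro power_mono hsum_add_sqrt a b) (simp add: hsum_nonneg h_summable_add a b)
    then show ?thesis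
      using zeta32_nonneg by (intro mult_left_mono) (auto simp: hsum_nonneg h_summable_add h_summable_diff a b)
  qed
  finally show ?thesis by simp
qed

text \<open>The parameters \<open>\<alpha> n\<close> and \<open>p n\<close> need not converge. The
  invariants of a soliton depend on the moduli alone and so are the same for all \<open>n\<close>;
  continuity in the weighted norm does the rest.\<close>

lemma invariants_near_soliton:
  fixes d :: "nat \<Rightarrow> nat \<Rightarrow> complex" and a r :: real
  assumes r: "0 < r" "r < 1" and d: "\<And>n. h_summable (d n)"
    and \<alpha>: "\<And>n. cmod (\<alpha> n) = a" and p: "\<And>n. cmod (p n) = r"
    and lim: "(\<lambda>n. hsum (\<lambda>k. d n k - geom (\<alpha> n) (p n) k)) \<longlonglongrightarrow> 0"
  shows "(\<lambda>n. mass (d n)) \<longlonglongrightarrow> a\<^sup>2 / (1 - r\<^sup>2)" "(\<lambda>n. hsum (d n)) \<longlonglongrightarrow> a\<^sup>2 / (1 - r\<^sup>2)\<^sup>2"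
    "(\<lambda>n. deficit (d n)) \<longlonglongrightarrow> 0"
proof -
  have r2: "0 < 1 - r\<^sup>2" using r by (simp add: power_less_one_iff abs_square_less_1)
  define \<phi> where "\<phi> n = geom (\<alpha> n) (p n)" for n
  define q h where "q = a\<^sup>2 / (1 - r\<^sup>2)" and "h = a\<^sup>2 / (1 - r\<^sup>2)\<^sup>2"
  have p1: "cmod (p n) < 1" for n using p r by simp
  have \<phi>: "h_summable (\<phi> n)" "mass (\<phi> n) = q" "hsum (\<phi> n) = h" "deficit (\<phi> n) = 0" for n
    unfolding \<phi>_def q_def h_def using geom_hsum[OF p1] geom_mass[OF p1] geom_deficit[OF p1] \<alpha> p by simp_all
  have q0: "0 \<le> q" "0 \<le> h" using r2 by (simp_all add: q_def h_def)
  have lim': "(\<lambda>n. hsum (\<lambda>k. d n k - \<phi> n k)) \<longlonglongrightarrow> 0" using lim by (simp add: \<phi>_def)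
  then have slim: "(\<lambda>n. sqrt (hsum (\<lambda>k. d n k - \<phi> n k))) \<longlonglongrightarrow> 0" using tendsto_real_sqrt[OF lim'] by simp
  have dphi: "h_summable (\<lambda>k. d n k - \<phi> n k)" for n by (intro h_summable_diff d \<phi>)
  have square: "f \<longlonglongrightarrow> l" if "(\<lambda>n. sqrt (f n) - sqrt l) \<longlonglongrightarrow> 0" "\<And>n. 0 \<le> f n" "0 \<le> l" for f :: "nat \<Rightarrow> real" and l
  proof -
    have "(\<lambda>n. (sqrt (f n) - sqrt l + sqrt l)\<^sup>2) \<longlonglongrightarrow> (0 + sqrt l)\<^sup>2" by (intro tendsto_intros that)
    then show ?thesis using that(2,3) by simp
  qed
  have "(\<lambda>n. sqrt (hsum (d n)) - sqrt h) \<longlonglongrightarrow> 0"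
    by (rule Lim_null_comparison[OF _ slim]) (use hsum_diff_ge[OF d \<phi>(1)] \<phi>(3) in simp)
  then have hs: "(\<lambda>n. hsum (d n)) \<longlonglongrightarrow> h" by (rule square) (simp_all add: hsum_nonneg d q0)
  have "\<bar>sqrt (mass (d n)) - sqrt q\<bar> \<le> sqrt (hsum (\<lambda>k. d n k - \<phi> n k))" for n
    using mass_diff_ge[OF h_summable_imp_l2_summable[OF d] h_summable_imp_l2_summable[OF \<phi>(1)], of n n]
      real_sqrt_le_mono[OF mass_le_hsum[OF dphi[of n]]] unfolding \<phi>(2) by linarith
  then have "(\<lambda>n. sqrt (mass (d n)) - sqrt q) \<longlonglongrightarrow> 0"
    by (intro Lim_null_comparison[OF _ slim]) simp
  then have ms: "(\<lambda>n. mass (d n)) \<longlonglongrightarrow> q"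
    by (rule square) (simp_all add: mass_nonneg h_summable_imp_l2_summable d q0)
  \<comment> \<open>The energy of the solitons, obtained from their vanishing deficit instead of
    summing the series of \<open>conv\<close>.\<close>
  define E where "E = q\<^sup>2 + 2 * (h - q) * q"
  have mom: "momentum c = hsum c - mass c" if "h_summable c" for c
    using hsum_eq_momentum_mass[OF that] by simp
  have E: "mass (conv (\<phi> n) (\<phi> n)) = E" for n
    using \<phi>(4)[of n] by (simp add: deficit_def E_def mom \<phi>)
  have E0: "0 \<le> E" using E mass_nonneg[OF conv_l2(1)[OF \<phi>(1) \<phi>(1)]] by metis
  have "(\<lambda>n. sqrt (mass (conv (d n) (d n))) - sqrt E) \<longlonglongrightarrow> 0"
  proof (rule Lim_null_comparison)
    show "\<forall>\<^sub>F n in sequentially. norm (sqrt (mass (conv (d n) (d n))) - sqrt E)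
        \<le> sqrt (2 * zeta32 * (hsum (\<lambda>k. d n k - \<phi> n k) * (sqrt (hsum (d n)) + sqrt h)\<^sup>2))"
      using mass_conv_diff[OF d \<phi>(1)] \<phi>(3) E by (intro always_eventually allI) (metis real_norm_def)
    have "(\<lambda>n. sqrt (2 * zeta32 * (hsum (\<lambda>k. d n k - \<phi> n k) * (sqrt (hsum (d n)) + sqrt h)\<^sup>2)))
        \<longlonglongrightarrow> sqrt (2 * zeta32 * (0 * (sqrt h + sqrt h)\<^sup>2))"
      by (intro tendsto_intros lim' hs)
    then show "(\<lambda>n. sqrt (2 * zeta32 * (hsum (\<lambda>k. d n k - \<phi> n k) * (sqrt (hsum (d n)) + sqrt h)\<^sup>2))) \<longlonglongrightarrow> 0"
      by simp
  qed
  then have es: "(\<lambda>n. mass (conv (d n) (d n))) \<longlonglongrightarrow> E"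
    by (rule square) (simp_all add: mass_nonneg conv_l2 d E0)
  have "(\<lambda>n. (mass (d n))\<^sup>2 + 2 * (hsum (d n) - mass (d n)) * mass (d n) - mass (conv (d n) (d n)))
      \<longlonglongrightarrow> q\<^sup>2 + 2 * (h - q) * q - E"
    by (intro tendsto_intros ms hs es)
  then show "(\<lambda>n. deficit (d n)) \<longlonglongrightarrow> 0" by (simp add: deficit_def mom d E_def)
  show "(\<lambda>n. mass (d n)) \<longlonglongrightarrow> a\<^sup>2 / (1 - r\<^sup>2)" using ms by (simp add: q_def)
  show "(\<lambda>n. hsum (d n)) \<longlonglongrightarrow> a\<^sup>2 / (1 - r\<^sup>2)\<^sup>2" using hs by (simp add: h_def)
qed

section \<open>The distance to the torus as an infimum\<close>

lemma torus_distance: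
  assumes "u \<in> plus_part H_half" "cmod p < 1"
  shows "H_half_norm (\<lambda>z. u z - soliton \<alpha> p z) = sqrt (hsum (\<lambda>k. coef u k - geom \<alpha> p k))"
  using soliton_coef[OF assms(2), of \<alpha>] plus_part_H_halfD(3)[OF assms(1)]
  by (simp add: H_half_norm_hsum coef_diff plus_part_H_halfD(3))

lemma torus_INF_less:
  assumes u: "u \<in> plus_part H_half" and ar: "0 < a" "0 < r" "r < 1"
    and less: "(INF \<phi>\<in>soliton_torus a r. H_half_norm (\<lambda>z. u z - \<phi> z)) < e"
  shows "\<exists>\<alpha> p. cmod \<alpha> = a \<and> cmod p = r \<and> sqrt (hsum (\<lambda>k. coef u k - geom \<alpha> p k)) < e"
proof -
  have "soliton (of_real a) (of_real r) \<in> soliton_torus a r"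
    unfolding soliton_torus_def using ar by (intro CollectI exI conjI) auto
  then have ne: "soliton_torus a r \<noteq> {}" by blast
  obtain \<phi> where \<phi>: "\<phi> \<in> soliton_torus a r" "H_half_norm (\<lambda>z. u z - \<phi> z) < e"
  proof -
    have "\<exists>y\<in>(\<lambda>\<phi>. H_half_norm (\<lambda>z. u z - \<phi> z)) ` soliton_torus a r. y < e"
      by (rule cInf_lessD[OF _ less]) (use ne in simp)
    then show ?thesis using that by blast
  qed
  then obtain \<alpha> p where "\<phi> = soliton \<alpha> p" "cmod \<alpha> = a" "cmod p = r"
    unfolding soliton_torus_def by blast
  then show ?thesis using \<phi>(2) torus_distance[OF u, of p \<alpha>] ar by auto
qed

lemma torus_INF_le:
  assumes u: "u \<in> plus_part H_half" and r: "r < 1" and \<alpha>: "cmod \<alpha> = a" "cmod p = r"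
  shows "(INF \<phi>\<in>soliton_torus a r. H_half_norm (\<lambda>z. u z - \<phi> z)) \<le> sqrt (hsum (\<lambda>k. coef u k - geom \<alpha> p k))"
proof -
  have "(INF \<phi>\<in>soliton_torus a r. H_half_norm (\<lambda>z. u z - \<phi> z)) \<le> H_half_norm (\<lambda>z. u z - soliton \<alpha> p z)"
  proof (rule cINF_lower)
    show "bdd_below ((\<lambda>\<phi>. H_half_norm (\<lambda>z. u z - \<phi> z)) ` soliton_torus a r)"
    proof (rule bdd_belowI2)
      fix \<phi> assume "\<phi> \<in> soliton_torus a r"
      then obtain \<alpha> p where "\<phi> = soliton \<alpha> p" "cmod p < 1" unfolding soliton_torus_def using r by auto
      then show "0 \<le> H_half_norm (\<lambda>z. u z - \<phi> z)"
        using torus_distance[OF u] geom_hsum(1) plus_part_H_halfD(2)[OF u]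
        by (simp add: hsum_nonneg h_summable_diff)
    qed
    show "soliton \<alpha> p \<in> soliton_torus a r" using \<alpha> unfolding soliton_torus_def by blast
  qed
  then show ?thesis using torus_distance[OF u, of p \<alpha>] r \<alpha> by simp
qed

lemma solution_deficit_const:
  assumes u: "szego_solution u"
  shows "deficit (coef (u s)) = deficit (coef (u t))"
  using solution_mass_const[OF u, of s t] solution_momentum_const[OF u, of s t]
    solution_energy_const[OF u, of s t] energy_eq_mass_conv(2)[OF solution_plus[OF u]]
  by (simp add: deficit_def)

text \<open>If no \<open>\<delta>\<close> worked, data ever closer to the torus would lead to times
  \<open>t n\<close> at distance more than \<open>\<epsilon>\<close>. Conservation makes the
  invariants at these times converge to those of the solitons, however the \<open>t n\<close>
  behave, and \<open>soliton_distance_limit\<close> rules this out. Forming the supremum in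
  \<open>ereal\<close> makes it meaningful before boundedness in time is known.\<close>

theorem corollary4:
  fixes a r :: real
  assumes "a > 0" and "0 < r" and "r < 1"
  shows "\<forall>\<epsilon>::real. \<epsilon> > 0 \<longrightarrow> (\<exists>\<delta>::real. \<delta> > 0 \<and> (\<forall>u0 \<in> plus_part H_half.
           (INF \<phi>\<in>soliton_torus a r. H_half_norm (\<lambda>z. u0 z - \<phi> z)) \<le> \<delta> \<longrightarrow>
           (\<forall>u. szego_solution u \<and> (AE z in circle. u 0 z = u0 z) \<longrightarrow>
             (SUP t. ereal (INF \<phi>\<in>soliton_torus a r. H_half_norm (\<lambda>z. u t z - \<phi> z))) \<le> ereal \<epsilon>)))"
proof (intro allI impI, rule ccontr)
  define dist where "dist u = (INF \<phi>\<in>soliton_torus a r. H_half_norm (\<lambda>z. u z - \<phi> z))" for u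
  fix \<epsilon> :: real
  assume \<epsilon>: "0 < \<epsilon>"
  assume "\<not> (\<exists>\<delta>>0. \<forall>u0\<in>plus_part H_half.
      (INF \<phi>\<in>soliton_torus a r. H_half_norm (\<lambda>z. u0 z - \<phi> z)) \<le> \<delta> \<longrightarrow>
      (\<forall>u. szego_solution u \<and> (AE z in circle. u 0 z = u0 z) \<longrightarrow>
        (SUP t. ereal (INF \<phi>\<in>soliton_torus a r. H_half_norm (\<lambda>z. u t z - \<phi> z))) \<le> ereal \<epsilon>))"
  then have neg: "\<exists>u0\<in>plus_part H_half. dist u0 \<le> \<delta> \<and> (\<exists>u. szego_solution u \<and> (AE z in circle. u 0 z = u0 z) \<and>
      \<not> (SUP t. ereal (dist (u t))) \<le> ereal \<epsilon>)" if "0 < \<delta>" for \<delta>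
    unfolding dist_def using that by blast
  define P where "P n u t \<alpha> p \<longleftrightarrow> szego_solution u \<and> \<epsilon> < dist (u t) \<and> cmod \<alpha> = a \<and> cmod p = r
      \<and> sqrt (hsum (\<lambda>k. coef (u 0) k - geom \<alpha> p k)) < 2 / real (Suc n)" for n u t \<alpha> p
  have "\<forall>n. \<exists>u t \<alpha> p. P n u t \<alpha> p"
  proof
    fix n
    obtain u0 u where u0: "u0 \<in> plus_part H_half" "dist u0 \<le> 1 / real (Suc n)"
      and u: "szego_solution u" "AE z in circle. u 0 z = u0 z" "\<not> (SUP t. ereal (dist (u t))) \<le> ereal \<epsilon>"
      using neg[of "1 / real (Suc n)"] by auto
    obtain t where t: "\<epsilon> < dist (u t)"
    proof (rule ccontr)
      assume "\<not> thesis"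
      then have "dist (u t) \<le> \<epsilon>" for t using that[of t] by (meson not_less)
      then have "(SUP t. ereal (dist (u t))) \<le> ereal \<epsilon>" by (intro SUP_least) simp
      with u(3) show False by contradiction
    qed
    \<comment> \<open>Doubling the bound makes the inequality strict, so that
      \<open>torus_INF_less\<close> yields an actual point of the torus.\<close>
    have "1 / real (Suc n) < 2 / real (Suc n)" by (intro divide_strict_right_mono) auto
    then have "dist u0 < 2 / real (Suc n)" using u0(2) by linarith
    then obtain \<alpha> p where "cmod \<alpha> = a" "cmod p = r" "sqrt (hsum (\<lambda>k. coef u0 k - geom \<alpha> p k)) < 2 / real (Suc n)"
      using torus_INF_less[OF u0(1) assms] unfolding dist_def by blast
    moreover have "coef (u 0) = coef u0"
      unfolding coef_def[abs_def]
      using fourier_cong_AE[OF u(2)] plus_part_H_halfD(3)[OF solution_plus[OF u(1)]] plus_part_H_halfD(3)[OF u0(1)]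
      by simp
    ultimately have "P n u t \<alpha> p" using u(1) t unfolding P_def by (simp only:)
    then show "\<exists>u t \<alpha> p. P n u t \<alpha> p" by blast
  qed
  then have "\<exists>u t \<alpha> p. \<forall>n. P n (u n) (t n) (\<alpha> n) (p n)" by (simp only: choice_iff)
  then obtain u t \<alpha> p where "\<forall>n. P n (u n) (t n) (\<alpha> n) (p n)" by blast
  then have S: "\<And>n. szego_solution (u n)" and far: "\<And>n. \<epsilon> < dist (u n (t n))"
    and \<alpha>p: "\<And>n. cmod (\<alpha> n) = a" "\<And>n. cmod (p n) = r"
    and near: "\<And>n. sqrt (hsum (\<lambda>k. coef (u n 0) k - geom (\<alpha> n) (p n) k)) < 2 / real (Suc n)"
    unfolding P_def by blast+
  note H = solution_plus[OF S]
  note hs = plus_part_H_halfD(2)[OF H]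
  have diff: "h_summable (\<lambda>k. coef (u n 0) k - geom (\<alpha> n) (p n) k)" for n
    by (intro h_summable_diff hs geom_hsum) (use \<alpha>p assms in simp)
  have "(\<lambda>n. sqrt (hsum (\<lambda>k. coef (u n 0) k - geom (\<alpha> n) (p n) k))) \<longlonglongrightarrow> 0"
  proof (rule Lim_null_comparison)
    show "\<forall>\<^sub>F n in sequentially. norm (sqrt (hsum (\<lambda>k. coef (u n 0) k - geom (\<alpha> n) (p n) k))) \<le> 2 / real (Suc n)"
      using near hsum_nonneg[OF diff] by (simp add: less_imp_le)
    show "(\<lambda>n. 2 / real (Suc n)) \<longlonglongrightarrow> 0" by (rule LIMSEQ_Suc[OF lim_const_over_n])
  qed
  then have "(\<lambda>n. (sqrt (hsum (\<lambda>k. coef (u n 0) k - geom (\<alpha> n) (p n) k)))\<^sup>2) \<longlonglongrightarrow> 0\<^sup>2" by (intro tendsto_intros)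
  then have lim: "(\<lambda>n. hsum (\<lambda>k. coef (u n 0) k - geom (\<alpha> n) (p n) k)) \<longlonglongrightarrow> 0"
    using hsum_nonneg[OF diff] by simp
  note inv = invariants_near_soliton[OF assms(2,3) hs \<alpha>p lim]
  have mass: "mass (coef (u n (t n))) = mass (coef (u n 0))" for n by (rule solution_mass_const[OF S])
  have hsum: "hsum (coef (u n (t n))) = hsum (coef (u n 0))" for n
    using solution_momentum_const[OF S] mass by (simp add: hsum_eq_momentum_mass[OF hs])
  have deficit: "deficit (coef (u n (t n))) = deficit (coef (u n 0))" for n
    by (rule solution_deficit_const[OF S])
  have "\<forall>\<^sub>F n in sequentially. \<exists>\<alpha> p. cmod \<alpha> = a \<and> cmod p = r \<and>
    h_summable (geom \<alpha> p) \<and> sqrt (hsum (\<lambda>k. coef (u n (t n)) k - geom \<alpha> p k)) < \<epsilon>"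
    by (rule soliton_distance_limit[OF assms hs _ _ _ \<epsilon>]) (use inv in \<open>simp_all add: mass hsum deficit\<close>)
  then obtain n \<alpha> p where "cmod \<alpha> = a" "cmod p = r" "sqrt (hsum (\<lambda>k. coef (u n (t n)) k - geom \<alpha> p k)) < \<epsilon>"
    by (auto dest: eventually_happens)
  then show False using torus_INF_le[OF H assms(3), of \<alpha> a p n "t n"] far[of n] unfolding dist_def by linarith
qed

end
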